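(* Let $J$ be a 5-dimensional coordinate space with coordinates $(x,y,z,p,q)$, with contact form $\varpi=\mathrm{d}z-p\,\mathrm{d}x-q\,\mathrm{d}y$ and symmetric 4-tensor (structural tensor) \begin{align*} \Upsilon&=81\,\mathrm{d}p^4+216\,\mathrm{d}p^3\mathrm{d}x+216\,\mathrm{d}p^2\mathrm{d}q\,\mathrm{d}y+144\,\mathrm{d}p^2\mathrm{d}x^2+24\,\mathrm{d}p\,\mathrm{d}q^3\\ &\quad+288\,\mathrm{d}p\,\mathrm{d}q\,\mathrm{d}x\,\mathrm{d}y-384\,\mathrm{d}p\,\mathrm{d}y^3+32\,\mathrm{d}q^3\mathrm{d}x-48\,\mathrm{d}q^2\mathrm{d}y^2, \end{align*} which is the contact structure of type $G_2$ associated to the solution of Noth's equation parametrized by $(t,H)=\left(\frac{2s^{2/3}}{1+2s},-\frac{4s^{1/3}}{1+2s}\right)$. Then the symmetry algebra of $[\varpi,\Upsilon]$ is the split simple Lie algebra $\mathfrak{g}_2$ (of dimension 14), and it is spanned by the following 14 vector fields: \begin{align*} S^1&=-(\tfrac3{16}q^2+\tfrac32xy+\tfrac98py)\partial_x-(\tfrac38pq+\tfrac12y^2+\tfrac12qx)\partial_y-(\tfrac9{16}p^2y+\tfrac14q^2x+\tfrac38q^2p+\tfrac32yz)\partial_z\\ &\quad+\tfrac14q^2\partial_p+(-\tfrac32z+\tfrac32px-\tfrac12qy+\tfrac9{16}p^2)\partial_q,\\ L^2&=-(\tfrac94px+\tfrac{27}{32}p^2-\tfrac34z+x^2+\tfrac34qy)\partial_x-(\tfrac34py+xy)\partial_y\\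 &\quad-(\tfrac98p^2x+\tfrac9{16}p^3+xz+\tfrac34pqy+\tfrac23y^3)\partial_z-(z-px-qy-\tfrac38p^2)\partial_p-2y^2\partial_q,\\ S^3&=-\tfrac38q\,\partial_x-(\tfrac38p+\tfrac12x)\partial_y-(\tfrac38pq+y^2)\partial_z+\tfrac12q\,\partial_p-2y\,\partial_q,\\ L^4&=-\tfrac34\partial_x+x\,\partial_z+\partial_p,\quad S^5=y\,\partial_z+\partial_q,\quad L^6=\partial_z,\quad S^7=\partial_y,\quad L^8=\partial_x,\\ S^9&=3y\,\partial_x+q\,\partial_y+\tfrac12q^2\partial_z-3p\,\partial_q,\\ L^{10}&=(3z+\tfrac{27}8p^2)\partial_x+\tfrac12q^2\partial_y+(\tfrac94p^3+\tfrac13q^3)\partial_z-3p^2\partial_p-3pq\,\partial_q,\\ S^{11}&=(-6y^2+\tfrac94qp)\partial_x+(3z+\tfrac98p^2-4qy)\partial_y+(\tfrac94p^2q-2yq^2)\partial_z-3pq\,\partial_p+(12py-q^2)\partial_q,\\ L^{12}&=-(3zx+\tfrac18q^3+\tfrac94pqy-2y^3+\tfrac{27}8p^2x+\tfrac{27}{16}p^3)\partial_x\\ &\quad-(3yz+\tfrac12q^2x+\tfrac38pq^2-2qy^2+\tfrac98p^2y)\partial_y\\ &\quad-(\tfrac94p^3x+\tfrac13xq^3+3z^2+\tfrac38q^3p-q^2y^2+\tfrac94qyp^2+\tfrac{81}{64}p^4)\partial_z\\ &\quad+(-3pz+3p^2x+3pqy+\tfrac16q^3+\tfrac98p^3)\partial_p+(-3qz+3pqx+\tfrac98p^2q-6py^2+q^2y)\partial_q,\\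 h_1&=(\tfrac94p+\tfrac32x)\partial_x+\tfrac12y\,\partial_y+\tfrac98p^2\partial_z-\tfrac32p\,\partial_p-\tfrac12q\,\partial_q,\\ h_2&=\tfrac{\sqrt3}{2}(x\,\partial_x+y\,\partial_y+2z\,\partial_z+p\,\partial_p+q\,\partial_q). \end{align*} Moreover, with the Cartan subalgebra spanned by $h_1$ and $h_2$, the other twelve vector fields are root vectors: each such $X$ satisfies $[h_1,X]=a_XX$ and $[h_2,X]=b_XX$, where the roots $(a_X,b_X)$ are $S^1:(\tfrac12,\tfrac{\sqrt3}2)$, $L^2:(\tfrac32,\tfrac{\sqrt3}2)$, $S^3:(1,0)$, $L^4:(\tfrac32,-\tfrac{\sqrt3}2)$, $S^5:(\tfrac12,-\tfrac{\sqrt3}2)$, $L^6:(0,-\sqrt3)$, $S^7:(-\tfrac12,-\tfrac{\sqrt3}2)$, $L^8:(-\tfrac32,-\tfrac{\sqrt3}2)$, $S^9:(-1,0)$, $L^{10}:(-\tfrac32,\tfrac{\sqrt3}2)$, $S^{11}:(-\tfrac12,\tfrac{\sqrt3}2)$, $L^{12}:(0,\sqrt3)$.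
   Context: Work over $K=\mathbb{R}$ or $\mathbb{C}$ (smooth, resp. holomorphic, vector fields on a connected open subset of $K^5$ with coordinates $(x,y,z,p,q)$). Products of 1-forms in $\Upsilon$ are symmetric products, $\mathrm{d}p^4=\mathrm{d}p\odot\mathrm{d}p\odot\mathrm{d}p\odot\mathrm{d}p$ etc. The symmetry algebra of $[\varpi,\Upsilon]$ is the Lie algebra, under the Lie bracket of vector fields, of all vector fields $X$ with $\mathcal{L}_X\varpi\equiv 0 \bmod \varpi$ and $\mathcal{L}_X\Upsilon\equiv 0\bmod \varpi,\Upsilon$; that is, $\mathcal{L}_X\varpi=\lambda\varpi$ and $\mathcal{L}_X\Upsilon=\phi\,\Upsilon+\varpi\odot\sigma$ for some functions $\lambda,\phi$ and some symmetric 3-tensor $\sigma$. The labels $S^i$, $L^i$ indicate short and long roots respectively, with $i$ the hour at which the root sits when the root diagram is superimposed on a clock face. Noth's equation is the ODE $10(H'')^3H^{(6)}-70(H'')^2H'''H^{(5)}-49(H'')^2(H'''')^2+280H''(H''')^2H''''-175(H''')^4=0$ for $H=H(t)$. A solution $H$ is associated with the 1-forms $\omega_2=\mathrm{d}p+(t^2H_t-2tH+2\int H\,\mathrm{d}t)\mathrm{d}x+(H-tH_t)\mathrm{d}y$, $\omega_3=\mathrm{d}q+(H-tH_t)\mathrm{d}x+H_t\,\mathrm{d}y$, $\omega_4=\mathrm{d}y-t\,\mathrm{d}x$. For the parametrized solution in the statement these are $\omega_2=\mathrm{d}p-\frac{4}{3(s-1)}\mathrm{d}x+\frac{2s^{1/3}}{s-1}\mathrm{d}y$,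 $\omega_3=\mathrm{d}q+\frac{2s^{1/3}}{s-1}\mathrm{d}x+\frac{1-4s}{s^{1/3}(s-1)}\mathrm{d}y$, $\omega_4=\mathrm{d}y-\frac{2s^{2/3}}{2s+1}\mathrm{d}x$, and the tensor $\Upsilon$ is obtained from them by eliminating the parameter $s$ (it vanishes on the locus $\omega_2=\omega_3=\omega_4=0$). *)

theory Defs
  imports "HOL-Analysis.Analysis" "HOL-Library.Function_Algebras"
begin

section \<open>Calculus on $K^5$ with named coordinates\<close>

text \<open>The constructors are the coordinates $(x,y,z,p,q)$, so that \<open>'k ^ coord\<close> is $K^5$.
  Everything is polymorphic in the field \<open>'k\<close> and is used for \<^typ>\<open>real\<close> and \<^typ>\<open>complex\<close>;
  scalar multiplication over \<open>'k\<close> is \<open>(*s)\<close>, and \<open>deriv\<close> is the derivative over \<open>'k\<close>.\<close>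

datatype coord = Cx | Cy | Cz | Cp | Cq

lemma UNIV_coord: "(UNIV :: coord set) = {Cx, Cy, Cz, Cp, Cq}"
  using coord.exhaust by auto

instance coord :: finite
  by standard (simp add: UNIV_coord)

definition vec5 :: "'k \<Rightarrow> 'k \<Rightarrow> 'k \<Rightarrow> 'k \<Rightarrow> 'k \<Rightarrow> 'k ^ coord" where
  "vec5 a b c d e = (\<chi> i. case i of Cx \<Rightarrow> a | Cy \<Rightarrow> b | Cz \<Rightarrow> c | Cp \<Rightarrow> d | Cq \<Rightarrow> e)"

definition partial :: "coord \<Rightarrow> ('k ^ coord \<Rightarrow> 'k) \<Rightarrow> 'k ^ coord \<Rightarrow> 'k :: real_normed_field" where
  "partial i f u = deriv (\<lambda>t. f (u + t *s axis i 1)) 0"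

primrec Ck_on :: "nat \<Rightarrow> (real ^ coord) set \<Rightarrow> (real ^ coord \<Rightarrow> real) \<Rightarrow> bool" where
  "Ck_on 0 U f \<longleftrightarrow> continuous_on U f"
| "Ck_on (Suc k) U f \<longleftrightarrow> (\<forall>u\<in>U. f differentiable (at u)) \<and> (\<forall>i. Ck_on k U (partial i f))"

definition smooth_fn_on :: "(real ^ coord) set \<Rightarrow> (real ^ coord \<Rightarrow> real) \<Rightarrow> bool" where
  "smooth_fn_on U f \<longleftrightarrow> (\<forall>k. Ck_on k U f)"

definition holomorphic_fn_on :: "(complex ^ coord) set \<Rightarrow> (complex ^ coord \<Rightarrow> complex) \<Rightarrow> bool" where
  "holomorphic_fn_on U f \<longleftrightarrow>
     (\<forall>u\<in>U. \<exists>D. Vector_Spaces.linear (*s) (*) D \<and> (f has_derivative D) (at u))"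

section \<open>Covariant tensors\<close>

text \<open>A covariant tensor field of rank $k$ is given by its components: \<open>T u [i1, \<dots>, ik]\<close> is the value
  of $T$ at the point $u$ on the coordinate vectors $\partial_{i_1},\dots,\partial_{i_k}$. Only the
  index lists of length $k$ are meaningful.\<close>

type_synonym 'k tensor = "'k ^ coord \<Rightarrow> coord list \<Rightarrow> 'k"

definition dcoord :: "coord \<Rightarrow> 'k :: real_normed_field tensor" where
  "dcoord i u I = (if I = [i] then 1 else 0)"

text \<open>The symmetric product of a 1-form with a symmetric tensor, normalised such that
  $\alpha\odot\dots\odot\alpha = \alpha\otimes\dots\otimes\alpha$: the average of the components of
  $\alpha\otimes T$ over the choice of the slot into which $\alpha$ goes.\<close>

definition sprod :: "'k tensor \<Rightarrow> 'k tensor \<Rightarrow> 'k :: real_normed_field tensor" (infixr "\<odot>" 75) where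
  "(\<alpha> \<odot> T) u I =
     (\<Sum>a<length I. \<alpha> u [I ! a] * T u (take a I @ drop (Suc a) I)) / of_nat (length I)"

definition monom4 :: "coord \<Rightarrow> coord \<Rightarrow> coord \<Rightarrow> coord \<Rightarrow> 'k :: real_normed_field tensor" where
  "monom4 i j k l = dcoord i \<odot> dcoord j \<odot> dcoord k \<odot> dcoord l"

definition symmetric_tensor_on :: "('k ^ coord) set \<Rightarrow> nat \<Rightarrow> 'k tensor \<Rightarrow> bool" where
  "symmetric_tensor_on U k T \<longleftrightarrow>
     (\<forall>u\<in>U. \<forall>I J. length I = k \<longrightarrow> mset I = mset J \<longrightarrow> T u I = T u J)"

definition tdiag :: "nat \<Rightarrow> 'k tensor \<Rightarrow> 'k ^ coord \<Rightarrow> 'k ^ coord \<Rightarrow> 'k :: real_normed_field" where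
  "tdiag k T u v = (\<Sum>I | length I = k. T u I * (\<Prod>a<k. v $ (I ! a)))"

definition form1 :: "'k tensor \<Rightarrow> 'k ^ coord \<Rightarrow> 'k ^ coord \<Rightarrow> 'k :: real_normed_field" where
  "form1 \<alpha> u v = (\<Sum>i\<in>UNIV. \<alpha> u [i] * v $ i)"

definition ext_deriv :: "'k tensor \<Rightarrow> 'k ^ coord \<Rightarrow> 'k ^ coord \<Rightarrow> 'k ^ coord \<Rightarrow> 'k :: real_normed_field" where
  "ext_deriv \<alpha> u v w =
     (\<Sum>i\<in>UNIV. \<Sum>j\<in>UNIV.
        (partial i (\<lambda>u'. \<alpha> u' [j]) u - partial j (\<lambda>u'. \<alpha> u' [i]) u) * v $ i * w $ j)"

definition lie_deriv ::
    "('k ^ coord \<Rightarrow> 'k ^ coord) \<Rightarrow> 'k tensor \<Rightarrow> 'k :: real_normed_field tensor" where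
  "lie_deriv X T u I =
     (\<Sum>m\<in>UNIV. X u $ m * partial m (\<lambda>u'. T u' I) u)
     + (\<Sum>a<length I. \<Sum>m\<in>UNIV. partial (I ! a) (\<lambda>u'. X u' $ m) u * T u (I[a := m]))"

section \<open>Vector fields on an open set and their symmetry algebra\<close>

text \<open>Vector fields on \<open>U\<close> are total functions that vanish outside \<open>U\<close>, so that equal fields are
  equal functions; \<open>restrict_vf U X\<close> is the field on \<open>U\<close> given by the formula \<open>X\<close>.\<close>

definition restrict_vf :: "('k ^ coord) set \<Rightarrow> ('k ^ coord \<Rightarrow> 'k ^ coord) \<Rightarrow>
    'k ^ coord \<Rightarrow> 'k :: real_normed_field ^ coord" where
  "restrict_vf U X = (\<lambda>u. if u \<in> U then X u else 0)"

definition vf_scale :: "'k \<Rightarrow> ('k ^ coord \<Rightarrow> 'k ^ coord) \<Rightarrow>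
    'k ^ coord \<Rightarrow> 'k :: real_normed_field ^ coord" where
  "vf_scale c X = (\<lambda>u. c *s X u)"

abbreviation vf_span :: "('k ^ coord \<Rightarrow> 'k ^ coord) set \<Rightarrow>
    ('k ^ coord \<Rightarrow> 'k :: real_normed_field ^ coord) set" where
  "vf_span \<equiv> module.span vf_scale"

abbreviation vf_dim :: "('k ^ coord \<Rightarrow> 'k :: real_normed_field ^ coord) set \<Rightarrow> nat" where
  "vf_dim \<equiv> vector_space.dim vf_scale"

definition vf_bracket :: "('k ^ coord) set \<Rightarrow> ('k ^ coord \<Rightarrow> 'k ^ coord) \<Rightarrow>
    ('k ^ coord \<Rightarrow> 'k ^ coord) \<Rightarrow> 'k ^ coord \<Rightarrow> 'k :: real_normed_field ^ coord" where
  "vf_bracket U X Y = restrict_vf U (\<lambda>u. \<chi> i.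
     \<Sum>m\<in>UNIV. X u $ m * partial m (\<lambda>u'. Y u' $ i) u - Y u $ m * partial m (\<lambda>u'. X u' $ i) u)"

text \<open>In the following, \<open>R U f\<close> says that the function \<open>f\<close> is regular on \<open>U\<close>, i.e. smooth for
  $K=\mathbb{R}$ and holomorphic for $K=\mathbb{C}$. For the 1-form \<open>w\<close> and the symmetric 4-tensor \<open>Y\<close>
  a symmetry satisfies $L_X w=\lambda w$ and $L_X Y=\phi Y+w\odot\sigma$.\<close>

type_synonym 'k regularity = "('k ^ coord) set \<Rightarrow> ('k ^ coord \<Rightarrow> 'k) \<Rightarrow> bool"

definition symmetry_algebra :: "'k regularity \<Rightarrow> ('k ^ coord) set \<Rightarrow> 'k tensor \<Rightarrow> 'k tensor \<Rightarrow>
    ('k ^ coord \<Rightarrow> 'k :: real_normed_field ^ coord) set" where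
  "symmetry_algebra R U w Y =
     {X. (\<forall>i. R U (\<lambda>u. X u $ i)) \<and> (\<forall>u. u \<notin> U \<longrightarrow> X u = 0) \<and>
         (\<exists>lam. R U lam \<and> (\<forall>u\<in>U. \<forall>i. lie_deriv X w u [i] = lam u * w u [i])) \<and>
         (\<exists>\<phi> \<sigma>. R U \<phi> \<and> (\<forall>I. length I = 3 \<longrightarrow> R U (\<lambda>u. \<sigma> u I)) \<and> symmetric_tensor_on U 3 \<sigma> \<and>
            (\<forall>u\<in>U. \<forall>I. length I = 4 \<longrightarrow> lie_deriv X Y u I = \<phi> u * Y u I + (w \<odot> \<sigma>) u I))}"

section \<open>Lie algebras and the split simple Lie algebra of type $G_2$\<close>

locale lie_algebra = vector_space scale
  for scale :: "'k :: field \<Rightarrow> 'v :: ab_group_add \<Rightarrow> 'v" +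
  fixes L :: "'v set" and br :: "'v \<Rightarrow> 'v \<Rightarrow> 'v"
  assumes subspace_L: "subspace L"
    and br_closed: "\<lbrakk>X \<in> L; Y \<in> L\<rbrakk> \<Longrightarrow> br X Y \<in> L"
    and br_add_left: "\<lbrakk>X \<in> L; Y \<in> L; Z \<in> L\<rbrakk> \<Longrightarrow> br (X + Y) Z = br X Z + br Y Z"
    and br_add_right: "\<lbrakk>X \<in> L; Y \<in> L; Z \<in> L\<rbrakk> \<Longrightarrow> br X (Y + Z) = br X Y + br X Z"
    and br_scale_left: "\<lbrakk>X \<in> L; Y \<in> L\<rbrakk> \<Longrightarrow> br (scale c X) Y = scale c (br X Y)"
    and br_scale_right: "\<lbrakk>X \<in> L; Y \<in> L\<rbrakk> \<Longrightarrow> br X (scale c Y) = scale c (br X Y)"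
    and br_self: "X \<in> L \<Longrightarrow> br X X = 0"
    and jacobi: "\<lbrakk>X \<in> L; Y \<in> L; Z \<in> L\<rbrakk> \<Longrightarrow> br X (br Y Z) + br Y (br Z X) + br Z (br X Y) = 0"
begin

definition lie_ideal :: "'v set \<Rightarrow> bool" where
  "lie_ideal I \<longleftrightarrow> subspace I \<and> I \<subseteq> L \<and> (\<forall>X\<in>L. \<forall>Y\<in>I. br X Y \<in> I)"

definition simple_lie :: bool where
  "simple_lie \<longleftrightarrow> (\<exists>X\<in>L. \<exists>Y\<in>L. br X Y \<noteq> 0) \<and> (\<forall>I. lie_ideal I \<longrightarrow> I = {0} \<or> I = L)"

definition subalgebra :: "'v set \<Rightarrow> bool" where
  "subalgebra h \<longleftrightarrow> subspace h \<and> h \<subseteq> L \<and> (\<forall>X\<in>h. \<forall>Y\<in>h. br X Y \<in> h)"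

primrec lower_central :: "'v set \<Rightarrow> nat \<Rightarrow> 'v set" where
  "lower_central h 0 = h"
| "lower_central h (Suc n) = span {br X Y | X Y. X \<in> h \<and> Y \<in> lower_central h n}"

definition cartan_subalgebra :: "'v set \<Rightarrow> bool" where
  "cartan_subalgebra h \<longleftrightarrow> subalgebra h \<and> (\<exists>n. lower_central h n = {0}) \<and>
     (\<forall>X\<in>L. (\<forall>H\<in>h. br X H \<in> h) \<longrightarrow> X \<in> h)"

text \<open>Linear functionals on \<open>h\<close>, extended by zero to the ambient type.\<close>

definition dual_on :: "'v set \<Rightarrow> ('v \<Rightarrow> 'k) set" where
  "dual_on h = {\<alpha>. (\<forall>X\<in>h. \<forall>Y\<in>h. \<alpha> (X + Y) = \<alpha> X + \<alpha> Y) \<and>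
     (\<forall>c. \<forall>X\<in>h. \<alpha> (scale c X) = c * \<alpha> X) \<and> (\<forall>X. X \<notin> h \<longrightarrow> \<alpha> X = 0)}"

definition root_space :: "'v set \<Rightarrow> ('v \<Rightarrow> 'k) \<Rightarrow> 'v set" where
  "root_space h \<alpha> = {X \<in> L. \<forall>H\<in>h. br H X = scale (\<alpha> H) X}"

definition roots :: "'v set \<Rightarrow> ('v \<Rightarrow> 'k) set" where
  "roots h = {\<alpha> \<in> dual_on h. (\<exists>H\<in>h. \<alpha> H \<noteq> 0) \<and> root_space h \<alpha> \<noteq> {0}}"

text \<open>Splitting: the ad-action of \<open>h\<close> on \<open>L\<close> is simultaneously diagonalisable over the
  ground field.\<close>

definition splitting_cartan :: "'v set \<Rightarrow> bool" where
  "splitting_cartan h \<longleftrightarrow> cartan_subalgebra h \<and> span (\<Union>\<alpha>\<in>dual_on h. root_space h \<alpha>) = L"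

text \<open>\<open>\<alpha>\<close> and \<open>\<beta>\<close> are the short and the long simple root; they form a basis of the dual of \<open>h\<close>.\<close>

definition roots_type_G2 :: "'v set \<Rightarrow> bool" where
  "roots_type_G2 h \<longleftrightarrow> dim h = 2 \<and> (\<exists>\<alpha> \<in> dual_on h. \<exists>\<beta> \<in> dual_on h.
     (\<forall>a b. (\<forall>H\<in>h. a * \<alpha> H + b * \<beta> H = 0) \<longrightarrow> a = 0 \<and> b = 0) \<and>
     roots h = {\<lambda>H. of_int m * \<alpha> H + of_int n * \<beta> H | m n.
       (m, n) \<in> {(1, 0), (0, 1), (1, 1), (2, 1), (3, 1), (3, 2),
                 (-1, 0), (0, -1), (-1, -1), (-2, -1), (-3, -1), (-3, -2)}})"

definition split_simple_G2 :: bool where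
  "split_simple_G2 \<longleftrightarrow> (\<exists>B. finite B \<and> span B = L) \<and> simple_lie \<and>
     (\<exists>h. splitting_cartan h \<and> roots_type_G2 h)"

end

section \<open>Contact structures of type $G_2$\<close>

text \<open>Locally there is an adapted coframe $w,\theta_0,\dots,\theta_3$ with
  $dw\equiv l\,(\theta_0\wedge\theta_3-3\,\theta_1\wedge\theta_2)$ modulo $w$ in which \<open>Y\<close> is, modulo $w$ and up
  to a non-vanishing factor, the discriminant form, i.e. the equation of the tangent developable of
  the twisted cubic $[\theta_0:\theta_1:\theta_2:\theta_3]=[1:r:r^2:r^3]$. Such data are the
  reductions of the contact distribution to $GL(2)$ acting as on binary cubics.\<close>

definition contact_structure_G2 ::
    "'k regularity \<Rightarrow> ('k ^ coord) set \<Rightarrow> 'k tensor \<Rightarrow> 'k :: real_normed_field tensor \<Rightarrow> bool" where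
  "contact_structure_G2 R U w Y \<longleftrightarrow>
     (\<forall>u0\<in>U. \<exists>W \<theta> l m. open W \<and> u0 \<in> W \<and> W \<subseteq> U \<and>
        (\<forall>j<4. \<forall>i. R W (\<lambda>u. \<theta> (j::nat) u [i])) \<and> R W l \<and> R W m \<and>
        (\<forall>u\<in>W. l u \<noteq> 0 \<and> m u \<noteq> 0 \<and>
          (\<forall>v. form1 w u v = 0 \<and> (\<forall>j<4. form1 (\<theta> j) u v = 0) \<longrightarrow> v = 0) \<and>
          (\<forall>v v'. form1 w u v = 0 \<and> form1 w u v' = 0 \<longrightarrow>
             ext_deriv w u v v' =
               l u * (form1 (\<theta> 0) u v * form1 (\<theta> 3) u v' - form1 (\<theta> 3) u v * form1 (\<theta> 0) u v'
                 - 3 * (form1 (\<theta> 1) u v * form1 (\<theta> 2) u v' - form1 (\<theta> 2) u v * form1 (\<theta> 1) u v'))) \<and>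
          (\<forall>v. form1 w u v = 0 \<longrightarrow>
             (let x0 = form1 (\<theta> 0) u v; x1 = form1 (\<theta> 1) u v;
                  x2 = form1 (\<theta> 2) u v; x3 = form1 (\<theta> 3) u v
              in tdiag 4 Y u v = m u * (x0^2 * x3^2 - 6 * x0 * x1 * x2 * x3
                   + 4 * x0 * x2^3 + 4 * x1^3 * x3 - 3 * x1^2 * x2^2)))))"

definition contact_form :: "'k :: real_normed_field tensor" where
  "contact_form u I = dcoord Cz u I - u $ Cp * dcoord Cx u I - u $ Cq * dcoord Cy u I"

definition Upsilon :: "'k :: real_normed_field tensor" where
  "Upsilon u I =
     81 * monom4 Cp Cp Cp Cp u I + 216 * monom4 Cp Cp Cp Cx u I + 216 * monom4 Cp Cp Cq Cy u I
     + 144 * monom4 Cp Cp Cx Cx u I + 24 * monom4 Cp Cq Cq Cq u I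
     + 288 * monom4 Cp Cq Cx Cy u I - 384 * monom4 Cp Cy Cy Cy u I
     + 32 * monom4 Cq Cq Cq Cx u I - 48 * monom4 Cq Cq Cy Cy u I"

section \<open>Noth's equation and the associated 1-forms\<close>

definition noth_solution :: "('k \<Rightarrow> 'k) \<Rightarrow> 'k :: real_normed_field set \<Rightarrow> bool" where
  "noth_solution h T \<longleftrightarrow> open T \<and>
     (\<forall>n<6. \<forall>t\<in>T. (deriv ^^ n) h field_differentiable (at t)) \<and>
     (\<forall>t\<in>T. let D = (\<lambda>n. (deriv ^^ n) h t) in
        10 * D 2 ^ 3 * D 6 - 70 * D 2 ^ 2 * D 3 * D 5 - 49 * D 2 ^ 2 * D 4 ^ 2
        + 280 * D 2 * D 3 ^ 2 * D 4 - 175 * D 3 ^ 4 = 0)"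

text \<open>The 1-forms of a solution \<open>h\<close> at the parameter value \<open>t\<close>; here \<open>J\<close> is the chosen
  antiderivative $\int H\,dt$.\<close>

definition noth_omega2 :: "('k \<Rightarrow> 'k) \<Rightarrow> ('k \<Rightarrow> 'k) \<Rightarrow> 'k \<Rightarrow> 'k :: real_normed_field tensor" where
  "noth_omega2 h J t u I = dcoord Cp u I
     + (t^2 * deriv h t - 2 * t * h t + 2 * J t) * dcoord Cx u I
     + (h t - t * deriv h t) * dcoord Cy u I"

definition noth_omega3 :: "('k \<Rightarrow> 'k) \<Rightarrow> 'k \<Rightarrow> 'k :: real_normed_field tensor" where
  "noth_omega3 h t u I = dcoord Cq u I
     + (h t - t * deriv h t) * dcoord Cx u I + deriv h t * dcoord Cy u I"

definition noth_omega4 :: "'k \<Rightarrow> 'k :: real_normed_field tensor" where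
  "noth_omega4 t u I = dcoord Cy u I - t * dcoord Cx u I"

text \<open>The parametrized solution. The parameter $s$ ranges over an open set on which $s^{1/3}$ is
  given by a continuous branch \<open>r\<close> of the cube root (for $K=\mathbb{R}$ this is the real cube root), and
  the values $s=0$, $s=1$ and $s=-1/2$, for which the formulas break down, are left out.\<close>

definition cube_root_branch :: "'k set \<Rightarrow> ('k \<Rightarrow> 'k :: real_normed_field) \<Rightarrow> bool" where
  "cube_root_branch D r \<longleftrightarrow> open D \<and> continuous_on D r \<and>
     (\<forall>s\<in>D. r s ^ 3 = s \<and> s \<noteq> 0 \<and> s \<noteq> 1 \<and> 1 + 2 * s \<noteq> 0)"

definition param_t :: "('k \<Rightarrow> 'k) \<Rightarrow> 'k \<Rightarrow> 'k :: real_normed_field" where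
  "param_t r s = 2 * r s ^ 2 / (1 + 2 * s)"

definition param_H :: "('k \<Rightarrow> 'k) \<Rightarrow> 'k \<Rightarrow> 'k :: real_normed_field" where
  "param_H r s = - (4 * r s / (1 + 2 * s))"

definition param_omega2 :: "('k \<Rightarrow> 'k) \<Rightarrow> 'k \<Rightarrow> 'k :: real_normed_field tensor" where
  "param_omega2 r s u I = dcoord Cp u I - 4 / (3 * (s - 1)) * dcoord Cx u I
     + 2 * r s / (s - 1) * dcoord Cy u I"

definition param_omega3 :: "('k \<Rightarrow> 'k) \<Rightarrow> 'k \<Rightarrow> 'k :: real_normed_field tensor" where
  "param_omega3 r s u I = dcoord Cq u I + 2 * r s / (s - 1) * dcoord Cx u I
     + (1 - 4 * s) / (r s * (s - 1)) * dcoord Cy u I"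

definition param_omega4 :: "('k \<Rightarrow> 'k) \<Rightarrow> 'k \<Rightarrow> 'k :: real_normed_field tensor" where
  "param_omega4 r s u I = dcoord Cy u I - 2 * r s ^ 2 / (2 * s + 1) * dcoord Cx u I"

text \<open>Near every parameter value the curve $(t(s),H(s))$ is the graph of a solution \<open>h\<close> of Noth's
  equation whose associated 1-forms (for a suitable constant of integration in \<open>J\<close>) are the
  displayed ones, and \<open>Y\<close> vanishes on their common zero locus for all $s$.\<close>

definition associated_to_noth_param :: "('k ^ coord) set \<Rightarrow> 'k :: real_normed_field tensor \<Rightarrow> bool" where
  "associated_to_noth_param U Y \<longleftrightarrow>
     (\<forall>D r. cube_root_branch D r \<longrightarrow>
        (\<forall>s0\<in>D. \<exists>S h J. open S \<and> s0 \<in> S \<and> S \<subseteq> D \<and> inj_on (param_t r) S \<and>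
           noth_solution h (param_t r ` S) \<and>
           (\<forall>t \<in> param_t r ` S. (J has_field_derivative h t) (at t)) \<and>
           (\<forall>s\<in>S. h (param_t r s) = param_H r s \<and>
              noth_omega2 h J (param_t r s) = param_omega2 r s \<and>
              noth_omega3 h (param_t r s) = param_omega3 r s \<and>
              noth_omega4 (param_t r s) = param_omega4 r s)) \<and>
        (\<forall>s\<in>D. \<forall>u\<in>U. \<forall>v. form1 (param_omega2 r s) u v = 0 \<and> form1 (param_omega3 r s) u v = 0 \<and>
           form1 (param_omega4 r s) u v = 0 \<longrightarrow> tdiag 4 Y u v = 0))"

section \<open>The fourteen vector fields\<close>

definition in_coords :: "('k \<Rightarrow> 'k \<Rightarrow> 'k \<Rightarrow> 'k \<Rightarrow> 'k \<Rightarrow> 'k ^ coord) \<Rightarrow>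
    'k ^ coord \<Rightarrow> 'k :: real_normed_field ^ coord" where
  "in_coords F u = F (u $ Cx) (u $ Cy) (u $ Cz) (u $ Cp) (u $ Cq)"

definition S1 :: "'k ^ coord \<Rightarrow> 'k :: real_normed_field ^ coord" where
  "S1 = in_coords (\<lambda>x y z p q. vec5
     (- (3/16 * q^2 + 3/2 * x * y + 9/8 * p * y))
     (- (3/8 * p * q + 1/2 * y^2 + 1/2 * q * x))
     (- (9/16 * p^2 * y + 1/4 * q^2 * x + 3/8 * q^2 * p + 3/2 * y * z))
     (1/4 * q^2)
     (- (3/2 * z) + 3/2 * p * x - 1/2 * q * y + 9/16 * p^2))"

definition L2 :: "'k ^ coord \<Rightarrow> 'k :: real_normed_field ^ coord" where
  "L2 = in_coords (\<lambda>x y z p q. vec5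
     (- (9/4 * p * x + 27/32 * p^2 - 3/4 * z + x^2 + 3/4 * q * y))
     (- (3/4 * p * y + x * y))
     (- (9/8 * p^2 * x + 9/16 * p^3 + x * z + 3/4 * p * q * y + 2/3 * y^3))
     (- (z - p * x - q * y - 3/8 * p^2))
     (- (2 * y^2)))"

definition S3 :: "'k ^ coord \<Rightarrow> 'k :: real_normed_field ^ coord" where
  "S3 = in_coords (\<lambda>x y z p q. vec5
     (- (3/8 * q)) (- (3/8 * p + 1/2 * x)) (- (3/8 * p * q + y^2)) (1/2 * q) (- (2 * y)))"

definition L4 :: "'k ^ coord \<Rightarrow> 'k :: real_normed_field ^ coord" where
  "L4 = in_coords (\<lambda>x y z p q. vec5 (- (3/4)) 0 x 1 0)"

definition S5 :: "'k ^ coord \<Rightarrow> 'k :: real_normed_field ^ coord" where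
  "S5 = in_coords (\<lambda>x y z p q. vec5 0 0 y 0 1)"

definition L6 :: "'k ^ coord \<Rightarrow> 'k :: real_normed_field ^ coord" where
  "L6 = in_coords (\<lambda>x y z p q. vec5 0 0 1 0 0)"

definition S7 :: "'k ^ coord \<Rightarrow> 'k :: real_normed_field ^ coord" where
  "S7 = in_coords (\<lambda>x y z p q. vec5 0 1 0 0 0)"

definition L8 :: "'k ^ coord \<Rightarrow> 'k :: real_normed_field ^ coord" where
  "L8 = in_coords (\<lambda>x y z p q. vec5 1 0 0 0 0)"

definition S9 :: "'k ^ coord \<Rightarrow> 'k :: real_normed_field ^ coord" where
  "S9 = in_coords (\<lambda>x y z p q. vec5 (3 * y) q (1/2 * q^2) 0 (- (3 * p)))"

definition L10 :: "'k ^ coord \<Rightarrow> 'k :: real_normed_field ^ coord" where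
  "L10 = in_coords (\<lambda>x y z p q. vec5
     (3 * z + 27/8 * p^2) (1/2 * q^2) (9/4 * p^3 + 1/3 * q^3) (- (3 * p^2)) (- (3 * p * q)))"

definition S11 :: "'k ^ coord \<Rightarrow> 'k :: real_normed_field ^ coord" where
  "S11 = in_coords (\<lambda>x y z p q. vec5
     (- (6 * y^2) + 9/4 * q * p)
     (3 * z + 9/8 * p^2 - 4 * q * y)
     (9/4 * p^2 * q - 2 * y * q^2)
     (- (3 * p * q))
     (12 * p * y - q^2))"

definition L12 :: "'k ^ coord \<Rightarrow> 'k :: real_normed_field ^ coord" where
  "L12 = in_coords (\<lambda>x y z p q. vec5
     (- (3 * z * x + 1/8 * q^3 + 9/4 * p * q * y - 2 * y^3 + 27/8 * p^2 * x + 27/16 * p^3))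
     (- (3 * y * z + 1/2 * q^2 * x + 3/8 * p * q^2 - 2 * q * y^2 + 9/8 * p^2 * y))
     (- (9/4 * p^3 * x + 1/3 * x * q^3 + 3 * z^2 + 3/8 * q^3 * p - q^2 * y^2
         + 9/4 * q * y * p^2 + 81/64 * p^4))
     (- (3 * p * z) + 3 * p^2 * x + 3 * p * q * y + 1/6 * q^3 + 9/8 * p^3)
     (- (3 * q * z) + 3 * p * q * x + 9/8 * p^2 * q - 6 * p * y^2 + q^2 * y))"

definition h1 :: "'k ^ coord \<Rightarrow> 'k :: real_normed_field ^ coord" where
  "h1 = in_coords (\<lambda>x y z p q. vec5
     (9/4 * p + 3/2 * x) (1/2 * y) (9/8 * p^2) (- (3/2 * p)) (- (1/2 * q)))"

definition h2 :: "'k ^ coord \<Rightarrow> 'k :: real_normed_field ^ coord" where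
  "h2 = in_coords (\<lambda>x y z p q. of_real (sqrt 3 / 2) *s vec5 x y (2 * z) p q)"

text \<open>The root vectors \<open>X\<close> with their roots \<open>(a, b)\<close>, where $[h_1,X]=aX$ and $[h_2,X]=bX$.\<close>

definition root_table ::
    "(('k ^ coord \<Rightarrow> 'k :: real_normed_field ^ coord) \<times> real \<times> real) set" where
  "root_table =
     {(S1, 1/2, sqrt 3 / 2), (L2, 3/2, sqrt 3 / 2), (S3, 1, 0),
      (L4, 3/2, - sqrt 3 / 2), (S5, 1/2, - sqrt 3 / 2), (L6, 0, - sqrt 3),
      (S7, - 1/2, - sqrt 3 / 2), (L8, - 3/2, - sqrt 3 / 2), (S9, - 1, 0),
      (L10, - 3/2, sqrt 3 / 2), (S11, - 1/2, sqrt 3 / 2), (L12, 0, sqrt 3)}"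

end

(*
A symmetry X of the contact form is determined by its contact Hamiltonian f = varpi(X).
In the coframe th0 = -3/4 dp, th1 = dq/4, th2 = dy/2, th3 = dx/2 + 3/8 dp the tensor Upsilon is 1024 times the
discriminant of a binary cubic, and X preserves [varpi, Upsilon] iff f satisfies seven linear second order equations in
the dual contact frame e0, ..., e3: the symmetrized second derivative (e_i e_j f), an element of sp(4), has to lie in the
subalgebra sl(2) of the twisted cubic. Commuting derivatives, with [e0, e3] = T and [e1, e2] = -3T, closes this system at weight 4, on
the 14-dimensional space of jets (f; e_i f; four of the second derivatives, among them T f; the T e_j f; T T f). Subtracting
suitable multiples of the 14 polynomial solutions makes these components vanish one after the other, hence the solution
space on a connected open set is exactly their span. This uses only that all iterated partial derivatives exist, are
continuous and commute, and so covers smooth and holomorphic fields at once.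

The bracket table puts the fields on a clock face: S^i and L^i carry the twelve roots, and for each hour some field carries
the root vector of that hour to a nonzero multiple of that of the next one. A nonzero ideal contains some root vector
because an element of the Cartan subalgebra separates the roots; going round the clock it is everything.

For Noth's equation put s = u^3: then t and H are rational in u, and so are all derivatives of H by t.
*)

theory Submission
  imports Defs "HOL-Complex_Analysis.Cauchy_Integral_Formula"
begin

section \<open>Partial derivatives\<close>

text \<open>Where the numbers come from. Under the sl(2) acting on binary cubics, the symmetric 4 by
  4 matrices, that is sp(4), split as 10 = 7 + 3. The seven equations remove the 7-dimensional
  summand, and T f stays free beside the remaining three entries. The jet components of weights 0,
  ..., 4 then number 1, 4, 4, 4, 1, which are the dimensions in the contact grading of g_2. So 14 is
  an upper bound for the solution space, and the listed fields attain it. The coframe is dictated by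
  the parametrized locus: there it is proportional to (1, r, r^2, r^3) with r^3 = s. The obstacle is
  to treat both fields K alike. A holomorphic function is only assumed to have a complex linear
  derivative at each point, so the continuity of its partial derivatives has to come from Cauchy's
  integral formula. After that, symmetry of mixed derivatives and constancy of functions rest on
  mean value inequalities, which hold over both fields.\<close>

definition has_partial ::
    "coord \<Rightarrow> ('k ^ coord \<Rightarrow> 'k) \<Rightarrow> 'k \<Rightarrow> 'k::real_normed_field ^ coord \<Rightarrow> bool" where
  "has_partial i f d u \<longleftrightarrow> ((\<lambda>t. f (u + t *s axis i 1)) has_field_derivative d) (at 0)"

lemma has_partial_imp_partial: "has_partial i f d u \<Longrightarrow> partial i f u = d"
  unfolding has_partial_def partial_def by (rule DERIV_imp_deriv)

lemma has_partial_self: "has_partial i f d u \<Longrightarrow> has_partial i f (partial i f u) u"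
  by (simp add: has_partial_imp_partial)

lemma has_partial_const: "has_partial i (\<lambda>u. c) 0 u"
  by (simp add: has_partial_def)

lemma has_partial_coord: "has_partial i (\<lambda>u. u $ j) (if i = j then 1 else 0) u"
proof -
  have "((\<lambda>t. u $ j + t * c) has_field_derivative c) (at 0)" for c
    by (auto intro!: derivative_eq_intros)
  from this[of "axis i 1 $ j"] show ?thesis
    unfolding has_partial_def by (simp add: axis_def eq_commute[of j])
qed

lemma has_partial_add:
  "\<lbrakk>has_partial i f a u; has_partial i g b u\<rbrakk> \<Longrightarrow> has_partial i (\<lambda>u. f u + g u) (a + b) u"
  unfolding has_partial_def by (rule DERIV_add)

lemma has_partial_diff:
  "\<lbrakk>has_partial i f a u; has_partial i g b u\<rbrakk> \<Longrightarrow> has_partial i (\<lambda>u. f u - g u) (a - b) u"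
  unfolding has_partial_def by (rule DERIV_diff)

lemma has_partial_mult:
  assumes "has_partial i f a u" "has_partial i g b u"
  shows "has_partial i (\<lambda>u. f u * g u) (a * g u + f u * b) u"
  using DERIV_mult[OF assms[unfolded has_partial_def]] by (simp add: has_partial_def algebra_simps)

lemma norm_scaled_axis: "norm (t *s axis i 1 :: 'k::real_normed_field ^ coord) = norm t"
proof -
  have "norm ((t *s axis i 1 :: 'k ^ coord) $ j) = (if j = i then norm t else 0)" for j
    by (simp add: axis_def)
  then show ?thesis by (simp add: norm_vec_def L2_set_def if_distrib[of "\<lambda>x. x\<^sup>2"] cong: if_cong)
qed

lemma continuous_on_line [continuous_intros]:
  fixes v :: "'a::topological_space \<Rightarrow> 'k::real_normed_field ^ coord"
  assumes "continuous_on A v" "continuous_on A t"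
  shows "continuous_on A (\<lambda>x. v x + t x *s axis i 1)"
proof -
  have "continuous_on A (\<lambda>x. \<chi> j. v x $ j + t x * axis i 1 $ j)"
    by (intro continuous_intros assms)
  then show ?thesis
    by (simp add: plus_vec_def vector_scalar_mult_def)
qed

lemma has_partial_cong:
  fixes f :: "'k::real_normed_field ^ coord \<Rightarrow> 'k"
  assumes "open U" "u \<in> U" "\<And>v. v \<in> U \<Longrightarrow> f v = g v"
  shows "has_partial i f d u \<longleftrightarrow> has_partial i g d u"
proof -
  let ?l = "\<lambda>t::'k. u + t *s axis i 1"
  have "continuous_on UNIV ?l" by (intro continuous_intros)
  then have "open (?l -` U)" using \<open>open U\<close> open_vimage by blast
  moreover have "0 \<in> ?l -` U" using assms by simp
  ultimately have "\<forall>\<^sub>F t in nhds 0. t \<in> ?l -` U"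
    by (rule eventually_nhds_in_open)
  then have ev: "\<forall>\<^sub>F t in nhds 0. f (?l t) = g (?l t)"
    by (rule eventually_mono) (use assms(3) in auto)
  show ?thesis
    unfolding has_partial_def by (rule DERIV_cong_ev) (use ev in auto)
qed

text \<open>Equality holds even where no derivative exists: \<open>deriv\<close> chooses among the
  derivatives at the point, and functions that agree near \<open>u\<close> have the same
  ones.\<close>

lemma partial_cong:
  fixes f :: "'k::real_normed_field ^ coord \<Rightarrow> 'k"
  assumes "open U" "u \<in> U" "\<And>v. v \<in> U \<Longrightarrow> f v = g v"
  shows "partial i f u = partial i g u"
  using has_partial_cong[OF assms(1,2), of f g] assms(3)
  by (simp add: has_partial_def partial_def deriv_def)

lemma has_partial_line:
  fixes f :: "'k::real_normed_field ^ coord \<Rightarrow> 'k"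
  assumes "has_partial i f d (u + t *s axis i 1)"
  shows "((\<lambda>t. f (u + t *s axis i 1)) has_field_derivative d) (at t)"
proof -
  have *: "u + (x + t) *s axis i 1 = u + t *s axis i 1 + x *s axis i 1" for x
    by (simp add: vec_eq_iff algebra_simps)
  show ?thesis
    using assms DERIV_shift[of "\<lambda>t. f (u + t *s axis i 1)" d 0 t]
    unfolding has_partial_def * by simp
qed

text \<open>The second assumption says that the real derivative is linear over \<open>'k\<close>
  along the axis. This is automatic over the reals and part of \<open>holomorphic_fn_on\<close> over
  the complex numbers.\<close>

lemma has_partial_of_has_derivative:
  fixes f :: "'k::real_normed_field ^ coord \<Rightarrow> 'k"
  assumes "(f has_derivative D) (at u)" "\<And>t. D (t *s axis i 1) = t * D (axis i 1)"
  shows "has_partial i f (D (axis i 1)) u"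
proof -
  have bl: "bounded_linear (\<lambda>t. t *s axis i 1 :: 'k ^ coord)"
    by (rule bounded_linear_intro[where K=1])
       (auto simp: vec_eq_iff algebra_simps norm_scaled_axis)
  have "((\<lambda>t. u + t *s axis i 1) has_derivative (\<lambda>t. t *s axis i 1)) (at 0)"
    using has_derivative_add[OF has_derivative_const bounded_linear.has_derivative[OF bl has_derivative_ident]]
    by simp
  moreover have "(f has_derivative D) (at (u + 0 *s axis i 1))"
    using assms(1) by simp
  ultimately have "((\<lambda>t. f (u + t *s axis i 1)) has_derivative (\<lambda>t. D (t *s axis i 1))) (at 0)"
    by (rule has_derivative_compose)
  then show ?thesis
    unfolding has_partial_def has_field_derivative_def
    by (rule has_derivative_eq_rhs) (simp add: assms(2) fun_eq_iff)
qed

section \<open>Functions all of whose iterated partial derivatives are continuous\<close>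

text \<open>Asks for derivatives along the axes and for continuity, never for a total derivative. In
  this form it is a common consequence of smoothness and of holomorphy.\<close>

primrec Cn_on :: "nat \<Rightarrow> ('k ^ coord) set \<Rightarrow> ('k::real_normed_field ^ coord \<Rightarrow> 'k) \<Rightarrow> bool" where
  "Cn_on 0 U f \<longleftrightarrow> continuous_on U f"
| "Cn_on (Suc n) U f \<longleftrightarrow> continuous_on U f \<and>
     (\<forall>i. (\<forall>u\<in>U. has_partial i f (partial i f u) u) \<and> Cn_on n U (partial i f))"

definition regular_on :: "('k ^ coord) set \<Rightarrow> ('k::real_normed_field ^ coord \<Rightarrow> 'k) \<Rightarrow> bool" where
  "regular_on U f \<longleftrightarrow> (\<forall>n. Cn_on n U f)"

lemma Cn_on_SucD: "Cn_on (Suc n) U f \<Longrightarrow> Cn_on n U f"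
  by (induction n arbitrary: f) auto

lemma Cn_on_cong:
  assumes "open U" "\<And>v. v \<in> U \<Longrightarrow> f v = g v"
  shows "Cn_on n U f \<longleftrightarrow> Cn_on n U g"
  using assms(2)
proof (induction n arbitrary: f g)
  case 0
  then show ?case by (simp cong: continuous_on_cong)
next
  case (Suc n)
  have p: "partial i f u = partial i g u" if "u \<in> U" for u i
    by (rule partial_cong[OF assms(1) that Suc.prems])
  have "Cn_on n U (partial i f) \<longleftrightarrow> Cn_on n U (partial i g)" for i
    by (rule Suc.IH) (rule p)
  moreover have "has_partial i f (partial i f u) u \<longleftrightarrow> has_partial i g (partial i g u) u"
    if "u \<in> U" for u i
    using has_partial_cong[OF assms(1) that Suc.prems] p[OF that] by simp
  moreover have "continuous_on U f \<longleftrightarrow> continuous_on U g"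
    using Suc.prems by (simp cong: continuous_on_cong)
  ultimately show ?case by simp
qed

lemma Cn_on_add:
  assumes "open U" "Cn_on n U f" "Cn_on n U g"
  shows "Cn_on n U (\<lambda>u. f u + g u)"
  using assms(2,3)
proof (induction n arbitrary: f g)
  case 0
  then show ?case by (auto intro: continuous_intros)
next
  case (Suc n)
  have hp: "has_partial i (\<lambda>u. f u + g u) (partial i f u + partial i g u) u" if "u \<in> U" for u i
    using Suc.prems that by (intro has_partial_add) auto
  \<comment> \<open>The sum rule is known on \<open>U\<close> only, so the derivative is exchanged
    for its formula through \<open>Cn_on_cong\<close> and not by an equation between
    functions.\<close>
  have "Cn_on n U (partial i (\<lambda>u. f u + g u)) \<longleftrightarrow> Cn_on n U (\<lambda>u. partial i f u + partial i g u)" for i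
    by (rule Cn_on_cong[OF assms(1)]) (rule has_partial_imp_partial[OF hp])
  then have "Cn_on n U (partial i (\<lambda>u. f u + g u))" for i
    using Suc by simp
  moreover have "has_partial i (\<lambda>u. f u + g u) (partial i (\<lambda>u. f u + g u) u) u" if "u \<in> U" for u i
    using hp[OF that] has_partial_imp_partial[OF hp[OF that]] by simp
  ultimately show ?case
    using Suc.prems by (auto intro: continuous_intros)
qed

lemma Cn_on_mult:
  assumes "open U" "Cn_on n U f" "Cn_on n U g"
  shows "Cn_on n U (\<lambda>u. f u * g u)"
  using assms(2,3)
proof (induction n arbitrary: f g)
  case 0
  then show ?case by (auto intro: continuous_intros)
next
  case (Suc n)
  have hp: "has_partial i (\<lambda>u. f u * g u) (partial i f u * g u + f u * partial i g u) u"
    if "u \<in> U" for u i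
    using Suc.prems that by (intro has_partial_mult) auto
  have "Cn_on n U (partial i (\<lambda>u. f u * g u)) \<longleftrightarrow>
      Cn_on n U (\<lambda>u. partial i f u * g u + f u * partial i g u)" for i
    by (rule Cn_on_cong[OF assms(1)]) (rule has_partial_imp_partial[OF hp])
  moreover have "Cn_on n U (\<lambda>u. partial i f u * g u + f u * partial i g u)" for i
    using Suc.prems Suc.prems[THEN Cn_on_SucD]
    by (intro Cn_on_add assms(1) Suc.IH) auto
  ultimately have "Cn_on n U (partial i (\<lambda>u. f u * g u))" for i
    by simp
  moreover have "has_partial i (\<lambda>u. f u * g u) (partial i (\<lambda>u. f u * g u) u) u" if "u \<in> U" for u i
    using hp[OF that] has_partial_imp_partial[OF hp[OF that]] by simp
  ultimately show ?case
    using Suc.prems by (auto intro: continuous_intros)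
qed

lemma regular_on_continuous: "regular_on U f \<Longrightarrow> continuous_on U f"
  unfolding regular_on_def by (auto dest: spec[of _ 0])

lemma regular_on_has_partial: "\<lbrakk>regular_on U f; u \<in> U\<rbrakk> \<Longrightarrow> has_partial i f (partial i f u) u"
  unfolding regular_on_def by (auto dest: spec[of _ "Suc 0"])

lemma regular_on_partial: "regular_on U f \<Longrightarrow> regular_on U (partial i f)"
  unfolding regular_on_def using Cn_on.simps(2)[of _ U f] by blast

lemma regular_on_cong:
  "\<lbrakk>open U; \<And>v. v \<in> U \<Longrightarrow> f v = g v\<rbrakk> \<Longrightarrow> regular_on U f \<longleftrightarrow> regular_on U g"
  unfolding regular_on_def using Cn_on_cong by blast

lemma regular_on_add:
  "\<lbrakk>open U; regular_on U f; regular_on U g\<rbrakk> \<Longrightarrow> regular_on U (\<lambda>u. f u + g u)"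
  unfolding regular_on_def using Cn_on_add by blast

lemma regular_on_mult:
  "\<lbrakk>open U; regular_on U f; regular_on U g\<rbrakk> \<Longrightarrow> regular_on U (\<lambda>u. f u * g u)"
  unfolding regular_on_def using Cn_on_mult by blast

text \<open>The mean value inequality twice: in \<open>s\<close> for
  \<open>Ft h t - Ft 0 t - h * c\<close>, then in \<open>t\<close> with the result as bound for the
  derivative. The subtracted linear terms turn closeness to \<open>c\<close> into smallness of a
  derivative.\<close>

lemma mixed_difference_bound:
  fixes F :: "'k::real_normed_field \<Rightarrow> 'k \<Rightarrow> 'k"
  assumes Ft: "\<And>s t. \<lbrakk>norm s < \<delta>; norm t < \<delta>\<rbrakk> \<Longrightarrow> (F s has_field_derivative Ft s t) (at t)"
    and Fts: "\<And>s t. \<lbrakk>norm s < \<delta>; norm t < \<delta>\<rbrakk> \<Longrightarrow> ((\<lambda>s. Ft s t) has_field_derivative Fts s t) (at s)"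
    and bound: "\<And>s t. \<lbrakk>norm s < \<delta>; norm t < \<delta>\<rbrakk> \<Longrightarrow> norm (Fts s t - c) \<le> \<epsilon>"
    and h: "norm h < \<delta>" and k: "norm k < \<delta>"
  shows "norm (F h k - F h 0 - F 0 k + F 0 0 - h * k * c) \<le> \<epsilon> * norm h * norm k"
proof -
  have \<delta>: "\<delta> > 0" using h norm_ge_zero[of h] by linarith
  have inner: "norm (Ft h t - Ft 0 t - h * c) \<le> \<epsilon> * norm h" if t: "norm t < \<delta>" for t
  proof -
    have "norm ((Ft h t - h * c) - (Ft 0 t - 0 * c)) \<le> \<epsilon> * norm (h - 0)"
    proof (rule field_differentiable_bound[where S="ball 0 \<delta>" and f'="\<lambda>s. Fts s t - c"])
      fix s :: 'k assume "s \<in> ball 0 \<delta>"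
      then have "norm s < \<delta>" by simp
      have "((\<lambda>s. Ft s t - s * c) has_field_derivative Fts s t - 1 * c) (at s)"
        by (intro DERIV_diff Fts DERIV_cmult_right DERIV_ident \<open>norm s < \<delta>\<close> t)
      then show "((\<lambda>s. Ft s t - s * c) has_field_derivative Fts s t - c) (at s within ball 0 \<delta>)"
        by (simp add: has_field_derivative_at_within)
      show "norm (Fts s t - c) \<le> \<epsilon>" using \<open>norm s < \<delta>\<close> t by (rule bound)
    qed (use h \<delta> in auto)
    then show ?thesis by (simp add: algebra_simps)
  qed
  have "norm ((F h k - F 0 k - h * k * c) - (F h 0 - F 0 0 - h * 0 * c)) \<le> \<epsilon> * norm h * norm (k - 0)"
  proof (rule field_differentiable_bound[where S="ball 0 \<delta>" and f'="\<lambda>t. Ft h t - Ft 0 t - h * c"])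
    fix t :: 'k assume "t \<in> ball 0 \<delta>"
    then have t: "norm t < \<delta>" by simp
    have "((\<lambda>t. F h t - F 0 t - h * t * c) has_field_derivative Ft h t - Ft 0 t - h * 1 * c) (at t)"
      by (intro DERIV_diff Ft DERIV_cmult_right DERIV_cmult DERIV_ident h t) (use \<delta> in simp)
    then show "((\<lambda>t. F h t - F 0 t - h * t * c) has_field_derivative Ft h t - Ft 0 t - h * c)
        (at t within ball 0 \<delta>)"
      by (simp add: has_field_derivative_at_within)
    show "norm (Ft h t - Ft 0 t - h * c) \<le> \<epsilon> * norm h" by (rule inner[OF t])
  qed (use k \<delta> in auto)
  then show ?thesis by (simp add: algebra_simps)
qed

lemma norm_two_axes:
  "norm (s *s axis i 1 + t *s axis j 1 :: 'k::real_normed_field ^ coord) \<le> norm s + norm t"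
  using norm_triangle_ineq[of "s *s axis i 1" "t *s axis j 1 :: 'k ^ coord"]
  by (simp add: norm_scaled_axis)

text \<open>Schwarz's theorem. The second difference of \<open>f\<close> along two axes does not see
  their order, yet divided by \<open>h * h\<close> it approximates either mixed derivative.\<close>

lemma partial_commute:
  fixes f :: "'k::real_normed_field ^ coord \<Rightarrow> 'k"
  assumes U: "open U" "u \<in> U" and f: "regular_on U f"
  shows "partial i (partial j f) u = partial j (partial i f) u"
proof -
  define c where "c = (\<lambda>i j. partial i (partial j f) u)"
  define A where "A = (\<lambda>h i j. f (u + h *s axis i 1 + h *s axis j 1) - f (u + h *s axis i 1)
     - f (u + h *s axis j 1) + f u)"
  have near: "\<exists>\<delta>>0. \<forall>h. norm h < \<delta> \<longrightarrow> norm (A h i j - h * h * c i j) \<le> \<epsilon> * norm h * norm h"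
    if "\<epsilon> > 0" for \<epsilon> :: real and i j
  proof -
    have "continuous_on U (partial i (partial j f))"
      by (intro regular_on_continuous regular_on_partial f)
    then have "\<exists>d>0. \<forall>v\<in>U. dist v u < d \<longrightarrow> norm (partial i (partial j f) v - c i j) < \<epsilon>"
      using \<open>\<epsilon> > 0\<close> \<open>u \<in> U\<close> by (simp add: continuous_on_iff c_def dist_norm)
    then obtain d1 where d1: "d1 > 0"
      "\<And>v. \<lbrakk>v \<in> U; dist v u < d1\<rbrakk> \<Longrightarrow> norm (partial i (partial j f) v - c i j) < \<epsilon>"
      by blast
    obtain d2 where d2: "d2 > 0" "ball u d2 \<subseteq> U"
      using U open_contains_ball by blast
    \<comment> \<open>Halved, because the displacements along the two axes add up.\<close>
    define \<delta> where "\<delta> = min d1 d2 / 2"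
    have \<delta>: "\<delta> > 0" using d1 d2 by (simp add: \<delta>_def)
    have in1: "u + s *s axis i 1 + t *s axis j 1 \<in> U \<and>
        dist (u + s *s axis i 1 + t *s axis j 1) u < d1"
      if "norm s < \<delta>" "norm t < \<delta>" for s t
    proof -
      have "dist (u + s *s axis i 1 + t *s axis j 1) u < min d1 d2"
        using norm_two_axes[of s i t j] that by (simp add: dist_norm \<delta>_def add.assoc)
      then show ?thesis using d2 by (auto simp: dist_commute)
    qed
    have "norm (A h i j - h * h * c i j) \<le> \<epsilon> * norm h * norm h" if h: "norm h < \<delta>" for h
    proof -
      let ?F = "\<lambda>s t. f (u + s *s axis i 1 + t *s axis j 1)"
      have sw: "u + s *s axis i 1 + t *s axis j 1 = u + t *s axis j 1 + s *s axis i 1" for s t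
        by (simp add: algebra_simps)
      have "norm (?F h h - ?F h 0 - ?F 0 h + ?F 0 0 - h * h * c i j) \<le> \<epsilon> * norm h * norm h"
      proof (rule mixed_difference_bound)
        fix s t :: 'k assume st: "norm s < \<delta>" "norm t < \<delta>"
        show "(?F s has_field_derivative partial j f (u + s *s axis i 1 + t *s axis j 1)) (at t)"
          by (intro has_partial_line regular_on_has_partial[OF f]) (use in1[OF st] in auto)
        have "((\<lambda>s. partial j f (u + t *s axis j 1 + s *s axis i 1)) has_field_derivative
            partial i (partial j f) (u + t *s axis j 1 + s *s axis i 1)) (at s)"
          by (intro has_partial_line regular_on_has_partial[OF regular_on_partial[OF f]])
             (use in1[OF st] sw in auto)
        then show "((\<lambda>s. partial j f (u + s *s axis i 1 + t *s axis j 1)) has_field_derivative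
            partial i (partial j f) (u + s *s axis i 1 + t *s axis j 1)) (at s)"
          by (simp add: sw)
        show "norm (partial i (partial j f) (u + s *s axis i 1 + t *s axis j 1) - c i j) \<le> \<epsilon>"
          using d1(2) in1[OF st] by (simp add: less_imp_le)
      qed (use h in auto)
      then show ?thesis by (simp add: A_def)
    qed
    then show ?thesis using \<delta> by blast
  qed
  have A_sym: "A h i j = A h j i" for h by (simp add: A_def algebra_simps)
  have small: "norm (c i j - c j i) \<le> 2 * \<epsilon>" if "\<epsilon> > 0" for \<epsilon> :: real
  proof -
    obtain d1 d2 where d: "d1 > 0" "d2 > 0"
      "\<And>h. norm h < d1 \<Longrightarrow> norm (A h i j - h * h * c i j) \<le> \<epsilon> * norm h * norm h"
      "\<And>h. norm h < d2 \<Longrightarrow> norm (A h j i - h * h * c j i) \<le> \<epsilon> * norm h * norm h"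
      using near[OF \<open>\<epsilon> > 0\<close>, of i j] near[OF \<open>\<epsilon> > 0\<close>, of j i] by blast
    define h :: 'k where "h = of_real (min d1 d2 / 2)"
    have h: "norm h = min d1 d2 / 2" "norm h > 0" "norm h < d1" "norm h < d2"
      using d(1,2) by (auto simp: h_def)
    have "norm (h * h * (c i j - c j i)) = norm ((A h i j - h * h * c j i) - (A h i j - h * h * c i j))"
      by (simp add: algebra_simps)
    also have "\<dots> \<le> norm (A h i j - h * h * c j i) + norm (A h i j - h * h * c i j)"
      by (rule norm_triangle_ineq4)
    also have "\<dots> \<le> (norm h * norm h) * (2 * \<epsilon>)"
      using d(3)[OF h(3)] d(4)[OF h(4)] by (simp add: A_sym algebra_simps)
    finally have "(norm h * norm h) * norm (c i j - c j i) \<le> (norm h * norm h) * (2 * \<epsilon>)"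
      by (simp add: norm_mult)
    then show ?thesis using h(2) by (simp add: mult_le_cancel_left)
  qed
  have "norm (c i j - c j i) \<le> 0"
  proof (rule field_le_epsilon)
    fix e :: real assume "e > 0"
    then show "norm (c i j - c j i) \<le> 0 + e"
      using small[of "e / 2"] by linarith
  qed
  then show ?thesis by (simp add: c_def)
qed

text \<open>Derivatives are known along the axes only, so within a ball the coordinates of
  \<open>u\<close> are exchanged for those of \<open>v\<close> one at a time. Connectedness then
  joins the balls.\<close>

lemma constant_of_zero_partials:
  fixes f :: "'k::real_normed_field ^ coord \<Rightarrow> 'k"
  assumes U: "open U" "connected U" and f: "\<And>i u. u \<in> U \<Longrightarrow> has_partial i f 0 u"
  shows "\<exists>c. \<forall>u\<in>U. f u = c"
proof -
  have "\<forall>\<^sub>F v in at u within U. f u = f v" if u: "u \<in> U" for u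
  proof -
    obtain e where e: "e > 0" "ball u e \<subseteq> U"
      using U u open_contains_ball by blast
    have eq: "f v = f u" if v: "dist v u < e" for v
    proof -
      \<comment> \<open>\<open>A\<close> is the set of coordinates already moved from
        \<open>u\<close> to \<open>v\<close>.\<close>
      have "f (\<chi> i. if i \<in> A then v $ i else u $ i) = f u" if "finite A" for A
        using that
      proof induction
        case empty
        then show ?case by simp
      next
        case (insert i A)
        let ?w = "\<chi> i. if i \<in> A then v $ i else u $ i"
        let ?r = "norm (v $ i - u $ i)"
        have "norm (f (?w + (v $ i - u $ i) *s axis i 1) - f (?w + 0 *s axis i 1))
            \<le> 0 * norm ((v $ i - u $ i) - 0)"
        proof (rule field_differentiable_bound[where S="cball 0 ?r" and f'="\<lambda>_. 0"])
          fix t :: 'k assume t: "t \<in> cball 0 ?r"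
          \<comment> \<open>Every component stays at least as close to \<open>u\<close> as that of
            \<open>v\<close>, so the segment does not leave the ball.\<close>
          have "norm (?w + t *s axis i 1 - u) \<le> norm (v - u)"
            by (rule norm_le_componentwise_cart) (use insert(2) t in \<open>auto simp: axis_def\<close>)
          also have "\<dots> < e" using v by (simp add: dist_norm)
          finally have "?w + t *s axis i 1 \<in> U"
            using e(2) by (auto simp: dist_norm norm_minus_commute)
          then show "((\<lambda>t. f (?w + t *s axis i 1)) has_field_derivative 0) (at t within cball 0 ?r)"
            by (intro DERIV_subset[OF has_partial_line] f) auto
        qed auto
        moreover have "?w + (v $ i - u $ i) *s axis i 1 = (\<chi> j. if j \<in> insert i A then v $ j else u $ j)"
          using insert(2) by (auto simp: vec_eq_iff axis_def)
        ultimately show ?case using insert.IH by simp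
      qed
      from this[of UNIV] show ?thesis by simp
    qed
    show ?thesis
      unfolding eventually_at
      by (intro exI[of _ e] conjI ballI impI e(1) eq[symmetric]) blast
  qed
  then have "f v = f w" if "v \<in> U" "w \<in> U" for v w
    using connected_local_const[OF \<open>connected U\<close> that, of f] by blast
  then show ?thesis
    by blast
qed

section \<open>Polynomial functions\<close>

text \<open>A syntactic class in which the existence of partial derivatives is settled by the shape
  of the term, so that derivatives of explicit polynomials can be computed by rewriting.\<close>

inductive polyfun :: "('k ^ coord \<Rightarrow> 'k::real_normed_field) \<Rightarrow> bool" where
  polyfun_const: "polyfun (\<lambda>u. c)"
| polyfun_coord: "polyfun (\<lambda>u. u $ j)"
| polyfun_add: "\<lbrakk>polyfun f; polyfun g\<rbrakk> \<Longrightarrow> polyfun (\<lambda>u. f u + g u)"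
| polyfun_mult: "\<lbrakk>polyfun f; polyfun g\<rbrakk> \<Longrightarrow> polyfun (\<lambda>u. f u * g u)"

lemma polyfun_minus: "polyfun f \<Longrightarrow> polyfun (\<lambda>u. - f u)"
  using polyfun_mult[OF polyfun_const[of "-1"], of f] by simp

lemma polyfun_diff: "\<lbrakk>polyfun f; polyfun g\<rbrakk> \<Longrightarrow> polyfun (\<lambda>u. f u - g u)"
  using polyfun_add[OF _ polyfun_minus, of f g] by simp

lemma polyfun_power: "polyfun f \<Longrightarrow> polyfun (\<lambda>u. f u ^ n)"
  by (induction n) (auto intro: polyfun.intros)

lemma polyfun_sum: "(\<And>x. x \<in> A \<Longrightarrow> polyfun (f x)) \<Longrightarrow> polyfun (\<lambda>u. \<Sum>x\<in>A. f x u)"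
  by (induction A rule: infinite_finite_induct) (auto intro: polyfun.intros)

lemmas polyfun_intros = polyfun_const polyfun_coord polyfun_add polyfun_mult polyfun_minus
  polyfun_diff polyfun_power polyfun_sum

text \<open>Both claims go through one induction for all \<open>u\<close>: the product rule at every
  point is what identifies the derivative of a product as a polynomial.\<close>

lemma polyfun_partial:
  fixes f :: "'k::real_normed_field ^ coord \<Rightarrow> 'k"
  assumes "polyfun f"
  shows "has_partial i f (partial i f u) u \<and> polyfun (partial i f)"
  using assms
proof (induction arbitrary: u)
  case (polyfun_const c)
  have "partial i (\<lambda>u. c) = (\<lambda>u. 0)" using has_partial_imp_partial[OF has_partial_const] by blast
  then show ?case by (simp add: has_partial_const polyfun.intros)
next
  case (polyfun_coord j)
  have "partial i (\<lambda>u::'k^coord. u $ j) = (\<lambda>u. if i = j then 1 else 0)"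
    using has_partial_imp_partial[OF has_partial_coord] by blast
  then have "polyfun (partial i (\<lambda>u::'k^coord. u $ j))"
    by (simp only: polyfun.polyfun_const)
  then show ?case using has_partial_self[OF has_partial_coord] by blast
next
  case (polyfun_add f g)
  have hp: "has_partial i (\<lambda>u. f u + g u) (partial i f u + partial i g u) u" for u
    using polyfun_add by (intro has_partial_add) auto
  have "partial i (\<lambda>u. f u + g u) = (\<lambda>u. partial i f u + partial i g u)"
    using has_partial_imp_partial[OF hp] by blast
  then show ?case using hp polyfun_add by (simp add: polyfun.intros)
next
  case (polyfun_mult f g)
  have hp: "has_partial i (\<lambda>u. f u * g u) (partial i f u * g u + f u * partial i g u) u" for u
    using polyfun_mult by (intro has_partial_mult) auto
  have "partial i (\<lambda>u. f u * g u) = (\<lambda>u. partial i f u * g u + f u * partial i g u)"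
    using has_partial_imp_partial[OF hp] by blast
  then show ?case using hp polyfun_mult by (simp add: polyfun.intros)
qed

lemma polyfun_continuous: "polyfun f \<Longrightarrow> continuous_on U f"
  by (induction rule: polyfun.induct) (auto intro!: continuous_intros)

lemma polyfun_regular: "polyfun f \<Longrightarrow> regular_on U f"
  unfolding regular_on_def
proof
  show "polyfun f \<Longrightarrow> Cn_on n U f" for n
    by (induction n arbitrary: f) (auto simp: polyfun_continuous polyfun_partial)
qed

lemma partial_const [simp]: "partial i (\<lambda>u. c) u = 0"
  by (rule has_partial_imp_partial[OF has_partial_const])

lemma partial_coord [simp]: "partial i (\<lambda>u. u $ j) u = (if i = j then 1 else 0)"
  by (rule has_partial_imp_partial[OF has_partial_coord])

lemma partial_add:
  assumes "polyfun f" "polyfun g"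
  shows "partial i (\<lambda>u. f u + g u) u = partial i f u + partial i g u"
  using polyfun_partial[OF assms(1)] polyfun_partial[OF assms(2)]
  by (intro has_partial_imp_partial has_partial_add) auto

lemma partial_diff:
  assumes "polyfun f" "polyfun g"
  shows "partial i (\<lambda>u. f u - g u) u = partial i f u - partial i g u"
  using polyfun_partial[OF assms(1)] polyfun_partial[OF assms(2)]
  by (intro has_partial_imp_partial has_partial_diff) auto

lemma partial_minus:
  assumes "polyfun f"
  shows "partial i (\<lambda>u. - f u) u = - partial i f u"
  using partial_diff[OF polyfun_const[of 0] assms] by simp

lemma partial_mult:
  assumes "polyfun f" "polyfun g"
  shows "partial i (\<lambda>u. f u * g u) u = partial i f u * g u + f u * partial i g u"
  using polyfun_partial[OF assms(1)] polyfun_partial[OF assms(2)]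
  by (intro has_partial_imp_partial has_partial_mult) auto

lemma partial_power:
  assumes "polyfun f"
  shows "partial i (\<lambda>u. f u ^ n) u = of_nat n * f u ^ (n - 1) * partial i f u"
proof (induction n)
  case (Suc n)
  then show ?case
    using partial_mult[OF assms polyfun_power[OF assms, of n], of i u]
    by (cases n) (simp_all add: algebra_simps)
qed simp

lemmas partial_simps = partial_add partial_diff partial_minus partial_mult partial_power

section \<open>Smooth and holomorphic functions\<close>

lemma Ck_on_imp_Cn_on: "Ck_on n U f \<Longrightarrow> Cn_on n U f"
proof (induction n arbitrary: f)
  case (Suc n)
  have "has_partial i f (partial i f u) u" if u: "u \<in> U" for u i
  proof -
    obtain D where D: "(f has_derivative D) (at u)"
      using Suc.prems u by (auto simp: differentiable_def)
    then have "D (t *s axis i 1) = t * D (axis i 1)" for t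
      by (simp add: scalar_mult_eq_scaleR linear_cmul has_derivative_linear)
    from has_partial_of_has_derivative[OF D this] show ?thesis
      by (rule has_partial_self)
  qed
  moreover have "continuous_on U f"
    using Suc.prems by (intro continuous_at_imp_continuous_on)
      (auto simp: differentiable_imp_continuous_within)
  ultimately show ?case using Suc by auto
qed simp

lemma smooth_imp_regular: "smooth_fn_on U f \<Longrightarrow> regular_on U f"
  by (auto simp: smooth_fn_on_def regular_on_def intro: Ck_on_imp_Cn_on)

lemma polyfun_differentiable:
  fixes f :: "real ^ coord \<Rightarrow> real"
  shows "polyfun f \<Longrightarrow> f differentiable (at u)"
proof (induction rule: polyfun.induct)
  case (polyfun_coord j)
  then show ?case
    by (intro bounded_linear_imp_differentiable bounded_linear_vec_nth)
qed auto

lemma polyfun_smooth: "polyfun f \<Longrightarrow> smooth_fn_on U f"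
  unfolding smooth_fn_on_def
proof
  show "polyfun f \<Longrightarrow> Ck_on n U f" for n
    by (induction n arbitrary: f)
       (auto simp: polyfun_continuous polyfun_partial polyfun_differentiable)
qed

lemma smooth_fn_on_cong:
  assumes "open U" "\<And>v. v \<in> U \<Longrightarrow> f v = g v"
  shows "smooth_fn_on U f \<longleftrightarrow> smooth_fn_on U g"
proof -
  have "Ck_on n U f \<Longrightarrow> Ck_on n U g" if "\<And>v. v \<in> U \<Longrightarrow> f v = g v" for n f g
    using that
  proof (induction n arbitrary: f g)
    case 0
    then show ?case by (simp cong: continuous_on_cong)
  next
    case (Suc n)
    have "g differentiable (at u)" if u: "u \<in> U" for u
    proof -
      obtain D where "(f has_derivative D) (at u)"
        using Suc.prems u by (auto simp: differentiable_def)
      then have "(g has_derivative D) (at u)"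
        by (rule has_derivative_transform_within_open[OF _ assms(1) u]) (rule Suc.prems)
      then show ?thesis by (auto simp: differentiable_def)
    qed
    moreover have "Ck_on n U (partial i g)" for i
      by (rule Suc.IH[of "partial i f"])
         (use Suc.prems partial_cong[OF assms(1) _ Suc.prems(2)] in auto)
    ultimately show ?case by simp
  qed
  from this[of f g] this[of g f] show ?thesis
    using assms(2) by (auto simp: smooth_fn_on_def)
qed

section \<open>Osgood's lemma: continuous, separately holomorphic functions\<close>

definition separately_holomorphic :: "(complex ^ coord) set \<Rightarrow> (complex ^ coord \<Rightarrow> complex) \<Rightarrow> bool" where
  "separately_holomorphic U f \<longleftrightarrow>
     continuous_on U f \<and> (\<forall>i. \<forall>u\<in>U. has_partial i f (partial i f u) u)"

text \<open>The parametrization of \<open>circlepath 0 \<rho>\<close>, named so that contour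
  integrals become integrals over the unit interval, where the theorems on parameter integrals
  apply.\<close>

definition circ :: "real \<Rightarrow> real \<Rightarrow> complex" where
  "circ \<rho> x = of_real \<rho> * exp (2 * of_real pi * \<i> * of_real x)"

lemma norm_circ: "\<rho> > 0 \<Longrightarrow> norm (circ \<rho> x) = \<rho>"
  by (simp add: circ_def norm_mult norm_exp_eq_Re)

lemma continuous_on_circ [continuous_intros]:
  "continuous_on A g \<Longrightarrow> continuous_on A (\<lambda>x. circ \<rho> (g x))"
  unfolding circ_def by (intro continuous_intros)

text \<open>Cauchy's formula for the first derivative: of \<open>f / w^2\<close> and
  \<open>dw = 2 pi i w dx\<close> only \<open>f / w\<close> is left.\<close>

lemma Cauchy_partial:
  assumes f: "separately_holomorphic U f" and \<rho>: "\<rho> > 0"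
    and sub: "\<And>t. norm t \<le> \<rho> \<Longrightarrow> v + t *s axis i 1 \<in> U"
  shows "partial i f v = integral (cbox 0 1) (\<lambda>x. f (v + circ \<rho> x *s axis i 1) / circ \<rho> x)"
proof -
  let ?g = "\<lambda>t. f (v + t *s axis i 1)"
  have d: "(?g has_field_derivative partial i f (v + t *s axis i 1)) (at t)" if "norm t \<le> \<rho>" for t
    using f sub[OF that] by (intro has_partial_line) (auto simp: separately_holomorphic_def)
  have c: "continuous_on (cball 0 \<rho>) ?g"
    by (intro continuous_at_imp_continuous_on ballI DERIV_isCont[OF d]) simp
  have h: "?g holomorphic_on ball 0 \<rho>"
    unfolding holomorphic_on_open[OF open_ball] by (intro ballI exI) (rule d, simp)
  have "(?g has_field_derivative (1 / (2 * of_real pi * \<i>) *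
      contour_integral (circlepath 0 \<rho>) (\<lambda>w. ?g w / (w - 0)^2))) (at 0)"
    by (rule Cauchy_derivative_integral_circlepath(2)[OF c h]) (use \<rho> in simp)
  then have "partial i f v = 1 / (2 * of_real pi * \<i>) *
      contour_integral (circlepath 0 \<rho>) (\<lambda>w. ?g w / w^2)"
    by (intro has_partial_imp_partial) (simp add: has_partial_def)
  also have "contour_integral (circlepath 0 \<rho>) (\<lambda>w. ?g w / w^2) =
      integral {0..1} (\<lambda>x. ?g (circ \<rho> x) / (circ \<rho> x)^2 * (2 * of_real pi * \<i> * circ \<rho> x))"
  proof -
    have "circlepath 0 \<rho> x = circ \<rho> x"
      "vector_derivative (circlepath 0 \<rho>) (at x) = 2 * of_real pi * \<i> * circ \<rho> x" for x
      by (simp_all add: vector_derivative_circlepath) (simp_all add: circlepath circ_def mult_ac)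
    then show ?thesis by (simp add: contour_integral_integral)
  qed
  also have "\<dots> = integral {0..1} (\<lambda>x. (2 * of_real pi * \<i>) * (?g (circ \<rho> x) / circ \<rho> x))"
  proof -
    have "circ \<rho> x \<noteq> 0" for x using norm_circ[OF \<rho>, of x] \<rho> by auto
    then show ?thesis by (simp add: power2_eq_square mult_ac)
  qed
  also have "\<dots> = (2 * of_real pi * \<i>) * integral {0..1} (\<lambda>x. ?g (circ \<rho> x) / circ \<rho> x)"
    by (rule integral_mult_right)
  finally show ?thesis
    by simp
qed

text \<open>With a fixed radius the integrand of \<open>Cauchy_partial\<close> is jointly continuous
  in the base point and the angle, and the interval of integration is compact.\<close>

lemma separately_holomorphic_partial_continuous:
  assumes U: "open U" and f: "separately_holomorphic U f"
  shows "continuous_on U (partial i f)"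
proof (rule continuous_at_imp_continuous_on, rule ballI)
  fix u assume "u \<in> U"
  then obtain e where e: "e > 0" "ball u e \<subseteq> U"
    using U open_contains_ball by blast
  \<comment> \<open>Half of \<open>e\<close>: base points within \<open>\<rho>\<close> of
    \<open>u\<close> still have room for a closed disc of radius \<open>\<rho>\<close>.\<close>
  define \<rho> where "\<rho> = e / 2"
  have \<rho>: "\<rho> > 0" using e by (simp add: \<rho>_def)
  have sub: "v + t *s axis i 1 \<in> U" if "v \<in> ball u \<rho>" "norm t \<le> \<rho>" for v t
  proof -
    have "norm ((v - u) + t *s axis i 1) \<le> norm (v - u) + norm t"
      using norm_triangle_ineq[of "v - u" "t *s axis i 1"] by (simp add: norm_scaled_axis)
    also have "\<dots> < e" using that by (simp add: dist_norm norm_minus_commute \<rho>_def)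
    finally have "v + t *s axis i 1 \<in> ball u e"
      by (simp add: dist_norm norm_minus_commute algebra_simps)
    then show ?thesis using e by blast
  qed
  have "continuous_on (ball u \<rho>) (\<lambda>v. integral (cbox 0 1) (\<lambda>x. f (v + circ \<rho> x *s axis i 1) / circ \<rho> x))"
  proof (rule integral_continuous_on_param)
    have "continuous_on (ball u \<rho> \<times> cbox 0 1) (\<lambda>a. f (fst a + circ \<rho> (snd a) *s axis i 1))"
      by (rule continuous_on_compose2[where t=U and g=f])
         (use f sub \<rho> in \<open>auto simp: separately_holomorphic_def norm_circ intro!: continuous_intros\<close>)
    then show "continuous_on (ball u \<rho> \<times> cbox 0 1)
        (\<lambda>(v, x). f (v + circ \<rho> x *s axis i 1) / circ \<rho> x)"
      unfolding case_prod_beta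
      by (intro continuous_intros) (use \<rho> in \<open>auto simp: circ_def\<close>)
  qed
  then have "continuous_on (ball u \<rho>) (partial i f)"
    by (subst continuous_on_cong[OF refl Cauchy_partial[OF f \<rho> sub]])
  then show "isCont (partial i f) u"
    using \<rho> by (simp add: continuous_on_eq_continuous_at)
qed

text \<open>Cauchy's formula is differentiated under the integral sign in direction
  \<open>j\<close>. The derivative of the integrand is continuous by the preceding lemma for
  \<open>partial j f\<close>. The class is thus stable under partial derivatives, and so its members
  lie in every \<open>Cn_on\<close>.\<close>

lemma separately_holomorphic_partial:
  assumes U: "open U" and f: "separately_holomorphic U f"
  shows "separately_holomorphic U (partial i f)"
proof -
  have "has_partial j (partial i f) (partial j (partial i f) u) u" if "u \<in> U" for u j
  proof -
    obtain e where e: "e > 0" "ball u e \<subseteq> U"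
      using U \<open>u \<in> U\<close> open_contains_ball by blast
    define \<rho> where "\<rho> = e / 2"
    have \<rho>: "\<rho> > 0" using e by (simp add: \<rho>_def)
    have sub: "u + s *s axis j 1 + t *s axis i 1 \<in> U" if "s \<in> ball 0 \<rho>" "norm t \<le> \<rho>" for s t :: complex
    proof -
      have "norm (s *s axis j 1 + t *s axis i 1 :: complex ^ coord) < e"
        using norm_two_axes[of s j t i] that by (simp add: \<rho>_def)
      then have "dist (u + s *s axis j 1 + t *s axis i 1) u < e"
        by (simp add: dist_norm add.assoc)
      then show ?thesis using e by (auto simp: dist_commute)
    qed
    have sw: "u + s *s axis j 1 + t *s axis i 1 = u + t *s axis i 1 + s *s axis j 1" for s t :: complex
      by (simp add: algebra_simps)
    let ?I = "\<lambda>s. integral (cbox 0 1) (\<lambda>x. f (u + s *s axis j 1 + circ \<rho> x *s axis i 1) / circ \<rho> x)"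
    have "continuous_on U (partial j f)"
      by (rule separately_holomorphic_partial_continuous[OF U f])
    then have c: "continuous_on (ball 0 \<rho> \<times> cbox 0 1)
        (\<lambda>a. g (u + fst a *s axis j 1 + circ \<rho> (snd a) *s axis i 1) / circ \<rho> (snd a))"
      if "continuous_on U g" for g
      by (intro continuous_on_divide continuous_on_compose2[OF that])
         (use sub \<rho> in \<open>auto simp: norm_circ intro!: continuous_intros, auto simp: circ_def\<close>)
    have "(?I has_field_derivative
        integral (cbox 0 1) (\<lambda>x. partial j f (u + 0 *s axis j 1 + circ \<rho> x *s axis i 1) / circ \<rho> x))
        (at 0 within ball 0 \<rho>)"
    proof (rule leibniz_rule_field_derivative)
      fix s :: complex and x :: real assume "s \<in> ball 0 \<rho>" "x \<in> cbox (0::real) 1"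
      then have "((\<lambda>s. f (u + circ \<rho> x *s axis i 1 + s *s axis j 1)) has_field_derivative
          partial j f (u + circ \<rho> x *s axis i 1 + s *s axis j 1)) (at s)"
        using f sub[of s "circ \<rho> x"] \<rho>
        by (intro has_partial_line) (auto simp: separately_holomorphic_def norm_circ sw)
      then have "((\<lambda>s. f (u + circ \<rho> x *s axis i 1 + s *s axis j 1) / circ \<rho> x) has_field_derivative
          partial j f (u + circ \<rho> x *s axis i 1 + s *s axis j 1) / circ \<rho> x) (at s within ball 0 \<rho>)"
        by (rule DERIV_cdivide[OF has_field_derivative_at_within])
      then show "((\<lambda>s. f (u + s *s axis j 1 + circ \<rho> x *s axis i 1) / circ \<rho> x) has_field_derivative
          partial j f (u + s *s axis j 1 + circ \<rho> x *s axis i 1) / circ \<rho> x) (at s within ball 0 \<rho>)"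
        by (simp add: sw)
    next
      fix s :: complex assume s: "s \<in> ball 0 \<rho>"
      have "continuous_on U f" using f by (simp add: separately_holomorphic_def)
      moreover have "continuous_on (cbox (0::real) 1) (\<lambda>x. (s, x))"
        by (intro continuous_intros)
      ultimately have "continuous_on (cbox 0 1)
          (\<lambda>x. f (u + fst (s, x) *s axis j 1 + circ \<rho> (snd (s, x)) *s axis i 1) / circ \<rho> (snd (s, x)))"
        using s by (intro continuous_on_compose2[OF c]) auto
      then show "(\<lambda>x. f (u + s *s axis j 1 + circ \<rho> x *s axis i 1) / circ \<rho> x) integrable_on cbox 0 1"
        unfolding fst_conv snd_conv by (rule integrable_continuous)
    next
      show "continuous_on (ball 0 \<rho> \<times> cbox 0 1)
          (\<lambda>(s, x). partial j f (u + s *s axis j 1 + circ \<rho> x *s axis i 1) / circ \<rho> x)"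
        using c[OF \<open>continuous_on U (partial j f)\<close>] by (simp add: case_prod_beta)
    qed (use \<rho> in auto)
    then have "(?I has_field_derivative
        integral (cbox 0 1) (\<lambda>x. partial j f (u + 0 *s axis j 1 + circ \<rho> x *s axis i 1) / circ \<rho> x)) (at 0)"
      using \<rho> by (simp add: at_within_open[OF _ open_ball])
    \<comment> \<open>For small \<open>s\<close> the parameter integral is
      \<open>partial i f\<close> on the line, again by Cauchy's formula.\<close>
    then have "((\<lambda>s. partial i f (u + s *s axis j 1)) has_field_derivative
        integral (cbox 0 1) (\<lambda>x. partial j f (u + 0 *s axis j 1 + circ \<rho> x *s axis i 1) / circ \<rho> x)) (at 0)"
      by (rule has_field_derivative_transform_within_open[where S="ball 0 \<rho>"])
         (use \<rho> Cauchy_partial[OF f \<rho> sub] in auto)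
    then show ?thesis
      unfolding has_partial_def[symmetric] by (rule has_partial_self)
  qed
  then show ?thesis
    using separately_holomorphic_partial_continuous[OF assms]
    by (simp add: separately_holomorphic_def)
qed

lemma linear_vec_field_iff:
  "Vector_Spaces.linear (*s) (*) (D :: 'k::field ^ coord \<Rightarrow> 'k) \<longleftrightarrow>
    (\<forall>x y. D (x + y) = D x + D y) \<and> (\<forall>c x. D (c *s x) = c * D x)"
  by (auto simp: Vector_Spaces.linear_def module_hom_def module_hom_axioms_def module_def
    vector_space_def algebra_simps vec_eq_iff)

lemma holomorphic_imp_regular:
  assumes U: "open U" and f: "holomorphic_fn_on U f"
  shows "regular_on U f"
proof -
  have "has_partial i f (partial i f u) u \<and> isCont f u" if u: "u \<in> U" for u i
  proof -
    obtain D where D: "(f has_derivative D) (at u)" "Vector_Spaces.linear (*s) (*) D"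
      using f u by (auto simp: holomorphic_fn_on_def)
    then have "D (t *s axis i 1) = t * D (axis i 1)" for t
      by (simp add: linear_vec_field_iff)
    from has_partial_of_has_derivative[OF D(1) this] show ?thesis
      using has_partial_self has_derivative_continuous[OF D(1)] by blast
  qed
  then have "separately_holomorphic U f"
    by (auto simp: separately_holomorphic_def intro: continuous_at_imp_continuous_on)
  then have "Cn_on n U f" for n
  proof (induction n arbitrary: f)
    case (Suc n)
    then show ?case
      using separately_holomorphic_partial[OF U Suc.prems] by (auto simp: separately_holomorphic_def)
  qed (simp add: separately_holomorphic_def)
  then show ?thesis by (simp add: regular_on_def)
qed

lemma polyfun_holomorphic: "polyfun f \<Longrightarrow> holomorphic_fn_on U f"
proof -
  assume "polyfun f"
  then have "\<exists>D. Vector_Spaces.linear (*s) (*) D \<and> (f has_derivative D) (at u)" for u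
  proof induction
    case (polyfun_const c)
    have "Vector_Spaces.linear (*s) (*) (\<lambda>v::complex^coord. 0::complex)"
      by (simp add: linear_vec_field_iff algebra_simps)
    then show ?case using has_derivative_const by blast
  next
    case (polyfun_coord j)
    have "Vector_Spaces.linear (*s) (*) (\<lambda>v::complex^coord. v $ j)"
      by (simp add: linear_vec_field_iff algebra_simps)
    moreover have "((\<lambda>v::complex^coord. v $ j) has_derivative (\<lambda>v. v $ j)) (at u)"
      by (intro bounded_linear_imp_has_derivative bounded_linear_vec_nth)
    ultimately show ?case by blast
  next
    case (polyfun_add f g)
    then obtain D E where DE: "Vector_Spaces.linear (*s) (*) D" "(f has_derivative D) (at u)"
      "Vector_Spaces.linear (*s) (*) E" "(g has_derivative E) (at u)" by blast
    have "Vector_Spaces.linear (*s) (*) (\<lambda>v. D v + E v)"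
      using DE(1,3) by (simp add: linear_vec_field_iff algebra_simps)
    then show ?case using has_derivative_add[OF DE(2,4)] by blast
  next
    case (polyfun_mult f g)
    then obtain D E where DE: "Vector_Spaces.linear (*s) (*) D" "(f has_derivative D) (at u)"
      "Vector_Spaces.linear (*s) (*) E" "(g has_derivative E) (at u)" by blast
    have "Vector_Spaces.linear (*s) (*) (\<lambda>v. f u * E v + D v * g u)"
      using DE(1,3) by (simp add: linear_vec_field_iff algebra_simps)
    then show ?case using has_derivative_mult[OF DE(2,4)] by blast
  qed
  then show ?thesis by (simp add: holomorphic_fn_on_def)
qed

lemma holomorphic_fn_on_cong:
  assumes "open U" "\<And>v. v \<in> U \<Longrightarrow> f v = g v"
  shows "holomorphic_fn_on U f \<longleftrightarrow> holomorphic_fn_on U g"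
proof -
  have "holomorphic_fn_on U g" if "holomorphic_fn_on U f" "\<And>v. v \<in> U \<Longrightarrow> f v = g v" for f g
    using that has_derivative_transform_within_open[OF _ assms(1)]
    unfolding holomorphic_fn_on_def by blast
  from this[of f g] this[of g f] show ?thesis using assms(2) by auto
qed

section \<open>Recognising the split simple Lie algebra of type $G_2$\<close>

context lie_algebra
begin

lemma br_zero_left: "X \<in> L \<Longrightarrow> br 0 X = 0"
  using br_scale_left[of X X 0] by simp

lemma br_zero_right: "X \<in> L \<Longrightarrow> br X 0 = 0"
  using br_scale_right[of X X 0] by simp

lemma br_anticommute:
  assumes "X \<in> L" "Y \<in> L"
  shows "br Y X = - br X Y"
proof -
  have XY: "X + Y \<in> L" using assms subspace_L subspace_add by blast
  have "br (X + Y) (X + Y) = br X X + br X Y + (br Y X + br Y Y)"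
    by (simp add: assms XY br_add_left br_add_right)
  then have "br X Y + br Y X = 0"
    by (simp add: assms XY br_self)
  then show ?thesis by (simp add: eq_neg_iff_add_eq_0 add.commute)
qed

lemma br_sum_right:
  "\<lbrakk>X \<in> L; \<And>i. i \<in> J \<Longrightarrow> v i \<in> L\<rbrakk> \<Longrightarrow> br X (\<Sum>i\<in>J. v i) = (\<Sum>i\<in>J. br X (v i))"
proof (induction J rule: infinite_finite_induct)
  case (insert j J)
  moreover have "(\<Sum>i\<in>J. v i) \<in> L"
    using insert by (intro subspace_sum subspace_L) auto
  ultimately show ?case by (simp add: br_add_right)
qed (simp_all add: br_zero_right)

lemma subspace_scale_cancel: "\<lbrakk>subspace W; c \<noteq> 0; scale c X \<in> W\<rbrakk> \<Longrightarrow> X \<in> W"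
  using subspace_scale[of W "scale c X" "inverse c"] by simp

text \<open>Applying \<open>br H\<close> minus \<open>lam j\<close> keeps the sum in
  \<open>W\<close>, removes the summand \<open>j\<close> and multiplies the others by the nonzero
  numbers \<open>lam i - lam j\<close>. Induction yields these summands, and subtraction the last
  one.\<close>

lemma eigenvector_components_in_invariant_subspace:
  assumes "finite J" and H: "H \<in> L"
    and W: "subspace W" "W \<subseteq> L" "\<forall>X\<in>W. br H X \<in> W"
    and "\<And>i. i \<in> J \<Longrightarrow> v i \<in> L" "\<And>i. i \<in> J \<Longrightarrow> br H (v i) = scale (lam i) (v i)"
    and "inj_on lam J" "(\<Sum>i\<in>J. v i) \<in> W"
  shows "\<forall>i\<in>J. v i \<in> W"
  using assms(1,6-)
proof (induction J arbitrary: v rule: finite_induct)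
  case (insert j J)
  let ?s = "\<Sum>i\<in>insert j J. v i"
  let ?w = "\<lambda>i. scale (lam i - lam j) (v i)"
  have "br H ?s - scale (lam j) ?s \<in> W"
    using insert.prems W by (intro subspace_diff subspace_scale) auto
  also have "br H ?s - scale (lam j) ?s = (\<Sum>i\<in>J. ?w i)"
  proof -
    have "br H ?s = (\<Sum>i\<in>insert j J. scale (lam i) (v i))"
      using insert.prems(1,2) by (subst br_sum_right[OF H]) auto
    then show ?thesis
      using insert.hyps
      by (simp add: scale_right_distrib scale_sum_right sum_subtractf scale_left_diff_distrib)
  qed
  finally have "\<forall>i\<in>J. ?w i \<in> W"
    using insert.prems subspace_L
    by (intro insert.IH) (auto simp: br_scale_right[OF H] inj_on_def subspace_scale mult.commute)
  then have J: "v i \<in> W" if "i \<in> J" for i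
  proof -
    have "lam i - lam j \<noteq> 0"
      using insert.prems(3) insert.hyps that by (auto simp: inj_on_def)
    then show ?thesis
      using subspace_scale_cancel[OF W(1)] \<open>\<forall>i\<in>J. ?w i \<in> W\<close> that by blast
  qed
  then have "?s - (\<Sum>i\<in>J. v i) \<in> W"
    by (intro subspace_diff[OF W(1) insert.prems(4)] subspace_sum[OF W(1)])
  then have "v j \<in> W" using insert.hyps by simp
  then show ?case using J by simp
qed simp

end

text \<open>The twelve root vectors \<open>e 1, \<dots>, e 12\<close> are numbered by the hours of the clock face; \<open>A\<close> and
  \<open>E\<close> are the multiples $2h_1$ and $\frac2{\sqrt3}h_2$, on which all roots are integral.\<close>

definition clock_A :: "nat \<Rightarrow> int" where
  "clock_A i = [0, 1, 3, 2, 3, 1, 0, -1, -3, -2, -3, -1, 0] ! i"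

definition clock_E :: "nat \<Rightarrow> int" where
  "clock_E i = [0, 1, 1, 0, -1, -1, -2, -1, -1, 0, 1, 1, 2] ! i"

lemma clock_set: "{1..12} = {1, 2, 3, 4, 5, 6, 7, 8, 9, 10, 11, 12::nat}"
  by (simp add: atLeastAtMost_insertL[symmetric] numeral_eq_Suc atLeastAtMost_singleton
      atLeastAtMostSuc_conv insert_commute)

lemma clock_values [simp]:
  "clock_A (Suc 0) = 1" "clock_E (Suc 0) = 1"
  "clock_A 2 = 3" "clock_E 2 = 1"
  "clock_A 3 = 2" "clock_E 3 = 0"
  "clock_A 4 = 3" "clock_E 4 = - 1"
  "clock_A 5 = 1" "clock_E 5 = - 1"
  "clock_A 6 = 0" "clock_E 6 = - 2"
  "clock_A 7 = - 1" "clock_E 7 = - 1"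
  "clock_A 8 = - 3" "clock_E 8 = - 1"
  "clock_A 9 = - 2" "clock_E 9 = 0"
  "clock_A 10 = - 3" "clock_E 10 = 1"
  "clock_A 11 = - 1" "clock_E 11 = 1"
  "clock_A 12 = 0" "clock_E 12 = 2"
  by (simp_all add: clock_A_def clock_E_def)

text \<open>What is asked of a multiplication table: the weights, one step from each hour to the
  next, and two brackets of opposite root vectors that return \<open>A\<close> and \<open>E\<close>.
  Linear independence of the spanning vectors comes out of their weights, in
  \<open>components_unique\<close> and \<open>A_E_independent\<close>.\<close>

locale clock_basis = lie_algebra scale L br
  for scale :: "'k :: field_char_0 \<Rightarrow> 'v :: ab_group_add \<Rightarrow> 'v" and L br +
  fixes e :: "nat \<Rightarrow> 'v" and A E :: 'v
  assumes span_L: "span (e ` {1..12} \<union> {A, E}) = L"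
    and e_nonzero: "i \<in> {1..12} \<Longrightarrow> e i \<noteq> 0"
    and br_A_E: "br A E = 0"
    and br_A_e: "i \<in> {1..12} \<Longrightarrow> br A (e i) = scale (of_int (clock_A i)) (e i)"
    and br_E_e: "i \<in> {1..12} \<Longrightarrow> br E (e i) = scale (of_int (clock_E i)) (e i)"
    and br_next: "i \<in> {1..12} \<Longrightarrow>
      \<exists>X\<in>L. \<exists>c. c \<noteq> 0 \<and> br X (e i) = scale c (e (if i = 12 then 1 else Suc i))"
    and br_3_9: "\<exists>c. c \<noteq> 0 \<and> br (e 3) (e 9) = scale c A"
    and br_6_12: "\<exists>c. c \<noteq> 0 \<and> br (e 6) (e 12) = scale c E"
begin

abbreviation "h \<equiv> span {A, E}"

lemma basis_subset: "e ` {1..12} \<union> {A, E} \<subseteq> L"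
  by (subst span_L[symmetric]) (rule span_superset)

lemma A_in: "A \<in> L" and E_in: "E \<in> L" and e_in: "i \<in> {1..12} \<Longrightarrow> e i \<in> L"
  using basis_subset by auto

lemma h_subset: "h \<subseteq> L"
  using A_in E_in subspace_L by (intro span_minimal) auto

lemma h_cases:
  assumes "H \<in> h"
  obtains a b where "H = scale a A + scale b E"
proof -
  obtain a where "H - scale a A \<in> span {E}"
    using assms span_breakdown_eq[of H A "{E}"] by blast
  then obtain b where "H - scale a A - scale b E \<in> span {}"
    using span_breakdown_eq[of _ E "{}"] by blast
  then show thesis using that[of a b] by (simp add: algebra_simps)
qed

lemma in_h: "scale a A + scale b E \<in> h"
  by (intro span_add span_scale span_base) auto

lemma br_E_A: "br E A = 0"
  using br_anticommute[OF A_in E_in] br_A_E by simp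

lemma scaled_in: "X \<in> L \<Longrightarrow> scale c X \<in> L"
  using subspace_L by (rule subspace_scale)

lemma br_h_h:
  assumes "H \<in> h" "K \<in> h"
  shows "br H K = 0"
proof -
  obtain a b a' b' where "H = scale a A + scale b E" "K = scale a' A + scale b' E"
    using assms by (meson h_cases)
  then show ?thesis
    by (simp add: br_add_left br_add_right br_scale_left br_scale_right A_in E_in scaled_in
        subspace_add[OF subspace_L] br_self br_A_E br_E_A)
qed

lemma br_h_e:
  assumes "i \<in> {1..12}"
  shows "br (scale a A + scale b E) (e i) =
    scale (a * of_int (clock_A i) + b * of_int (clock_E i)) (e i)"
  by (simp add: br_add_left br_scale_left A_in E_in scaled_in e_in[OF assms] br_A_e[OF assms]
      br_E_e[OF assms] scale_left_distrib)

text \<open>Read off from the eigenvector \<open>e i\<close>, so that it is well defined before the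
  coordinates \<open>a\<close>, \<open>b\<close> of an element of \<open>h\<close> are known to be
  unique; zero off \<open>h\<close>, as \<open>dual_on\<close> demands.\<close>

definition root_fun :: "nat \<Rightarrow> 'v \<Rightarrow> 'k" where
  "root_fun i H = (if H \<in> h then (SOME c. br H (e i) = scale c (e i)) else 0)"

lemma root_fun_eq:
  assumes i: "i \<in> {1..12}"
  shows "root_fun i (scale a A + scale b E) = a * of_int (clock_A i) + b * of_int (clock_E i)"
proof -
  have "(SOME c. br (scale a A + scale b E) (e i) = scale c (e i)) =
      a * of_int (clock_A i) + b * of_int (clock_E i)"
    by (rule some_equality) (use e_nonzero[OF i] in \<open>auto simp: br_h_e[OF i] simp del: of_int_add\<close>)
  then show ?thesis by (simp only: root_fun_def in_h if_True)
qed

lemma br_root_fun: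
  assumes "i \<in> {1..12}" "H \<in> h"
  shows "br H (e i) = scale (root_fun i H) (e i)"
  using assms(2) by (rule h_cases) (simp add: root_fun_eq[OF assms(1)] br_h_e[OF assms(1)])

lemma root_fun_dual:
  assumes i: "i \<in> {1..12}"
  shows "root_fun i \<in> dual_on h"
proof -
  have "root_fun i (H + K) = root_fun i H + root_fun i K" if HK: "H \<in> h" "K \<in> h" for H K
  proof -
    obtain a b a' b' where eq: "H = scale a A + scale b E" "K = scale a' A + scale b' E"
      using HK by (meson h_cases)
    then have sum: "H + K = scale (a + a') A + scale (b + b') E"
      by (simp add: scale_left_distrib)
    show ?thesis
      unfolding sum root_fun_eq[OF i] unfolding eq root_fun_eq[OF i] by (simp add: algebra_simps)
  qed
  moreover have "root_fun i (scale c H) = c * root_fun i H" if H: "H \<in> h" for c H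
  proof -
    obtain a b where eq: "H = scale a A + scale b E" using H by (rule h_cases)
    then have prod: "scale c H = scale (c * a) A + scale (c * b) E"
      by (simp add: scale_right_distrib)
    show ?thesis
      unfolding prod root_fun_eq[OF i] unfolding eq root_fun_eq[OF i] by (simp add: algebra_simps)
  qed
  ultimately show ?thesis by (simp add: dual_on_def root_fun_def)
qed

lemma L_cases:
  assumes "X \<in> L"
  obtains c H where "H \<in> h" "X = H + (\<Sum>i\<in>{1..12}. scale (c i) (e i))"
proof -
  have "X \<in> span ({A, E} \<union> e ` {1..12})"
    using assms span_L by (simp add: Un_commute)
  then obtain H Y where "H \<in> h" "Y \<in> span (e ` {1..12})" "X = H + Y"
    unfolding span_Un by blast
  moreover have "\<exists>c. Y = (\<Sum>i\<in>{1..12}. scale (c i) (e i))"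
    using \<open>Y \<in> span (e ` {1..12})\<close>
  proof (induction rule: span_induct_alt)
    case base
    have "0 = (\<Sum>i\<in>{1..12}. scale 0 (e i))" by simp
    then show ?case by (rule exI[of _ "\<lambda>_. 0"])
  next
    case (step a x y)
    then obtain c j where "y = (\<Sum>i\<in>{1..12}. scale (c i) (e i))" "j \<in> {1..12}" "x = e j"
      by auto
    then have "scale a x + y = (\<Sum>i\<in>{1..12}. scale ((if i = j then a else 0) + c i) (e i))"
      by (simp add: scale_left_distrib sum.distrib if_distrib[of "\<lambda>r. scale r _"] cong: if_cong)
    then show ?case by (rule exI[of _ "\<lambda>i. (if i = j then a else 0) + c i"])
  qed
  ultimately show thesis using that by blast
qed

lemma br_L_cases:
  assumes K: "K \<in> L" and H: "H \<in> h"
  shows "br K (H + (\<Sum>i\<in>{1..12}. scale (c i) (e i))) =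
    br K H + (\<Sum>i\<in>{1..12}. scale (c i) (br K (e i)))"
proof -
  have in_L: "scale (c i) (e i) \<in> L" if "i \<in> {1..12}" for i
    using that by (intro scaled_in e_in)
  then have "(\<Sum>i\<in>{1..12}. scale (c i) (e i)) \<in> L"
    using subspace_L by (intro subspace_sum)
  then have "br K (H + (\<Sum>i\<in>{1..12}. scale (c i) (e i))) =
      br K H + br K (\<Sum>i\<in>{1..12}. scale (c i) (e i))"
    using H h_subset K by (intro br_add_right) auto
  also have "br K (\<Sum>i\<in>{1..12}. scale (c i) (e i)) = (\<Sum>i\<in>{1..12}. br K (scale (c i) (e i)))"
    by (rule br_sum_right[OF K in_L])
  also have "(\<Sum>i\<in>{1..12}. br K (scale (c i) (e i))) = (\<Sum>i\<in>{1..12}. scale (c i) (br K (e i)))"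
    by (intro sum.cong refl br_scale_right K e_in)
  finally show ?thesis .
qed

text \<open>The root vectors have pairwise distinct eigenvalues $\alpha(A)+4\alpha(E)$ under this element.\<close>

definition "H0 = scale 1 A + scale 4 E"

lemma H0_in_h: "H0 \<in> h"
  unfolding H0_def by (rule in_h)

lemma H0_in: "H0 \<in> L"
  using H0_in_h h_subset by blast

lemma H0_e: "i \<in> {1..12} \<Longrightarrow> br H0 (e i) = scale (of_int (clock_A i + 4 * clock_E i)) (e i)"
  using br_h_e[of i 1 4] by (simp only: H0_def) simp

text \<open>Index 0 has weight 0 and stands for the \<open>h\<close>-part of an element. Its
  inclusion makes the value of every root on \<open>H0\<close> nonzero as well.\<close>

lemma clock_distinct: "inj_on (\<lambda>i. clock_A i + 4 * clock_E i) {0..12}"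
proof -
  have "{0..12} = insert 0 {1..12::nat}" by auto
  then have "{0..12} = {0, 1, 2, 3, 4, 5, 6, 7, 8, 9, 10, 11, 12::nat}"
    by (simp only: clock_set)
  then show ?thesis
    by (simp add: inj_on_def clock_A_def[of 0] clock_E_def[of 0])
qed

lemma clock_nonzero: "i \<in> {1..12} \<Longrightarrow> clock_A i + 4 * clock_E i \<noteq> 0"
  using inj_onD[OF clock_distinct, of i 0] by (auto simp: clock_A_def clock_E_def)

lemma components_in:
  assumes W: "subspace W" "W \<subseteq> L" "\<forall>X\<in>W. br H0 X \<in> W"
    and H: "H \<in> h" and sum: "H + (\<Sum>i\<in>{1..12}. scale (c i) (e i)) \<in> W"
  shows "H \<in> W" and "\<And>i. i \<in> {1..12} \<Longrightarrow> c i \<noteq> 0 \<Longrightarrow> e i \<in> W"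
proof -
  \<comment> \<open>The \<open>h\<close>-part joins the family as component 0, an eigenvector of
    eigenvalue 0.\<close>
  define v where "v = (\<lambda>i. if i = 0 then H else scale (c i) (e i))"
  have "\<forall>i\<in>{0..12}. v i \<in> W"
  proof (rule eigenvector_components_in_invariant_subspace[OF _ H0_in W])
    show "inj_on (\<lambda>i. of_int (clock_A i + 4 * clock_E i) :: 'k) {0..12}"
      using clock_distinct unfolding inj_on_def of_int_eq_iff .
    show "(\<Sum>i\<in>{0..12}. v i) \<in> W"
      using sum by (subst sum.atLeast_Suc_atMost) (simp_all add: v_def)
    fix i :: nat assume i: "i \<in> {0..12}"
    show "v i \<in> L"
      using i H h_subset by (auto simp: v_def intro!: scaled_in e_in)
    show "br H0 (v i) = scale (of_int (clock_A i + 4 * clock_E i)) (v i)"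
    proof (cases "i = 0")
      case True
      then show ?thesis using br_h_h[OF H0_in_h H] by (simp add: v_def clock_A_def clock_E_def)
    next
      case False
      then show ?thesis using i
        by (simp add: v_def br_scale_right[OF H0_in e_in] H0_e mult.commute del: of_int_add of_int_mult)
    qed
  qed simp
  then have "v 0 \<in> W" "\<And>i. i \<in> {1..12} \<Longrightarrow> v i \<in> W" by auto
  then show "H \<in> W" and "\<And>i. i \<in> {1..12} \<Longrightarrow> c i \<noteq> 0 \<Longrightarrow> e i \<in> W"
    using subspace_scale_cancel[OF W(1)] by (auto simp: v_def)
qed

text \<open>The case \<open>W = {0}\<close> of \<open>components_in\<close>.\<close>

lemma components_unique:
  assumes "H \<in> h" "H + (\<Sum>i\<in>{1..12}. scale (c i) (e i)) = 0"
  shows "H = 0" and "\<And>i. i \<in> {1..12} \<Longrightarrow> c i = 0"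
proof -
  have "subspace {0}" "{0} \<subseteq> L" "\<forall>X\<in>{0}. br H0 X \<in> {0}"
    using subspace_0[OF subspace_L] by (auto simp: br_zero_right H0_in)
  note * = components_in[OF this assms(1)]
  show "H = 0" using *(1) assms(2) by simp
  show "c i = 0" if "i \<in> {1..12}" for i
  proof (rule ccontr)
    assume "c i \<noteq> 0"
    then have "e i \<in> {0}" using *(2) assms(2) that by blast
    then show False using e_nonzero[OF that] by simp
  qed
qed

lemma A_E_independent:
  assumes "scale a A + scale b E = 0"
  shows "a = 0 \<and> b = 0"
proof -
  have *: "scale (a * of_int (clock_A i) + b * of_int (clock_E i)) (e i) = 0" if "i \<in> {1..12}" for i
    using br_h_e[OF that, of a b] assms br_zero_left[OF e_in[OF that]] by simp
  then have "a * of_int (clock_A i) + b * of_int (clock_E i) = 0" if "i \<in> {1..12}" for i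
    using *[OF that] e_nonzero[OF that] by simp
  \<comment> \<open>Hours 3 and 6 have the weights \<open>(2, 0)\<close> and
    \<open>(0, - 2)\<close>, so they isolate \<open>a\<close> and \<open>b\<close>.\<close>
  from this[of 3] this[of 6] show ?thesis
    by simp
qed

lemma A_neq_E: "A \<noteq> E"
  using A_E_independent[of 1 "-1"] by auto

lemma e_inj: "inj_on e {1..12}"
proof (rule inj_onI)
  fix i j :: nat assume ij: "i \<in> {1..12}" "j \<in> {1..12}" "e i = e j"
  then have "(of_int (clock_A i + 4 * clock_E i) :: 'k) = of_int (clock_A j + 4 * clock_E j)"
    using H0_e[OF ij(1)] H0_e[OF ij(2)] e_nonzero[OF ij(1)] by (metis scale_cancel_right)
  then show "i = j"
    using inj_onD[OF clock_distinct, of i j] ij unfolding of_int_eq_iff by auto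
qed

lemma e_notin_h: "i \<in> {1..12} \<Longrightarrow> e i \<notin> h"
proof
  assume i: "i \<in> {1..12}" and "e i \<in> h"
  then have "scale (of_int (clock_A i + 4 * clock_E i)) (e i) = 0"
    using H0_e[OF i] br_h_h[OF H0_in_h \<open>e i \<in> h\<close>] by simp
  then show False
    using e_nonzero[OF i] clock_nonzero[OF i] by (simp del: of_int_add of_int_mult)
qed

lemma A_E_notin: "A \<notin> e ` {1..12}" "E \<notin> e ` {1..12}"
  using e_notin_h span_base[of A "{A, E}"] span_base[of E "{A, E}"] by auto

lemma dim_L: "dim L = 14"
proof -
  let ?B = "insert A (insert E (e ` {1..12}))"
  have "independent ?B"
  proof (rule independent_if_scalars_zero)
    fix f X assume f: "(\<Sum>x\<in>?B. scale (f x) x) = 0" and X: "X \<in> ?B"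
    have "(\<Sum>x\<in>?B. scale (f x) x) =
        (scale (f A) A + scale (f E) E) + (\<Sum>i\<in>{1..12}. scale (f (e i)) (e i))"
      using A_E_notin A_neq_E by (simp add: sum.reindex[OF e_inj] add.assoc del: One_nat_def)
    with f have "(scale (f A) A + scale (f E) E) + (\<Sum>i\<in>{1..12}. scale (f (e i)) (e i)) = 0"
      by simp
    from components_unique[OF in_h this] show "f X = 0"
      using X A_E_independent[of "f A" "f E"] by auto
  qed simp
  moreover have "card ?B = 14"
    using A_E_notin A_neq_E by (simp add: card_image[OF e_inj] del: One_nat_def)
  moreover have "span ?B = span L"
    using span_L by (metis Un_insert_right Un_empty_right span_span insert_commute)
  ultimately show ?thesis
    using dim_eq_card[of ?B L] by simp
qed

lemma dim_h: "dim h = 2"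
proof -
  have "independent {A, E}"
  proof (rule independent_if_scalars_zero)
    fix f X assume "(\<Sum>x\<in>{A, E}. scale (f x) x) = 0" "X \<in> {A, E}"
    then show "f X = 0" using A_neq_E A_E_independent[of "f A" "f E"] by auto
  qed simp
  then show ?thesis
    using A_neq_E by (simp add: dim_eq_card_independent)
qed

lemma ideal_generated_by_root_vector:
  assumes I: "lie_ideal I" and i: "i \<in> {1..12}" "e i \<in> I"
  shows "I = L"
proof -
  have sI: "subspace I" "I \<subseteq> L" using I by (auto simp: lie_ideal_def)
  have cancel: "X \<in> I" if "c \<noteq> 0" "scale c X \<in> I" for c X
    using subspace_scale_cancel[OF sI(1)] that by blast
  have nxt: "e (if j = 12 then 1 else Suc j) \<in> I" if "j \<in> {1..12}" "e j \<in> I" for j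
  proof -
    obtain X c where "X \<in> L" "c \<noteq> 0" "br X (e j) = scale c (e (if j = 12 then 1 else Suc j))"
      using br_next[OF \<open>j \<in> {1..12}\<close>] by blast
    moreover have "br X (e j) \<in> I" using I \<open>X \<in> L\<close> \<open>e j \<in> I\<close> by (auto simp: lie_ideal_def)
    ultimately show ?thesis using cancel by metis
  qed
  have up: "e j \<in> I" if "k \<le> j" "k \<in> {1..12}" "e k \<in> I" "j \<le> 12" for j k
    using that
  proof (induction rule: dec_induct)
    case (step n)
    then show ?case using nxt[of n] by auto
  qed
  \<comment> \<open>Up to 12, across to 1 and up again reaches all hours from any start.\<close>
  have "e 12 \<in> I" using up[of i 12] i by auto
  then have "e 1 \<in> I" using nxt[of 12] by simp
  then have all: "e j \<in> I" if "j \<in> {1..12}" for j using up[of 1 j] that by auto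
  have *: "br (e j) (e k) \<in> I" if "j \<in> {1..12}" "k \<in> {1..12}" for j k
    using I all that e_in by (auto simp: lie_ideal_def)
  \<comment> \<open>Opposite root vectors bring in the Cartan subalgebra.\<close>
  have "A \<in> I" using br_3_9 cancel *[of 3 9] by auto
  moreover have "E \<in> I" using br_6_12 cancel *[of 6 12] by auto
  ultimately have "L \<subseteq> I"
    unfolding span_L[symmetric] using sI(1) all by (intro span_minimal) auto
  then show ?thesis using sI(2) by blast
qed

lemma simple: simple_lie
proof -
  have "br A (e 3) \<noteq> 0"
    using br_A_e[of 3] e_nonzero[of 3] by simp
  moreover have "I = L" if I: "lie_ideal I" and "I \<noteq> {0}" for I
  proof -
    have sI: "subspace I" "I \<subseteq> L" "\<forall>X\<in>I. br H0 X \<in> I"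
      using I H0_in by (auto simp: lie_ideal_def)
    obtain X where X: "X \<in> I" "X \<noteq> 0"
      using \<open>I \<noteq> {0}\<close> subspace_0[OF sI(1)] by blast
    then obtain c H where cH: "H \<in> h" "X = H + (\<Sum>i\<in>{1..12}. scale (c i) (e i))"
      using L_cases sI(2) by blast
    note comp = components_in[OF sI cH(1), of c, folded cH(2), OF X(1)]
    show ?thesis
    proof (cases "\<exists>i\<in>{1..12}. c i \<noteq> 0")
      case True
      then show ?thesis using comp(2) ideal_generated_by_root_vector[OF I] by blast
    next
      case False
      then have "H \<noteq> 0" using X(2) cH(2) by simp
      obtain a b where ab: "H = scale a A + scale b E" using cH(1) by (rule h_cases)
      \<comment> \<open>A nonzero element of \<open>h\<close> is detected by hour 3 if
        \<open>a \<noteq> 0\<close>, and otherwise by hour 6.\<close>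
      obtain i :: nat where i: "i \<in> {1..12}" "a * of_int (clock_A i) + b * of_int (clock_E i) \<noteq> 0"
      proof (cases "a = 0")
        case True
        then show thesis using \<open>H \<noteq> 0\<close> ab that[of 6] by auto
      next
        case False
        then show thesis using that[of 3] by auto
      qed
      have "H \<in> I" using comp(1) .
      then have "br (e i) H \<in> I" using I e_in[OF i(1)] by (auto simp: lie_ideal_def)
      moreover have "br (e i) H = - br H (e i)"
        using br_anticommute[OF _ e_in[OF i(1)]] cH(1) h_subset by blast
      ultimately have "scale (a * of_int (clock_A i) + b * of_int (clock_E i)) (e i) \<in> I"
        using subspace_neg[OF sI(1)] ab br_h_e[OF i(1)] by (metis minus_minus)
      then have "e i \<in> I" using subspace_scale_cancel[OF sI(1) i(2)] by blast
      then show ?thesis using ideal_generated_by_root_vector[OF I i(1)] by blast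
    qed
  qed
  ultimately show ?thesis
    unfolding simple_lie_def using A_in e_in[of 3] by fastforce
qed

text \<open>The point is self-normalization. If \<open>X\<close> normalizes \<open>h\<close>, then
  \<open>br H0 X\<close> lies in \<open>h\<close>. No root vector lies in \<open>h\<close> and all
  roots are nonzero on \<open>H0\<close>, so the root components of \<open>X\<close> vanish.\<close>

lemma cartan: "cartan_subalgebra h"
proof -
  have "subalgebra h"
    unfolding subalgebra_def
    by (intro conjI ballI subspace_span h_subset) (simp only: br_h_h span_zero)
  moreover have "lower_central h 1 = {0}"
  proof -
    have "{br X Y | X Y. X \<in> h \<and> Y \<in> h} = {0}"
    proof (intro equalityI subsetI)
      fix Z assume "Z \<in> {br X Y | X Y. X \<in> h \<and> Y \<in> h}"
      then obtain X Y where "X \<in> h" "Y \<in> h" "Z = br X Y" by auto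
      then show "Z \<in> {0}" by (simp only: br_h_h singleton_iff)
    next
      fix Z :: 'v assume "Z \<in> {0}"
      then have "Z = br 0 0" by (simp only: br_h_h[OF span_zero span_zero] singleton_iff)
      then show "Z \<in> {br X Y | X Y. X \<in> h \<and> Y \<in> h}" using span_zero by (intro CollectI exI conjI)
    qed
    then show ?thesis by simp
  qed
  moreover have "X \<in> h" if X: "X \<in> L" "\<forall>H\<in>h. br X H \<in> h" for X
  proof -
    obtain c H where cH: "H \<in> h" "X = H + (\<Sum>i\<in>{1..12}. scale (c i) (e i))"
      using X(1) by (rule L_cases)
    let ?d = "\<lambda>i. of_int (clock_A i + 4 * clock_E i) :: 'k"
    have "br H0 X = br H0 H + (\<Sum>i\<in>{1..12}. scale (c i) (br H0 (e i)))"
      unfolding cH(2) by (rule br_L_cases[OF H0_in cH(1)])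
    also have "\<dots> = 0 + (\<Sum>i\<in>{1..12}. scale (c i * ?d i) (e i))"
      unfolding br_h_h[OF H0_in_h cH(1)]
      by (intro arg_cong2[where f="(+)"] sum.cong refl) (simp only: H0_e scale_scale)
    finally have eq: "br H0 X = 0 + (\<Sum>i\<in>{1..12}. scale (c i * ?d i) (e i))" .
    have "br H0 X = - br X H0" by (rule br_anticommute[OF X(1) H0_in])
    then have "br H0 X \<in> h" using X(2) H0_in_h span_neg by metis
    moreover have "\<forall>H\<in>h. br H0 H \<in> h"
      using br_h_h[OF H0_in_h] span_zero by simp
    ultimately have "c i * ?d i = 0" if "i \<in> {1..12}" for i
      using components_in(2)[OF subspace_span h_subset _ span_zero, of "\<lambda>i. c i * ?d i" i] eq
        e_notin_h[OF that] that by auto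
    then have "c i = 0" if "i \<in> {1..12}" for i
      using clock_nonzero[OF that] that by (metis mult_eq_0_iff of_int_eq_0_iff)
    then show ?thesis using cH by simp
  qed
  ultimately show ?thesis
    unfolding cartan_subalgebra_def by (intro conjI exI[of _ 1] ballI impI)
qed

lemma zero_dual: "(\<lambda>_. 0) \<in> dual_on h"
  by (simp add: dual_on_def)

text \<open>Since \<open>h\<close> is abelian, \<open>A\<close> and \<open>E\<close> lie in the root
  space of the zero functional, which \<open>dual_on\<close> admits.\<close>

lemma splitting: "splitting_cartan h"
proof -
  have "root_space h \<alpha> \<subseteq> L" for \<alpha> by (auto simp: root_space_def)
  then have "span (\<Union>\<alpha>\<in>dual_on h. root_space h \<alpha>) \<subseteq> L"
    using subspace_L by (intro span_minimal) auto
  moreover have "e i \<in> root_space h (root_fun i)" if "i \<in> {1..12}" for i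
    using that by (simp add: root_space_def e_in br_root_fun)
  then have "e ` {1..12} \<subseteq> (\<Union>\<alpha>\<in>dual_on h. root_space h \<alpha>)"
    using root_fun_dual by blast
  moreover have "{A, E} \<subseteq> root_space h (\<lambda>_. 0)"
    using A_in E_in span_base[of _ "{A, E}"] by (auto simp: root_space_def br_h_h)
  then have "{A, E} \<subseteq> (\<Union>\<alpha>\<in>dual_on h. root_space h \<alpha>)"
    using zero_dual by blast
  ultimately have "span (\<Union>\<alpha>\<in>dual_on h. root_space h \<alpha>) = L"
    using span_mono[of "e ` {1..12} \<union> {A, E}"] span_L by (metis Un_subset_iff subset_antisym)
  then show ?thesis using cartan by (simp add: splitting_cartan_def)
qed

text \<open>Components are compared in the eigenvector equation of \<open>X\<close>. The
  \<open>h\<close>-part dies because \<open>\<alpha>\<close> is nonzero somewhere, so some root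
  component is nonzero and forces \<open>\<alpha>\<close> to be its root. Off \<open>h\<close> both
  functionals are 0 by convention.\<close>

lemma roots_eq: "roots h = root_fun ` {1..12}"
proof (intro set_eqI iffI)
  fix \<alpha> assume "\<alpha> \<in> roots h"
  then obtain H1 where \<alpha>: "\<alpha> \<in> dual_on h" and H1: "H1 \<in> h" "\<alpha> H1 \<noteq> 0" and ne: "root_space h \<alpha> \<noteq> {0}"
    by (auto simp: roots_def)
  have "0 \<in> root_space h \<alpha>"
    using h_subset subspace_0[OF subspace_L] by (auto simp: root_space_def br_zero_right)
  then obtain X where X: "X \<in> root_space h \<alpha>" "X \<noteq> 0" using ne by blast
  then have "X \<in> L" by (simp add: root_space_def)
  then obtain c H where cH: "H \<in> h" "X = H + (\<Sum>i\<in>{1..12}. scale (c i) (e i))"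
    by (rule L_cases)
  have rel: "scale (- \<alpha> K) H = 0 \<and> (\<forall>i\<in>{1..12}. c i * (root_fun i K - \<alpha> K) = 0)" if K: "K \<in> h" for K
  proof -
    have KL: "K \<in> L" using K h_subset by blast
    have "br K X = br K H + (\<Sum>i\<in>{1..12}. scale (c i) (br K (e i)))"
      unfolding cH(2) by (rule br_L_cases[OF KL cH(1)])
    also have "\<dots> = 0 + (\<Sum>i\<in>{1..12}. scale (c i * root_fun i K) (e i))"
      unfolding br_h_h[OF K cH(1)]
      by (intro arg_cong2[where f="(+)"] sum.cong refl) (simp only: br_root_fun[OF _ K] scale_scale)
    finally have "(\<Sum>i\<in>{1..12}. scale (c i * root_fun i K) (e i)) = scale (\<alpha> K) X"
      using X(1) K by (auto simp: root_space_def)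
    then have "scale (- \<alpha> K) H + (\<Sum>i\<in>{1..12}. scale (c i * (root_fun i K - \<alpha> K)) (e i)) = 0"
      unfolding cH(2)
      by (simp add: scale_right_distrib scale_sum_right right_diff_distrib scale_left_diff_distrib
          sum_subtractf mult.commute)
    from components_unique[OF span_scale[OF cH(1)] this] show ?thesis by blast
  qed
  have "scale (- \<alpha> H1) H = 0" using rel[OF H1(1)] by (rule conjunct1)
  then have "H = 0" using H1(2) by (simp only: scale_eq_0_iff neg_equal_0_iff_equal simp_thms)
  have "\<exists>i\<in>{1..12}. c i \<noteq> 0"
  proof (rule ccontr)
    assume "\<not> ?thesis"
    then have "(\<Sum>i\<in>{1..12}. scale (c i) (e i)) = 0" by (intro sum.neutral) auto
    then show False using X(2) cH(2) \<open>H = 0\<close> by simp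
  qed
  then obtain i where i: "i \<in> {1..12}" "c i \<noteq> 0" by blast
  then have "root_fun i K = \<alpha> K" for K
    using rel[of K] \<alpha> by (cases "K \<in> h") (auto simp: root_fun_def dual_on_def)
  then have "\<alpha> = root_fun i" by (simp add: fun_eq_iff)
  then show "\<alpha> \<in> root_fun ` {1..12}" using i(1) by blast
next
  fix \<alpha> assume "\<alpha> \<in> root_fun ` {1..12}"
  then obtain i where i: "i \<in> {1..12}" "\<alpha> = root_fun i" by blast
  have "root_fun i H0 = of_int (clock_A i + 4 * clock_E i)"
    unfolding H0_def root_fun_eq[OF i(1)] by simp
  then have "root_fun i H0 \<noteq> 0"
    using clock_nonzero[OF i(1)] by (simp only: of_int_eq_0_iff not_False_eq_True)
  moreover have "e i \<in> root_space h (root_fun i)"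
    using i by (simp add: root_space_def e_in br_root_fun)
  ultimately show "\<alpha> \<in> roots h"
    using i H0_in_h root_fun_dual[OF i(1)] e_nonzero[OF i(1)] by (auto simp: roots_def)
qed

text \<open>Hours 3 and 10, at an angle of 150 degrees, serve as the short and the long simple root.
  Their weights are \<open>(2, 0)\<close> and \<open>(- 3, 1)\<close>.\<close>

lemma root_fun_combination:
  assumes "i \<in> {1..12}" "clock_A i = 2 * m - 3 * n" "clock_E i = n"
  shows "(\<lambda>H. of_int m * root_fun 3 H + of_int n * root_fun 10 H) = root_fun i"
proof
  fix H
  show "of_int m * root_fun 3 H + of_int n * root_fun 10 H = root_fun i H"
  proof (cases "H \<in> h")
    case True
    then obtain a b where "H = scale a A + scale b E" by (rule h_cases)
    then show ?thesis
      by (simp add: root_fun_eq assms(2,3) root_fun_eq[OF assms(1)] algebra_simps)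
  qed (simp add: root_fun_def)
qed

lemma roots_G2: "roots_type_G2 h"
proof -
  let ?comb = "\<lambda>(m, n) H. of_int m * root_fun 3 H + of_int n * root_fun 10 H"
  let ?P = "{(1, 0), (0, 1), (1, 1), (2, 1), (3, 1), (3, 2),
      (-1, 0), (0, -1), (-1, -1), (-2, -1), (-3, -1), (-3, -2)} :: (int \<times> int) set"
  have c: "?comb (m, n) = root_fun i" if "i \<in> {1..12}" "clock_A i = 2 * m - 3 * n" "clock_E i = n"
    for i m n
    using root_fun_combination[OF that] by simp
  have vals: "?comb (1, 0) = root_fun 3" "?comb (0, 1) = root_fun 10" "?comb (1, 1) = root_fun 11"
    "?comb (2, 1) = root_fun 1" "?comb (3, 1) = root_fun 2" "?comb (3, 2) = root_fun 12"
    "?comb (-1, 0) = root_fun 9" "?comb (0, -1) = root_fun 4" "?comb (-1, -1) = root_fun 5"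
    "?comb (-2, -1) = root_fun 7" "?comb (-3, -1) = root_fun 8" "?comb (-3, -2) = root_fun 6"
    by (rule c; simp)+
  have "?comb ` ?P = root_fun ` {1..12}"
    unfolding clock_set image_insert image_empty vals by blast
  moreover have "?comb ` ?P = {\<lambda>H. of_int m * root_fun 3 H + of_int n * root_fun 10 H | m n. (m, n) \<in> ?P}"
  proof (intro equalityI subsetI)
    fix F assume "F \<in> ?comb ` ?P"
    then obtain x where x: "x \<in> ?P" "F = ?comb x" by blast
    then have "(fst x, snd x) \<in> ?P" "F = ?comb (fst x, snd x)" by (simp_all only: prod.collapse)
    then show "F \<in> {\<lambda>H. of_int m * root_fun 3 H + of_int n * root_fun 10 H | m n. (m, n) \<in> ?P}"
      unfolding case_prod_conv by (intro CollectI exI conjI)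
  next
    fix F assume "F \<in> {\<lambda>H. of_int m * root_fun 3 H + of_int n * root_fun 10 H | m n. (m, n) \<in> ?P}"
    then obtain m n where mn: "(m, n) \<in> ?P" "F = ?comb (m, n)" by force
    show "F \<in> ?comb ` ?P" unfolding mn(2) by (rule imageI[OF mn(1)])
  qed
  ultimately have eq: "roots h =
      {\<lambda>H. of_int m * root_fun 3 H + of_int n * root_fun 10 H | m n. (m, n) \<in> ?P}"
    using roots_eq by simp
  have indep: "a = 0 \<and> b = 0" if z: "\<forall>H\<in>h. a * root_fun 3 H + b * root_fun 10 H = 0" for a b
  proof -
    have "a * root_fun 3 (scale s A + scale t E) + b * root_fun 10 (scale s A + scale t E) = 0" for s t
      using z in_h by blast
    then have "a * (s * 2 + t * 0) + b * (s * (- 3) + t * 1) = 0" for s t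
      by (simp add: root_fun_eq)
    from this[of 0 1] this[of 1 0] show ?thesis by simp
  qed
  show ?thesis
    unfolding roots_type_G2_def
  proof (rule conjI[OF dim_h], rule bexI[of _ "root_fun 3"], rule bexI[of _ "root_fun 10"], rule conjI)
    show "\<forall>a b. (\<forall>H\<in>h. a * root_fun 3 H + b * root_fun 10 H = 0) \<longrightarrow> a = 0 \<and> b = 0"
      using indep by blast
    show "root_fun 3 \<in> dual_on h" "root_fun 10 \<in> dual_on h"
      by (rule root_fun_dual; simp)+
  qed (rule eq)
qed

lemma split_simple: split_simple_G2
  unfolding split_simple_G2_def
proof (intro conjI)
  show "\<exists>B. finite B \<and> span B = L"
    by (rule exI[of _ "e ` {1..12} \<union> {A, E}"], rule conjI[OF _ span_L]) simp
  show "\<exists>h. splitting_cartan h \<and> roots_type_G2 h"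
    by (rule exI[of _ h]) (rule conjI[OF splitting roots_G2])
qed (rule simple)

end

section \<open>The parametrized solution of Noth's equation\<close>

text \<open>Each order is transported along the open set \<open>V\<close>: functions equal on
  \<open>V\<close> have the same derivative at its points, although they may differ
  elsewhere.\<close>

lemma iterated_deriv_eq:
  fixes F :: "nat \<Rightarrow> 'k::real_normed_field \<Rightarrow> 'k"
  assumes "open V" and F: "\<forall>n<k. \<forall>t\<in>V. (F n has_field_derivative F (Suc n) t) (at t)"
  shows "\<lbrakk>n \<le> k; t \<in> V\<rbrakk> \<Longrightarrow> (deriv ^^ n) (F 0) t = F n t"
    and "\<lbrakk>n < k; t \<in> V\<rbrakk> \<Longrightarrow> ((deriv ^^ n) (F 0) has_field_derivative F (Suc n) t) (at t)"
proof -
  have step: "((deriv ^^ n) (F 0) has_field_derivative F (Suc n) t) (at t)"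
    if "n < k" "t \<in> V" "\<And>t. t \<in> V \<Longrightarrow> (deriv ^^ n) (F 0) t = F n t" for n t
    using F[rule_format, OF that(1,2)]
    by (rule has_field_derivative_transform_within_open[OF _ \<open>open V\<close> that(2)]) (simp add: that(3))
  have eq: "(deriv ^^ n) (F 0) t = F n t" if "n \<le> k" "t \<in> V" for n t
    using that
  proof (induction n arbitrary: t)
    case (Suc n)
    have "((deriv ^^ n) (F 0) has_field_derivative F (Suc n) t) (at t)"
      by (rule step) (use Suc in auto)
    then show ?case by (simp add: DERIV_imp_deriv)
  qed simp
  show "\<lbrakk>n \<le> k; t \<in> V\<rbrakk> \<Longrightarrow> (deriv ^^ n) (F 0) t = F n t" by (rule eq)
  show "\<lbrakk>n < k; t \<in> V\<rbrakk> \<Longrightarrow> ((deriv ^^ n) (F 0) has_field_derivative F (Suc n) t) (at t)"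
    by (rule step) (auto intro: eq)
qed

text \<open>The inverse function theorem for real Euclidean spaces, with multiplication by
  \<open>d s\<close> as the bounded linear derivative. The continuous inverse is then differentiable
  over \<open>'k\<close> because \<open>d\<close> does not vanish.\<close>

lemma inverse_function_field:
  fixes f :: "'k::{real_normed_field, euclidean_space} \<Rightarrow> 'k"
  assumes "open D" and f: "\<And>s. s \<in> D \<Longrightarrow> (f has_field_derivative d s) (at s)"
    and d: "continuous_on D d" "\<And>s. s \<in> D \<Longrightarrow> d s \<noteq> 0" and s0: "s0 \<in> D"
  obtains S V g where "open S" "S \<subseteq> D" "s0 \<in> S" "open V" "f ` S = V" "inj_on f S"
    "\<And>s. s \<in> S \<Longrightarrow> g (f s) = s" "\<And>t. t \<in> V \<Longrightarrow> g t \<in> S"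
    "\<And>t. t \<in> V \<Longrightarrow> (g has_field_derivative inverse (d (g t))) (at t)"
proof -
  let ?f' = "\<lambda>s. blinfun_mult_right (d s)"
  have "continuous_on D ?f'"
    by (intro bounded_linear.continuous_on[OF bounded_linear_blinfun_mult_right] d(1))
  moreover have "(f has_derivative blinfun_apply (?f' s)) (at s)" if "s \<in> D" for s
    using f[OF that] by (simp add: has_field_derivative_def)
  moreover have "blinfun_mult_right (inverse (d s0)) o\<^sub>L ?f' s0 = id_blinfun"
    using d(2)[OF s0] by (intro blinfun_eqI) (simp add: mult.assoc[symmetric])
  ultimately obtain S V g where *: "open S" "S \<subseteq> D" "s0 \<in> S" "open V" "homeomorphism S V f g"
    using inverse_function_theorem[OF \<open>open D\<close> _ _ s0] by metis
  have "(g has_field_derivative inverse (d (g t))) (at t)" if t: "t \<in> V" for t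
  proof (rule has_field_derivative_inverse_basic[OF f _ _ \<open>open V\<close> t])
    have gt: "g t \<in> D" using * t by (auto simp: homeomorphism_def)
    show "g t \<in> D" "d (g t) \<noteq> 0" using gt d(2) by auto
    show "continuous (at t) g"
      using *(4,5) t by (auto simp: homeomorphism_def continuous_on_eq_continuous_at)
  qed (use * in \<open>auto simp: homeomorphism_def\<close>)
  moreover have "inj_on f S"
    using *(5) by (auto simp: homeomorphism_def intro!: inj_on_inverseI[of S g])
  moreover have "f ` S = V" "\<And>s. s \<in> S \<Longrightarrow> g (f s) = s" "\<And>t. t \<in> V \<Longrightarrow> g t \<in> S"
    using *(5) by (auto simp: homeomorphism_def)
  ultimately show thesis
    using that[of S V g] *(1-4) by blast
qed

text \<open>A continuous branch is a continuous local inverse of the cube, whose derivative does not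
  vanish at \<open>r s\<close>.\<close>

lemma cube_root_branch_deriv:
  fixes r :: "'k::real_normed_field \<Rightarrow> 'k"
  assumes "cube_root_branch D r" "s \<in> D"
  shows "(r has_field_derivative inverse (3 * r s ^ 2)) (at s)" and "r s \<noteq> 0"
proof -
  have r: "open D" "continuous_on D r" "\<And>s. s \<in> D \<Longrightarrow> r s ^ 3 = s" "s \<noteq> 0"
    using assms by (auto simp: cube_root_branch_def)
  show nz: "r s \<noteq> 0" using r(3)[OF assms(2)] r(4) by auto
  show "(r has_field_derivative inverse (3 * r s ^ 2)) (at s)"
  proof (rule has_field_derivative_inverse_basic[where f="\<lambda>x. x ^ 3", OF _ _ _ r(1) assms(2)])
    show "((\<lambda>x. x ^ 3) has_field_derivative 3 * r s ^ 2) (at (r s))"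
      by (auto intro!: derivative_eq_intros)
    show "continuous (at s) r"
      using r(1,2) assms(2) by (simp add: continuous_on_eq_continuous_at)
  qed (use nz r(3) in auto)
qed

text \<open>This vanishes only at \<open>s = 1\<close>, a value that \<open>cube_root_branch\<close>
  excludes, so \<open>t\<close> is a local parameter of the curve.\<close>

lemma param_t_deriv:
  fixes r :: "'k::real_normed_field \<Rightarrow> 'k"
  assumes r: "cube_root_branch D r" and s: "s \<in> D"
  shows "(param_t r has_field_derivative 4 * (1 - s) / (3 * r s * (1 + 2 * s) ^ 2)) (at s)"
proof -
  have "1 + 2 * s \<noteq> 0" and cube: "r s ^ 3 = s"
    using assms by (auto simp: cube_root_branch_def)
  note nz = this(1) cube_root_branch_deriv(2)[OF assms]
  let ?i = "inverse (3 * r s ^ 2)"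
  have i: "r s * ?i = 1 / (3 * r s)"
    using nz by (simp add: field_simps power2_eq_square)
  have "((\<lambda>s. 2 * r s ^ 2 / (1 + 2 * s)) has_field_derivative
      ((4 * (r s * ?i)) * (1 + 2 * s) - 2 * r s ^ 2 * 2) / ((1 + 2 * s) * (1 + 2 * s))) (at s)"
    using nz by (auto intro!: derivative_eq_intros cube_root_branch_deriv(1)[OF assms])
  also have "((4 * (r s * ?i)) * (1 + 2 * s) - 2 * r s ^ 2 * 2) / ((1 + 2 * s) * (1 + 2 * s)) =
      (4 * (1 + 2 * s) - 12 * r s ^ 3) / (3 * r s * (1 + 2 * s) ^ 2)"
    unfolding i using nz by (simp add: divide_simps) (simp add: algebra_simps power2_eq_square power3_eq_cube)
  finally show ?thesis
    by (simp add: param_t_def[abs_def] cube algebra_simps)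
qed

text \<open>With $u=s^{1/3}$ the $n$-th derivative of $H$ by $t$ is a rational function of $u$; from $n=2$ on it is
  $N_n(u)\,(1+2u^3)^{n+2}/(u(1-u^3))^{2n-1}$ with a polynomial $N_n$, computed by the following rule.\<close>

lemma rational_step:
  fixes u :: "'k::real_normed_field"
  assumes N: "(N has_field_derivative N') (at u)" and nz: "u \<noteq> 0" "1 - u ^ 3 \<noteq> 0" "1 + 2 * u ^ 3 \<noteq> 0"
    and \<rho>: "(\<rho> has_field_derivative (1 + 2 * u ^ 3) ^ 2 / (4 * u * (1 - u ^ 3))) (at t)" "\<rho> t = u"
    and M: "4 * M = (N' * u - of_nat (Suc a) * N u) * (1 + 2 * u ^ 3) * (1 - u ^ 3)
      + 6 * of_nat (Suc b) * u ^ 3 * (1 - u ^ 3) * N u + 3 * of_nat (Suc a) * u ^ 3 * (1 + 2 * u ^ 3) * N u"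
  shows "((\<lambda>t. N (\<rho> t) * (1 + 2 * \<rho> t ^ 3) ^ Suc b / (\<rho> t * (1 - \<rho> t ^ 3)) ^ Suc a) has_field_derivative
      M * (1 + 2 * u ^ 3) ^ Suc (Suc b) / (u * (1 - u ^ 3)) ^ (Suc a + 2)) (at t)"
proof -
  define w where "w = 1 + 2 * u ^ 3"
  define v where "v = 1 - u ^ 3"
  let ?Q = "\<lambda>u. N u * (1 + 2 * u ^ 3) ^ Suc b / (u * (1 - u ^ 3)) ^ Suc a"
  let ?d = "(N' * w ^ Suc b + N u * (of_nat (Suc b) * w ^ b * (6 * u ^ 2))) * (u * v) ^ Suc a
      - N u * w ^ Suc b * (of_nat (Suc a) * (u * v) ^ a * (v - 3 * u ^ 3))"
  have "(?Q has_field_derivative ?d / ((u * v) ^ Suc a * (u * v) ^ Suc a)) (at u)"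
  proof (rule DERIV_cong[OF DERIV_divide])
    have "((\<lambda>u. 1 + 2 * u ^ 3) has_field_derivative 6 * u ^ 2) (at u)"
      by (auto intro!: derivative_eq_intros)
    from DERIV_mult[OF N DERIV_power_Suc[OF this, of b]]
    show "((\<lambda>u. N u * (1 + 2 * u ^ 3) ^ Suc b) has_field_derivative
        N' * w ^ Suc b + N u * (of_nat (Suc b) * w ^ b * (6 * u ^ 2))) (at u)"
      by (rule DERIV_cong) (simp add: w_def algebra_simps)
    have "((\<lambda>u. u * (1 - u ^ 3)) has_field_derivative (v - 3 * u ^ 3)) (at u)"
      by (auto intro!: derivative_eq_intros simp: v_def algebra_simps power2_eq_square power3_eq_cube)
    from DERIV_power_Suc[OF this, of a]
    show "((\<lambda>u. (u * (1 - u ^ 3)) ^ Suc a) has_field_derivative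
        of_nat (Suc a) * (u * v) ^ a * (v - 3 * u ^ 3)) (at u)"
      by (rule DERIV_cong) (simp add: v_def algebra_simps)
  qed (use nz in simp, simp_all add: w_def v_def)
  from DERIV_chain2[OF this[folded \<rho>(2)] \<rho>(1)[folded \<rho>(2)]]
  have D: "((\<lambda>t. ?Q (\<rho> t)) has_field_derivative
      ?d / ((u * v) ^ Suc a * (u * v) ^ Suc a) * (w ^ 2 / (4 * u * v))) (at t)"
    by (simp add: \<rho>(2) w_def v_def)
  \<comment> \<open>With the common factor \<open>w ^ b * (u * v) ^ a\<close> taken out, the
    numerator is the right hand side of the rule for \<open>M\<close>. The 4 is that of
    \<open>4 * u * v\<close> in the derivative of \<open>\<rho>\<close>.\<close>
  have d: "?d = w ^ b * (u * v) ^ a * (4 * M)"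
    unfolding M w_def[symmetric] v_def[symmetric]
    by (simp add: algebra_simps power2_eq_square power3_eq_cube)
  have "w ^ b * p ^ a * (4 * M) / (p ^ Suc a * p ^ Suc a) * (w ^ 2 / (4 * p)) =
      M * w ^ Suc (Suc b) / p ^ (Suc a + 2)" if "p \<noteq> 0" for p
    using that by (simp add: divide_simps) (simp add: algebra_simps power2_eq_square)
  from this[of "u * v"] have "?d / ((u * v) ^ Suc a * (u * v) ^ Suc a) * (w ^ 2 / (4 * u * v)) =
      M * w ^ Suc (Suc b) / (u * v) ^ (Suc a + 2)"
    unfolding d using nz by (simp only: w_def v_def mult_eq_0_iff mult.assoc simp_thms)
  from DERIV_cong[OF D this] show ?thesis
    unfolding w_def v_def .
qed

text \<open>Entry \<open>n\<close> belongs to the derivative of order \<open>n + 2\<close>, as a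
  polynomial in \<open>s = u^3\<close>. The first is the \<open>1/4\<close> of the second
  derivative; the others come out of the recursion in \<open>noth_numerator_rec\<close>.\<close>

definition noth_numerator :: "nat \<Rightarrow> 'k::real_normed_field \<Rightarrow> 'k" where
  "noth_numerator n s =
     [1/4, - 3/16 + 15/8 * s, 15/64 - 45/16 * s + 315/16 * s ^ 2 + 15/8 * s ^ 3,
      - 105/256 + 735/128 * s - 2625/64 * s ^ 2 + 8535/32 * s ^ 3 + 2145/32 * s ^ 4 + 15/16 * s ^ 5,
      945/1024 - 945/64 * s + 945/8 * s ^ 2 - 82215/128 * s ^ 3 + 571725/128 * s ^ 4
        + 16065/8 * s ^ 5 + 945/8 * s ^ 6] ! n"

definition noth_numerator' :: "nat \<Rightarrow> 'k::real_normed_field \<Rightarrow> 'k" where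
  "noth_numerator' n s =
     [0, 15/8, - 45/16 + 315/8 * s + 45/8 * s ^ 2,
      735/128 - 2625/32 * s + 25605/32 * s ^ 2 + 2145/8 * s ^ 3 + 75/16 * s ^ 4] ! n"

lemma noth_numerator_deriv:
  assumes "n < 4"
  shows "(noth_numerator n has_field_derivative noth_numerator' n s) (at s)"
proof -
  consider "n = 0" | "n = 1" | "n = 2" | "n = 3" using assms by linarith
  then show ?thesis
    by cases (auto simp: noth_numerator_def[abs_def] noth_numerator'_def numeral_eq_Suc
        intro!: derivative_eq_intros)
qed

text \<open>The rule for \<open>M\<close> in \<open>rational_step\<close>, in the variable
  \<open>s\<close>: for \<open>s = u^3\<close> the operator \<open>u d/du\<close> becomes
  \<open>3 s d/ds\<close>.\<close>

lemma noth_numerator_rec: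
  assumes "n < 4"
  shows "4 * noth_numerator (Suc n) s =
    (3 * s * noth_numerator' n s - of_nat (Suc (2 * n + 2)) * noth_numerator n s) * (1 + 2 * s) * (1 - s)
    + 6 * of_nat (Suc (n + 3)) * s * (1 - s) * noth_numerator n s
    + 3 * of_nat (Suc (2 * n + 2)) * s * (1 + 2 * s) * noth_numerator n s"
proof -
  consider "n = 0" | "n = 1" | "n = 2" | "n = 3" using assms by linarith
  then show ?thesis
    by cases (simp_all add: noth_numerator_def noth_numerator'_def nth_Cons' field_simps eval_nat_numeral)
qed

text \<open>\<open>H\<close> and its first derivative are listed apart because the pattern of powers
  starts at order 2.\<close>

definition noth_deriv :: "nat \<Rightarrow> 'k::real_normed_field \<Rightarrow> 'k" where
  "noth_deriv n u =
     (if n = 0 then - (4 * u / (1 + 2 * u ^ 3))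
      else if n = 1 then (4 * u ^ 3 - 1) / (u * (1 - u ^ 3))
      else noth_numerator (n - 2) (u ^ 3) * (1 + 2 * u ^ 3) ^ (n + 2) / (u * (1 - u ^ 3)) ^ (2 * n - 1))"

lemma noth_deriv_ge2:
  "noth_deriv (n + 2) u =
    noth_numerator n (u ^ 3) * (1 + 2 * u ^ 3) ^ Suc (n + 3) / (u * (1 - u ^ 3)) ^ Suc (2 * n + 2)"
  by (simp add: noth_deriv_def eval_nat_numeral)

lemma noth_deriv_step:
  fixes u :: "'k::real_normed_field"
  assumes nz: "u \<noteq> 0" "1 - u ^ 3 \<noteq> 0" "1 + 2 * u ^ 3 \<noteq> 0"
    and \<rho>: "(\<rho> has_field_derivative (1 + 2 * u ^ 3) ^ 2 / (4 * u * (1 - u ^ 3))) (at t)" "\<rho> t = u"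
    and n: "n < 6"
  shows "((\<lambda>t. noth_deriv n (\<rho> t)) has_field_derivative noth_deriv (Suc n) u) (at t)"
proof -
  let ?w = "1 + 2 * u ^ 3" and ?v = "1 - u ^ 3"
  have chain: "((\<lambda>t. F (\<rho> t)) has_field_derivative F' * (?w ^ 2 / (4 * u * ?v))) (at t)"
    if "(F has_field_derivative F') (at u)" for F F'
    by (rule DERIV_chain2[OF that[folded \<rho>(2)] \<rho>(1)])
  consider "n = 0" | "n = 1" | m where "n = m + 2" "m < 4"
    using n by (cases n; cases "n - 1") auto
  then show ?thesis
  proof cases
    case 1
    have "((\<lambda>u. - (4 * u / (1 + 2 * u ^ 3))) has_field_derivative
        - ((4 * ?w - 4 * u * (6 * u ^ 2)) / (?w * ?w))) (at u)"
      using nz by (auto intro!: derivative_eq_intros)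
    from DERIV_cong[OF chain[OF this], of "(4 * u ^ 3 - 1) / (u * ?v)"] show ?thesis
      using nz 1 by (simp add: noth_deriv_def[abs_def] divide_simps)
        (simp add: algebra_simps power2_eq_square power3_eq_cube)
  next
    case 2
    have "((\<lambda>u. (4 * u ^ 3 - 1) / (u * (1 - u ^ 3))) has_field_derivative
        (12 * u ^ 2 * (u * ?v) - (4 * u ^ 3 - 1) * (1 - 4 * u ^ 3)) / ((u * ?v) * (u * ?v))) (at u)"
      using nz by (auto intro!: derivative_eq_intros simp: power2_eq_square power3_eq_cube algebra_simps)
    from DERIV_cong[OF chain[OF this], of "1/4 * ?w ^ 4 / (u * ?v) ^ 3"] show ?thesis
      using nz 2 by (simp add: noth_deriv_def[abs_def] noth_numerator_def divide_simps)
        (simp add: algebra_simps eval_nat_numeral)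
  next
    case 3
    have N: "((\<lambda>u. noth_numerator m (u ^ 3)) has_field_derivative
        noth_numerator' m (u ^ 3) * (3 * u ^ 2)) (at u)"
      by (rule DERIV_chain2[OF noth_numerator_deriv[OF 3(2)]]) (auto intro!: derivative_eq_intros)
    have "4 * noth_numerator (Suc m) (u ^ 3) =
        (noth_numerator' m (u ^ 3) * (3 * u ^ 2) * u - of_nat (Suc (2 * m + 2)) * noth_numerator m (u ^ 3)) * ?w * ?v
      + 6 * of_nat (Suc (m + 3)) * u ^ 3 * ?v * noth_numerator m (u ^ 3)
      + 3 * of_nat (Suc (2 * m + 2)) * u ^ 3 * ?w * noth_numerator m (u ^ 3)"
      unfolding noth_numerator_rec[OF 3(2)] by (simp add: power2_eq_square power3_eq_cube mult_ac)
    note step = rational_step[OF N nz \<rho> this]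
    have "noth_deriv (Suc n) u =
        noth_numerator (Suc m) (u ^ 3) * ?w ^ Suc (Suc (m + 3)) / (u * ?v) ^ (Suc (2 * m + 2) + 2)"
      using noth_deriv_ge2[of "Suc m" u] by (simp add: 3(1))
    then show ?thesis
      using step by (simp only: 3(1) noth_deriv_ge2)
  qed
qed

text \<open>Noth's equation is homogeneous: every term has four factors whose orders, each lowered
  by 2, add up to 4. Writing the derivative of order \<open>n + 2\<close> as a numerator times
  \<open>c * k ^ n\<close> therefore takes out \<open>c ^ 4 * k ^ 4\<close> and leaves a polynomial
  identity in \<open>s\<close>.\<close>

lemma noth_equation:
  "10 * noth_deriv 2 u ^ 3 * noth_deriv 6 u - 70 * noth_deriv 2 u ^ 2 * noth_deriv 3 u * noth_deriv 5 u
    - 49 * noth_deriv 2 u ^ 2 * noth_deriv 4 u ^ 2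
    + 280 * noth_deriv 2 u * noth_deriv 3 u ^ 2 * noth_deriv 4 u - 175 * noth_deriv 3 u ^ 4 = 0"
proof -
  define w where "w = 1 + 2 * u ^ 3"
  define p where "p = u * (1 - u ^ 3)"
  define k where "k = w / p ^ 2"
  define c where "c = w ^ 4 / p ^ 3"
  have gen: "noth_deriv m u = noth_numerator n (u ^ 3) * c * k ^ n" if "m = n + 2" for m n
    unfolding that noth_deriv_ge2 w_def[symmetric] p_def[symmetric]
    by (simp add: c_def k_def power_divide power_add power_mult_distrib eval_nat_numeral mult_ac)
  have d: "noth_deriv 2 u = noth_numerator 0 (u ^ 3) * c * k ^ 0" "noth_deriv 3 u = noth_numerator 1 (u ^ 3) * c * k ^ 1"
    "noth_deriv 4 u = noth_numerator 2 (u ^ 3) * c * k ^ 2" "noth_deriv 5 u = noth_numerator 3 (u ^ 3) * c * k ^ 3"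
    "noth_deriv 6 u = noth_numerator 4 (u ^ 3) * c * k ^ 4"
    by (rule gen; simp)+
  define s where "s = u ^ 3"
  define n where "n = (\<lambda>i. noth_numerator i s)"
  have "10 * n 0 ^ 3 * n 4 - 70 * n 0 ^ 2 * n 1 * n 3 - 49 * n 0 ^ 2 * n 2 ^ 2
      + 280 * n 0 * n 1 ^ 2 * n 2 - 175 * n 1 ^ 4 = 0"
    by (simp add: n_def noth_numerator_def nth_Cons' field_simps eval_nat_numeral)
  moreover have "10 * (n 0 * c) ^ 3 * (n 4 * c * k ^ 4) - 70 * (n 0 * c) ^ 2 * (n 1 * c * k) * (n 3 * c * k ^ 3)
      - 49 * (n 0 * c) ^ 2 * (n 2 * c * k ^ 2) ^ 2 + 280 * (n 0 * c) * (n 1 * c * k) ^ 2 * (n 2 * c * k ^ 2)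
      - 175 * (n 1 * c * k) ^ 4 =
      c ^ 4 * k ^ 4 * (10 * n 0 ^ 3 * n 4 - 70 * n 0 ^ 2 * n 1 * n 3 - 49 * n 0 ^ 2 * n 2 ^ 2
      + 280 * n 0 * n 1 ^ 2 * n 2 - 175 * n 1 ^ 4)"
    by (simp add: algebra_simps eval_nat_numeral)
  ultimately show ?thesis
    unfolding d s_def[symmetric] n_def power_0 power_one_right mult_1_right by simp
qed

lemma param_solves_noth:
  fixes r :: "'k::{real_normed_field, euclidean_space} \<Rightarrow> 'k"
  assumes r: "cube_root_branch D r" and s0: "s0 \<in> D"
  shows "\<exists>S h J. open S \<and> s0 \<in> S \<and> S \<subseteq> D \<and> inj_on (param_t r) S \<and>
    noth_solution h (param_t r ` S) \<and>
    (\<forall>t \<in> param_t r ` S. (J has_field_derivative h t) (at t)) \<and>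
    (\<forall>s\<in>S. h (param_t r s) = param_H r s \<and>
       noth_omega2 h J (param_t r s) = param_omega2 r s \<and>
       noth_omega3 h (param_t r s) = param_omega3 r s \<and>
       noth_omega4 (param_t r s) = param_omega4 r s)"
proof -
  let ?d = "\<lambda>s. 4 * (1 - s) / (3 * r s * (1 + 2 * s) ^ 2)"
  have D: "open D" "continuous_on D r" and rD: "\<And>s. s \<in> D \<Longrightarrow> r s ^ 3 = s"
    "\<And>s. s \<in> D \<Longrightarrow> s \<noteq> 1" "\<And>s. s \<in> D \<Longrightarrow> 1 + 2 * s \<noteq> 0" "\<And>s. s \<in> D \<Longrightarrow> r s \<noteq> 0"
    using r cube_root_branch_deriv(2)[OF r] by (auto simp: cube_root_branch_def)
  obtain S V g where S: "open S" "S \<subseteq> D" "s0 \<in> S" "open V" "param_t r ` S = V" "inj_on (param_t r) S"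
    "\<And>s. s \<in> S \<Longrightarrow> g (param_t r s) = s" "\<And>t. t \<in> V \<Longrightarrow> g t \<in> S"
    "\<And>t. t \<in> V \<Longrightarrow> (g has_field_derivative inverse (?d (g t))) (at t)"
  proof (rule inverse_function_field[OF D(1) _ _ _ s0])
    show "(param_t r has_field_derivative ?d s) (at s)" if "s \<in> D" for s
      using param_t_deriv[OF r that] .
    show "continuous_on D ?d"
      using rD by (intro continuous_intros D(2)) auto
    show "?d s \<noteq> 0" if "s \<in> D" for s
      using rD[OF that] by auto
  qed blast
  \<comment> \<open>The rational parameter \<open>u\<close> as a function of
    \<open>t\<close>.\<close>
  define \<rho> where "\<rho> = (\<lambda>t. r (g t))"
  have nz: "\<rho> t \<noteq> 0" "1 - \<rho> t ^ 3 \<noteq> 0" "1 + 2 * \<rho> t ^ 3 \<noteq> 0" if "t \<in> V" for t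
    using rD[of "g t"] S(2) S(8)[OF that] by (auto simp: \<rho>_def)
  have \<rho>: "(\<rho> has_field_derivative (1 + 2 * \<rho> t ^ 3) ^ 2 / (4 * \<rho> t * (1 - \<rho> t ^ 3))) (at t)"
    if t: "t \<in> V" for t
  proof -
    have gt: "g t \<in> D" using S t by blast
    have "(\<rho> has_field_derivative inverse (3 * r (g t) ^ 2) * inverse (?d (g t))) (at t)"
      unfolding \<rho>_def by (rule DERIV_chain2[OF cube_root_branch_deriv(1)[OF r gt] S(9)[OF t]])
    moreover have "inverse (3 * r (g t) ^ 2) * inverse (?d (g t)) =
        (1 + 2 * \<rho> t ^ 3) ^ 2 / (4 * \<rho> t * (1 - \<rho> t ^ 3))"
      using rD[OF gt] nz[OF t] by (simp add: \<rho>_def divide_simps power2_eq_square)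
    ultimately show ?thesis by simp
  qed
  define h where "h = (\<lambda>t. noth_deriv 0 (\<rho> t))"
  \<comment> \<open>An antiderivative of \<open>h\<close>, with the constant of integration for
    which the \<open>dx\<close> coefficient of \<open>noth_omega2\<close> becomes
    \<open>- 4 / (3 * (s - 1))\<close>.\<close>
  define J where "J = (\<lambda>t. 2 * (1 - 4 * \<rho> t ^ 3) / (3 * (1 + 2 * \<rho> t ^ 3) ^ 2))"
  have step: "\<forall>n<6. \<forall>t\<in>V. ((\<lambda>t. noth_deriv n (\<rho> t)) has_field_derivative noth_deriv (Suc n) (\<rho> t)) (at t)"
    by (intro allI impI ballI noth_deriv_step[OF nz \<rho> refl])
  note it = iterated_deriv_eq[of V 6 "\<lambda>n t. noth_deriv n (\<rho> t)", OF S(4) step, folded h_def]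
  have sol: "noth_solution h V"
    unfolding noth_solution_def Let_def
  proof (intro conjI allI ballI impI S(4))
    show "(deriv ^^ n) h field_differentiable at t" if "n < 6" "t \<in> V" for n t
      using it(2)[OF that] unfolding field_differentiable_def by blast
    fix t assume "t \<in> V"
    then show "10 * (deriv ^^ 2) h t ^ 3 * (deriv ^^ 6) h t
        - 70 * (deriv ^^ 2) h t ^ 2 * (deriv ^^ 3) h t * (deriv ^^ 5) h t
        - 49 * (deriv ^^ 2) h t ^ 2 * (deriv ^^ 4) h t ^ 2
        + 280 * (deriv ^^ 2) h t * (deriv ^^ 3) h t ^ 2 * (deriv ^^ 4) h t - 175 * (deriv ^^ 3) h t ^ 4 = 0"
      using noth_equation[of "\<rho> t"] it(1)[of 2 t] it(1)[of 3 t] it(1)[of 4 t] it(1)[of 5 t] it(1)[of 6 t]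
      by (simp only: le_numeral_extra numeral_le_iff semiring_norm simp_thms)
  qed
  have J_deriv: "(J has_field_derivative h t) (at t)" if t: "t \<in> V" for t
  proof -
    define u where "u = \<rho> t"
    let ?w = "1 + 2 * u ^ 3"
    note n = nz[OF t, folded u_def]
    have num: "(- (24 * u ^ 2)) * (3 * ?w ^ 2) - 2 * (1 - 4 * u ^ 3) * (3 * (2 * ?w * (6 * u ^ 2))) =
        - (144 * u ^ 2 * ?w * (1 - u ^ 3))"
      by (simp add: algebra_simps power2_eq_square power3_eq_cube)
    have "((\<lambda>u. 2 * (1 - 4 * u ^ 3) / (3 * (1 + 2 * u ^ 3) ^ 2)) has_field_derivative
        ((- (24 * u ^ 2)) * (3 * ?w ^ 2) - 2 * (1 - 4 * u ^ 3) * (3 * (2 * ?w * (6 * u ^ 2))))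
        / ((3 * ?w ^ 2) * (3 * ?w ^ 2))) (at u)"
      using n by (auto intro!: derivative_eq_intros)
    from DERIV_chain2[OF this[unfolded num, unfolded u_def] \<rho>[OF t]]
    have "(J has_field_derivative - (144 * u ^ 2 * ?w * (1 - u ^ 3)) / ((3 * ?w ^ 2) * (3 * ?w ^ 2))
        * (?w ^ 2 / (4 * u * (1 - u ^ 3)))) (at t)"
      unfolding J_def u_def .
    moreover have "- (144 * x ^ 2 * w * v) / ((3 * w ^ 2) * (3 * w ^ 2)) * (w ^ 2 / (4 * x * v)) = - (4 * x / w)"
      if "x \<noteq> 0" "w \<noteq> 0" "v \<noteq> 0" for x w v :: 'k
      using that by (simp add: divide_simps power2_eq_square)
    note this[OF n(1) n(3) n(2)]
    ultimately show ?thesis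
      by (simp only: h_def noth_deriv_def u_def simp_thms if_True)
  qed
  have vals: "h (param_t r s) = param_H r s \<and>
       noth_omega2 h J (param_t r s) = param_omega2 r s \<and>
       noth_omega3 h (param_t r s) = param_omega3 r s \<and>
       noth_omega4 (param_t r s) = param_omega4 r s" if s: "s \<in> S" for s
  proof -
    let ?t = "param_t r s"
    define u where "u = r s"
    have sD: "s \<in> D" using s S(2) by blast
    have t: "?t \<in> V" "\<rho> ?t = u" using s S by (auto simp: \<rho>_def u_def)
    have su: "s = u ^ 3" using rD(1)[OF sD] by (simp add: u_def)
    have n: "u \<noteq> 0" "1 - u ^ 3 \<noteq> 0" "1 + 2 * u ^ 3 \<noteq> 0" "u ^ 3 - 1 \<noteq> 0" "2 * u ^ 3 + 1 \<noteq> 0"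
      using nz[OF t(1)] by (auto simp: t(2) add.commute)
    have ht: "h ?t = - (4 * u / (1 + 2 * u ^ 3))" by (simp add: h_def t noth_deriv_def)
    have ht': "deriv h ?t = (4 * u ^ 3 - 1) / (u * (1 - u ^ 3))"
      using it(1)[of 1 ?t] t by (simp add: noth_deriv_def)
    have Jt: "J ?t = 2 * (1 - 4 * u ^ 3) / (3 * (1 + 2 * u ^ 3) ^ 2)" by (simp add: J_def t)
    have tt: "?t = 2 * u ^ 2 / (1 + 2 * u ^ 3)" by (simp only: param_t_def u_def[symmetric] su[symmetric])
    have 1: "h ?t - ?t * deriv h ?t = 2 * u / (u ^ 3 - 1)"
      unfolding ht ht' unfolding tt using n by (simp add: divide_simps) (simp add: algebra_simps eval_nat_numeral)
    have 2: "?t ^ 2 * deriv h ?t - 2 * ?t * h ?t + 2 * J ?t = - (4 / (3 * (u ^ 3 - 1)))"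
      unfolding ht ht' Jt unfolding tt using n by (simp add: divide_simps) (simp add: algebra_simps eval_nat_numeral)
    have 3: "deriv h ?t = (1 - 4 * u ^ 3) / (u * (u ^ 3 - 1))"
      unfolding ht' using n by (simp add: divide_simps) (simp add: algebra_simps)
    have rs: "r s = u" by (simp add: u_def)
    show ?thesis
    proof (intro conjI ext)
      show "h ?t = param_H r s" unfolding ht param_H_def rs su[symmetric] ..
      show "noth_omega2 h J ?t v I = param_omega2 r s v I" for v I
        unfolding noth_omega2_def param_omega2_def 1 2 rs su[symmetric] by simp
      show "noth_omega3 h ?t v I = param_omega3 r s v I" for v I
        unfolding noth_omega3_def param_omega3_def 1 unfolding 3 rs su[symmetric] by simp
      show "noth_omega4 ?t v I = param_omega4 r s v I" for v I
        unfolding noth_omega4_def param_omega4_def unfolding tt rs su[symmetric] by (simp add: add.commute)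
    qed
  qed
  show ?thesis
  proof (intro exI conjI)
    show "noth_solution h (param_t r ` S)" using sol S(5) by simp
    show "\<forall>t\<in>param_t r ` S. (J has_field_derivative h t) (at t)" using J_deriv S(5) by simp
  qed (use S(1-3,6) vals in simp_all)
qed

section \<open>Symmetric tensors and their diagonals\<close>

abbreviation lists_of :: "nat \<Rightarrow> coord list set" where
  "lists_of k \<equiv> {I. length I = k}"

text \<open>The slot \<open>a\<close> is arbitrary because \<open>sprod\<close> averages over all
  slots.\<close>

lemma sum_lists_insert:
  assumes "a \<le> k"
  shows "(\<Sum>I\<in>lists_of (Suc k). F I) = (\<Sum>i\<in>UNIV. \<Sum>J\<in>lists_of k. F (take a J @ i # drop a J))"
  unfolding sum.cartesian_product
  by (rule sum.reindex_bij_witness[of _ "\<lambda>(i, J). take a J @ i # drop a J"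
        "\<lambda>I. (I ! a, take a I @ drop (Suc a) I)"])
     (use assms in \<open>auto simp: id_take_nth_drop[symmetric] nth_append min_def\<close>)

abbreviation weight :: "'k::real_normed_field ^ coord \<Rightarrow> coord list \<Rightarrow> 'k" where
  "weight v I \<equiv> prod_list (map (($) v) I)"

lemma tdiag_eq: "tdiag k T u v = (\<Sum>I\<in>lists_of k. T u I * weight v I)"
  unfolding tdiag_def
  by (intro sum.cong refl) (auto simp: prod.list_conv_set_nth atLeast0LessThan)

lemma weight_insert: "weight v (take a J @ i # drop a J) = v $ i * weight v J"
proof -
  have "weight v J = weight v (take a J) * weight v (drop a J)"
    by (metis append_take_drop_id map_append prod_list.append)
  then show ?thesis by (simp add: mult_ac)
qed

text \<open>Every slot contributes the same product, so the average in \<open>sprod\<close> equals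
  it. This multiplicativity lets tensors be handled as polynomials in \<open>v\<close>.\<close>

lemma tdiag_sprod: "tdiag (Suc k) (\<alpha> \<odot> T) u v = form1 \<alpha> u v * tdiag k T u v"
proof -
  have "tdiag (Suc k) (\<alpha> \<odot> T) u v =
      (\<Sum>I\<in>lists_of (Suc k). \<Sum>a<Suc k. \<alpha> u [I ! a] * T u (take a I @ drop (Suc a) I) * weight v I) / of_nat (Suc k)"
    unfolding tdiag_eq sum_divide_distrib
    by (intro sum.cong refl) (simp add: sprod_def sum_distrib_right sum_divide_distrib
      del: sum.lessThan_Suc of_nat_Suc)
  also have "(\<Sum>I\<in>lists_of (Suc k). \<Sum>a<Suc k. \<alpha> u [I ! a] * T u (take a I @ drop (Suc a) I) * weight v I) =
      (\<Sum>a<Suc k. \<Sum>I\<in>lists_of (Suc k). \<alpha> u [I ! a] * T u (take a I @ drop (Suc a) I) * weight v I)"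
    by (rule sum.swap)
  also have "\<dots> = (\<Sum>a<Suc k. form1 \<alpha> u v * tdiag k T u v)"
  proof (rule sum.cong[OF refl])
    fix a assume "a \<in> {..<Suc k}"
    then have a: "a \<le> k" by simp
    have "(\<Sum>I\<in>lists_of (Suc k). \<alpha> u [I ! a] * T u (take a I @ drop (Suc a) I) * weight v I) =
        (\<Sum>i\<in>UNIV. \<Sum>J\<in>lists_of k. (\<alpha> u [i] * v $ i) * (T u J * weight v J))"
      unfolding sum_lists_insert[OF a] weight_insert
      by (intro sum.cong refl) (use a in \<open>auto simp: nth_append mult_ac\<close>)
    then show "(\<Sum>I\<in>lists_of (Suc k). \<alpha> u [I ! a] * T u (take a I @ drop (Suc a) I) * weight v I) =
        form1 \<alpha> u v * tdiag k T u v"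
      by (simp add: form1_def tdiag_eq sum_product)
  qed
  also have "\<dots> / of_nat (Suc k) = form1 \<alpha> u v * tdiag k T u v"
    by (simp del: of_nat_Suc)
  finally show ?thesis .
qed

lemma tdiag_Suc_0: "tdiag (Suc 0) \<alpha> u v = form1 \<alpha> u v"
  by (simp add: tdiag_eq form1_def sum_lists_insert[of 0 0])

lemma tdiag_linear:
  "tdiag k (\<lambda>u I. S u I + T u I) u v = tdiag k S u v + tdiag k T u v"
  "tdiag k (\<lambda>u I. S u I - T u I) u v = tdiag k S u v - tdiag k T u v"
  "tdiag k (\<lambda>u I. c u * T u I) u v = c u * tdiag k T u v"
  "tdiag k (\<lambda>u I. \<Sum>x\<in>A. W x u I) u v = (\<Sum>x\<in>A. tdiag k (W x) u v)"
  by (simp_all add: tdiag_eq distrib_right left_diff_distrib sum.distrib sum_subtractf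
      sum_distrib_left sum_distrib_right mult.assoc)
     (rule sum.swap)

section \<open>Symmetric tensors as functions of multisets of indices\<close>

definition symmetric_form :: "nat \<Rightarrow> (coord list \<Rightarrow> 'k) \<Rightarrow> bool" where
  "symmetric_form k T \<longleftrightarrow> (\<forall>I J. length I = k \<longrightarrow> mset I = mset J \<longrightarrow> T I = T J)"

text \<open>Dependence on the multiset turns sums over slots into multiset sums by
  \<open>sum_slots\<close>, and these are visibly symmetric.\<close>

lemma symmetric_form_mset:
  assumes "symmetric_form k T"
  shows "\<exists>g. \<forall>I. length I = k \<longrightarrow> T I = g (mset I)"
proof (intro exI allI impI)
  fix I :: "coord list" assume I: "length I = k"
  have "mset (SOME J. mset J = mset I) = mset I" by (rule someI) (rule refl)
  then show "T I = (\<lambda>M. T (SOME J. mset J = M)) (mset I)"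
    using assms I unfolding symmetric_form_def by metis
qed

lemma symmetric_form_Cons: "symmetric_form (Suc k) T \<Longrightarrow> symmetric_form k (\<lambda>J. T (m # J))"
  unfolding symmetric_form_def by (metis length_Cons mset.simps(2))

lemma symmetric_form_insert:
  "\<lbrakk>symmetric_form (Suc k) T; length J = k\<rbrakk> \<Longrightarrow> T (take a J @ m # drop a J) = T (m # J)"
  unfolding symmetric_form_def
  by (metis append_take_drop_id length_append_singleton length_rotate1 length_Cons mset_append
      mset.simps(2) union_mset_add_mset_right size_mset)

lemma sum_slots: "(\<Sum>a<length I. h (I ! a)) = \<Sum>\<^sub># (image_mset h (mset I))"
proof -
  have "(\<Sum>a<length I. h (I ! a)) = sum_list (map h I)"
    by (simp add: sum_list_sum_nth atLeast0LessThan)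
  then show ?thesis by (simp add: sum_mset_sum_list[symmetric])
qed

lemma mset_remove_slot:
  assumes "a < length I"
  shows "mset (take a I @ drop (Suc a) I) = mset I - {#I ! a#}"
proof -
  have "mset I = mset (take a I @ I ! a # drop (Suc a) I)"
    using id_take_nth_drop[OF assms] by simp
  then show ?thesis by simp
qed

lemma symmetric_form_sprod:
  assumes "symmetric_form k (T u)"
  shows "symmetric_form (Suc k) ((\<alpha> \<odot> T) u)"
proof -
  obtain g where g: "\<And>I. length I = k \<Longrightarrow> T u I = g (mset I)"
    using symmetric_form_mset[OF assms] by blast
  have "(\<alpha> \<odot> T) u I = \<Sum>\<^sub># (image_mset (\<lambda>i. \<alpha> u [i] * g (mset I - {#i#})) (mset I)) / of_nat (Suc k)"
    if I: "length I = Suc k" for I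
  proof -
    have "(\<Sum>a<length I. \<alpha> u [I ! a] * T u (take a I @ drop (Suc a) I)) =
        (\<Sum>a<length I. \<alpha> u [I ! a] * g (mset I - {#I ! a#}))"
      using I by (intro sum.cong refl) (simp add: g mset_remove_slot del: mset_append)
    then show ?thesis
      using sum_slots[of "\<lambda>i. \<alpha> u [i] * g (mset I - {#i#})" I] I by (simp add: sprod_def)
  qed
  then show ?thesis
    unfolding symmetric_form_def by (metis size_mset)
qed

text \<open>For constant components the transport term of \<open>lie_deriv\<close> vanishes, and a
  sum over slots remains.\<close>

lemma symmetric_form_lie_deriv:
  assumes T: "\<And>u. T u = T0" and sym: "symmetric_form k T0"
  shows "symmetric_form k (lie_deriv X T u)"
proof -
  obtain g where g: "\<And>I. length I = k \<Longrightarrow> T0 I = g (mset I)"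
    using symmetric_form_mset[OF sym] by blast
  let ?h = "\<lambda>M i. \<Sum>m\<in>UNIV. partial i (\<lambda>u'. X u' $ m) u * g (add_mset m (M - {#i#}))"
  have eq: "lie_deriv X T u I = \<Sum>\<^sub># (image_mset (?h (mset I)) (mset I))" if I: "length I = k" for I
  proof -
    have "lie_deriv X T u I = (\<Sum>a<length I. \<Sum>m\<in>UNIV. partial (I ! a) (\<lambda>u'. X u' $ m) u * T0 (I[a := m]))"
      by (simp add: lie_deriv_def T)
    also have "\<dots> = (\<Sum>a<length I. ?h (mset I) (I ! a))"
      by (intro sum.cong refl arg_cong2[where f="(*)"]) (simp add: g I mset_update)
    also have "\<dots> = \<Sum>\<^sub># (image_mset (?h (mset I)) (mset I))"
      by (rule sum_slots)
    finally show ?thesis .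
  qed
  show ?thesis
    unfolding symmetric_form_def
  proof (intro allI impI)
    fix I J :: "coord list" assume "length I = k" "mset I = mset J"
    moreover from this have "length J = k" using mset_eq_length by metis
    ultimately show "lie_deriv X T u I = lie_deriv X T u J" by (simp only: eq)
  qed
qed

section \<open>Derivatives of diagonals, and polarization\<close>

lemma weight_has_derivative:
  "((\<lambda>t. weight (v + t *s w) I) has_field_derivative
    (\<Sum>a<length I. w $ (I ! a) * weight v (take a I @ drop (Suc a) I))) (at 0)"
proof (induction I)
  case (Cons x I)
  have "((\<lambda>t. v $ x + t * w $ x) has_field_derivative w $ x) (at 0)"
    by (auto intro!: derivative_eq_intros)
  from DERIV_mult[OF this Cons.IH] show ?case
    by (rule DERIV_cong_ev[THEN iffD1, rotated -1])
       (simp_all add: sum.lessThan_Suc_shift sum_distrib_left mult_ac del: sum.lessThan_Suc)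
qed simp

text \<open>By symmetry all slots contribute alike, hence the factor \<open>k + 1\<close>. With
  \<open>c\<close> the diagonal matrix of \<open>w\<close> this computes the derivative of the
  diagonal in direction \<open>w\<close>; with \<open>c\<close> the Jacobian of \<open>X\<close>
  weighted by \<open>v\<close> it computes the Lie derivative.\<close>

lemma sum_symmetric_slots:
  assumes sym: "symmetric_form (Suc k) (T u)"
  shows "(\<Sum>I\<in>lists_of (Suc k). \<Sum>a<Suc k. \<Sum>m\<in>UNIV. c (I ! a) m * T u (I[a := m]) * weight v (take a I @ drop (Suc a) I))
    = of_nat (Suc k) * (\<Sum>m\<in>UNIV. (\<Sum>i\<in>UNIV. c i m) * tdiag k (\<lambda>u J. T u (m # J)) u v)"
proof -
  have "(\<Sum>I\<in>lists_of (Suc k). \<Sum>m\<in>UNIV. c (I ! a) m * T u (I[a := m]) * weight v (take a I @ drop (Suc a) I))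
      = (\<Sum>m\<in>UNIV. (\<Sum>i\<in>UNIV. c i m) * tdiag k (\<lambda>u J. T u (m # J)) u v)" if "a < Suc k" for a
  proof -
    have a: "a \<le> k" using that by simp
    have "(\<Sum>I\<in>lists_of (Suc k). \<Sum>m\<in>UNIV. c (I ! a) m * T u (I[a := m]) * weight v (take a I @ drop (Suc a) I))
      = (\<Sum>i\<in>UNIV. \<Sum>J\<in>lists_of k. \<Sum>m\<in>UNIV. c i m * (T u (m # J) * weight v J))"
      unfolding sum_lists_insert[OF a]
    proof (intro sum.cong refl)
      fix i J m assume "J \<in> lists_of k"
      then have J: "length J = k" by simp
      have "(take a J @ i # drop a J)[a := m] = take a J @ m # drop a J"
        using a J by (simp add: list_update_append)
      then show "c ((take a J @ i # drop a J) ! a) m * T u ((take a J @ i # drop a J)[a := m]) *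
          weight v (take a (take a J @ i # drop a J) @ drop (Suc a) (take a J @ i # drop a J))
          = c i m * (T u (m # J) * weight v J)"
        using a J by (simp add: symmetric_form_insert[OF sym J] nth_append)
    qed
    also have "\<dots> = (\<Sum>i\<in>UNIV. \<Sum>m\<in>UNIV. c i m * tdiag k (\<lambda>u J. T u (m # J)) u v)"
      unfolding tdiag_eq sum_distrib_left by (intro sum.cong refl sum.swap)
    also have "\<dots> = (\<Sum>m\<in>UNIV. (\<Sum>i\<in>UNIV. c i m) * tdiag k (\<lambda>u J. T u (m # J)) u v)"
      unfolding sum_distrib_right by (rule sum.swap)
    finally show ?thesis .
  qed
  then show ?thesis
    by (subst sum.swap) simp
qed

lemma tdiag_has_derivative:
  assumes sym: "symmetric_form (Suc k) (T u)"
  shows "((\<lambda>t. tdiag (Suc k) T u (v + t *s w)) has_field_derivative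
    of_nat (Suc k) * (\<Sum>m\<in>UNIV. w $ m * tdiag k (\<lambda>u J. T u (m # J)) u v)) (at 0)"
proof -
  have "((\<lambda>t. tdiag (Suc k) T u (v + t *s w)) has_field_derivative
      (\<Sum>I\<in>lists_of (Suc k). T u I * (\<Sum>a<length I. w $ (I ! a) * weight v (take a I @ drop (Suc a) I)))) (at 0)"
    unfolding tdiag_eq by (intro DERIV_sum DERIV_cmult weight_has_derivative)
  moreover have "(\<Sum>I\<in>lists_of (Suc k). T u I * (\<Sum>a<length I. w $ (I ! a) * weight v (take a I @ drop (Suc a) I)))
      = (\<Sum>I\<in>lists_of (Suc k). \<Sum>a<Suc k. \<Sum>m\<in>UNIV. (if I ! a = m then w $ m else 0) * T u (I[a := m]) *
           weight v (take a I @ drop (Suc a) I))"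
    by (intro sum.cong refl)
       (simp add: sum_distrib_left mult_ac if_distrib[of "\<lambda>x. x * _"] if_distrib[of "\<lambda>x. _ * x"]
         del: sum.lessThan_Suc cong: if_cong)
  ultimately show ?thesis
    using sum_symmetric_slots[of k T u "\<lambda>i m. if i = m then w $ m else 0" v, OF sym]
    by (simp del: sum.lessThan_Suc of_nat_Suc)
qed

text \<open>To be read with \<open>tdiag_has_derivative\<close>: on the diagonal, the Lie derivative
  of a constant tensor is the derivative of its form in the direction of the Jacobian of
  \<open>X\<close> applied to \<open>v\<close>.\<close>

lemma tdiag_lie_deriv:
  assumes T: "\<And>u. T u = T0" and sym: "symmetric_form (Suc k) T0"
  shows "tdiag (Suc k) (lie_deriv X T) u v = of_nat (Suc k) *
    (\<Sum>m\<in>UNIV. (\<Sum>i\<in>UNIV. partial i (\<lambda>u'. X u' $ m) u * v $ i) * tdiag k (\<lambda>u J. T u (m # J)) u v)"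
proof -
  have "tdiag (Suc k) (lie_deriv X T) u v =
      (\<Sum>I\<in>lists_of (Suc k). \<Sum>a<Suc k. \<Sum>m\<in>UNIV. (partial (I ! a) (\<lambda>u'. X u' $ m) u * v $ (I ! a)) *
         T u (I[a := m]) * weight v (take a I @ drop (Suc a) I))"
    unfolding tdiag_eq
  proof (intro sum.cong refl)
    fix I assume "I \<in> lists_of (Suc k)"
    then have I: "length I = Suc k" by simp
    have w: "weight v I = v $ (I ! a) * weight v (take a I @ drop (Suc a) I)" if "a < Suc k" for a
    proof -
      have "I = take a (take a I @ drop (Suc a) I) @ I ! a # drop a (take a I @ drop (Suc a) I)"
        using id_take_nth_drop[of a I] that I by simp
      then show ?thesis using weight_insert by metis
    qed
    have "lie_deriv X T u I * weight v I =
        (\<Sum>a<Suc k. \<Sum>m\<in>UNIV. partial (I ! a) (\<lambda>u'. X u' $ m) u * T u (I[a := m]) * weight v I)"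
      unfolding lie_deriv_def T by (simp add: I sum_distrib_right del: sum.lessThan_Suc)
    also have "\<dots> = (\<Sum>a<Suc k. \<Sum>m\<in>UNIV. (partial (I ! a) (\<lambda>u'. X u' $ m) u * v $ (I ! a)) *
         T u (I[a := m]) * weight v (take a I @ drop (Suc a) I))"
      by (intro sum.cong refl) (simp only: lessThan_iff w mult_ac)
    finally show "lie_deriv X T u I * weight v I = \<dots>" .
  qed
  also have "\<dots> = of_nat (Suc k) *
    (\<Sum>m\<in>UNIV. (\<Sum>i\<in>UNIV. partial i (\<lambda>u'. X u' $ m) u * v $ i) * tdiag k (\<lambda>u J. T u (m # J)) u v)"
    by (rule sum_symmetric_slots[of k T u]) (simp add: T sym)
  finally show ?thesis .
qed

text \<open>Differentiating the vanishing diagonal along an axis fixes one index and gives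
  \<open>k + 1\<close> times a diagonal of rank \<open>k\<close>; in characteristic 0 the factor
  cancels.\<close>

lemma polarization:
  fixes T :: "'k::real_normed_field tensor"
  assumes "symmetric_form k (T u)" "\<And>v. tdiag k T u v = 0" "length I = k"
  shows "T u I = 0"
  using assms
proof (induction k arbitrary: T I)
  case 0
  then show ?case by (simp add: tdiag_eq)
next
  case (Suc k)
  obtain m J where I: "I = m # J" "length J = k"
    using Suc.prems(3) by (cases I) auto
  have "tdiag k (\<lambda>u J. T u (m # J)) u v = 0" for v
  proof -
    have "((\<lambda>t. tdiag (Suc k) T u (v + t *s axis m 1)) has_field_derivative
        of_nat (Suc k) * tdiag k (\<lambda>u J. T u (m # J)) u v) (at 0)"
      using tdiag_has_derivative[of k T u v "axis m 1", OF Suc.prems(1)]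
      by (simp add: axis_def if_distrib[of "\<lambda>x. x * _"] cong: if_cong)
    then have "of_nat (Suc k) * tdiag k (\<lambda>u J. T u (m # J)) u v = 0"
      unfolding Suc.prems(2) by (rule DERIV_unique[OF _ DERIV_const])
    then show ?thesis by (simp del: of_nat_Suc)
  qed
  from Suc.IH[OF symmetric_form_Cons[OF Suc.prems(1)] this I(2)] show ?case
    by (simp add: I)
qed

section \<open>Prolongation of the symmetry equations\<close>

text \<open>The operators model the derivations along the contact frame \<open>e0, \<dots>, e3\<close> dual to the coframe in which
  $\Upsilon$ is the discriminant form; \<open>T\<close> is a multiple of $\partial_z$, and \<open>R\<close> is the space of
  regular functions.\<close>

locale contact_frame = vector_space scale
  for scale :: "'k :: field_char_0 \<Rightarrow> 'v :: ab_group_add \<Rightarrow> 'v" +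
  fixes R :: "'v set" and e0 e1 e2 e3 T :: "'v \<Rightarrow> 'v" and one :: 'v
  assumes subspace_R: "subspace R"
    and closed: "\<lbrakk>P \<in> {e0, e1, e2, e3, T}; f \<in> R\<rbrakk> \<Longrightarrow> P f \<in> R"
    and add: "\<lbrakk>P \<in> {e0, e1, e2, e3, T}; f \<in> R; g \<in> R\<rbrakk> \<Longrightarrow> P (f + g) = P f + P g"
    and scl: "\<lbrakk>P \<in> {e0, e1, e2, e3, T}; f \<in> R\<rbrakk> \<Longrightarrow> P (scale c f) = scale c (P f)"
    and e10: "f \<in> R \<Longrightarrow> e1 (e0 f) = e0 (e1 f)"
    and e20: "f \<in> R \<Longrightarrow> e2 (e0 f) = e0 (e2 f)"
    and e30: "f \<in> R \<Longrightarrow> e3 (e0 f) = e0 (e3 f) - T f"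
    and e21: "f \<in> R \<Longrightarrow> e2 (e1 f) = e1 (e2 f) + scale 3 (T f)"
    and e31: "f \<in> R \<Longrightarrow> e3 (e1 f) = e1 (e3 f)"
    and e32: "f \<in> R \<Longrightarrow> e3 (e2 f) = e2 (e3 f)"
    and eT: "\<lbrakk>P \<in> {e0, e1, e2, e3}; f \<in> R\<rbrakk> \<Longrightarrow> P (T f) = T (P f)"
    and kernel: "\<lbrakk>f \<in> R; e0 f = 0; e1 f = 0; e2 f = 0; e3 f = 0\<rbrakk> \<Longrightarrow> \<exists>c. f = scale c one"
begin

text \<open>One equation for each index sum 0, ..., 6, the weights of the seven-dimensional summand.
  The term \<open>T f\<close> in the middle one is due to the order of the operators: for
  symmetrized second derivatives the equation reads \<open>e1 e2 = - e0 e3\<close>.\<close>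

definition solution :: "'v \<Rightarrow> bool" where
  "solution f \<longleftrightarrow> f \<in> R \<and> e0 (e0 f) = 0 \<and> e0 (e1 f) = 0 \<and> e1 (e1 f) = scale (-2) (e0 (e2 f)) \<and>
     e1 (e2 f) = - e0 (e3 f) - T f \<and> e2 (e2 f) = scale (-2) (e1 (e3 f)) \<and>
     e2 (e3 f) = 0 \<and> e3 (e3 f) = 0"

lemma in_R: "f \<in> R \<Longrightarrow> e0 f \<in> R" "f \<in> R \<Longrightarrow> e1 f \<in> R" "f \<in> R \<Longrightarrow> e2 f \<in> R"
  "f \<in> R \<Longrightarrow> e3 f \<in> R" "f \<in> R \<Longrightarrow> T f \<in> R" "f \<in> R \<Longrightarrow> scale c f \<in> R"
  "f \<in> R \<Longrightarrow> g \<in> R \<Longrightarrow> f + g \<in> R" "f \<in> R \<Longrightarrow> g \<in> R \<Longrightarrow> f - g \<in> R" "f \<in> R \<Longrightarrow> - f \<in> R" "0 \<in> R"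
  using closed subspace_R
  by (auto intro: subspace_scale subspace_add subspace_diff subspace_neg subspace_0)

lemma op_minus: "\<lbrakk>P \<in> {e0, e1, e2, e3, T}; f \<in> R\<rbrakk> \<Longrightarrow> P (- f) = - P f"
  using scl[of P f "- 1"] by simp

lemma op_diff: "\<lbrakk>P \<in> {e0, e1, e2, e3, T}; f \<in> R; g \<in> R\<rbrakk> \<Longrightarrow> P (f - g) = P f - P g"
  using add[of P f "- g"] op_minus[of P g] in_R(9)[of g] by simp

lemma op_zero: "P \<in> {e0, e1, e2, e3, T} \<Longrightarrow> P 0 = 0"
  using scl[OF _ in_R(10), of P 0] by simp

lemmas op_simps =
  add[of e0, simplified] add[of e1, simplified] add[of e2, simplified] add[of e3, simplified] add[of T, simplified]
  scl[of e0, simplified] scl[of e1, simplified] scl[of e2, simplified] scl[of e3, simplified] scl[of T, simplified]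
  op_minus[of e0, simplified] op_minus[of e1, simplified] op_minus[of e2, simplified] op_minus[of e3, simplified]
  op_minus[of T, simplified]
  op_diff[of e0, simplified] op_diff[of e1, simplified] op_diff[of e2, simplified] op_diff[of e3, simplified]
  op_diff[of T, simplified]
  op_zero[of e0, simplified] op_zero[of e1, simplified] op_zero[of e2, simplified] op_zero[of e3, simplified]
  op_zero[of T, simplified]
  eT[of e0, simplified] eT[of e1, simplified] eT[of e2, simplified] eT[of e3, simplified] in_R

lemma eq_of_scaled: "\<lbrakk>c \<noteq> 0; scale c x = scale c y\<rbrakk> \<Longrightarrow> x = y"
  by simp

lemma self_scaled_zero: "\<lbrakk>x = scale c x; c \<noteq> 1\<rbrakk> \<Longrightarrow> x = 0"
  using scale_right_imp_eq[of x 1 c] by fastforce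

context
  fixes f assumes sol: "solution f"
begin

lemma f_in: "f \<in> R"
  and s00: "e0 (e0 f) = 0" and s01: "e0 (e1 f) = 0" and s11: "e1 (e1 f) = scale (-2) (e0 (e2 f))"
  and s12: "e1 (e2 f) = - e0 (e3 f) - T f" and s22: "e2 (e2 f) = scale (-2) (e1 (e3 f))"
  and s23: "e2 (e3 f) = 0" and s33: "e3 (e3 f) = 0"
  using sol by (auto simp: solution_def)

lemma s10: "e1 (e0 f) = 0" and s20: "e2 (e0 f) = e0 (e2 f)" and s30: "e3 (e0 f) = e0 (e3 f) - T f"
  and s21: "e2 (e1 f) = scale 2 (T f) - e0 (e3 f)" and s31: "e3 (e1 f) = e1 (e3 f)" and s32: "e3 (e2 f) = 0"
proof -
  show "e2 (e1 f) = scale 2 (T f) - e0 (e3 f)"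
    using scale_left_distrib[of 2 1 "T f"] by (simp add: e21 f_in s12)
qed (simp_all add: e10 e20 e30 e31 e32 f_in s01 s23)

text \<open>In the lemma names \<open>K\<close>, \<open>M\<close>, \<open>N\<close> are the second
  derivatives \<open>e0 (e2 f)\<close>, \<open>e0 (e3 f)\<close>, \<open>e1 (e3 f)\<close>, which
  the equations leave free. Their frame derivatives, up to \<open>e3N\<close>, all turn out to be
  multiples of \<open>T\<close> of a first derivative: order three brings no new unknowns.\<close>

lemma e0K: "e0 (e0 (e2 f)) = 0"
proof -
  have "scale (-2) (e0 (e0 (e2 f))) = e0 (e1 (e1 f))"
    by (simp add: s11 op_simps f_in)
  also have "\<dots> = e1 (e0 (e1 f))" by (simp add: e10 op_simps f_in)
  also have "\<dots> = 0" by (simp add: s01 op_simps)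
  finally show ?thesis by simp
qed

lemma e0e1e2: "e0 (e1 (e2 f)) = scale (-3) (T (e0 f))"
proof -
  have "e0 (e1 (e2 f)) = e0 (e2 (e1 f) - scale 3 (T f))"
    by (simp add: e21 f_in)
  also have "\<dots> = e2 (e0 (e1 f)) - scale 3 (T (e0 f))"
    by (simp add: op_simps f_in e20)
  finally show ?thesis by (simp add: s01 op_simps)
qed

lemma e1K: "e1 (e0 (e2 f)) = scale (-3) (T (e0 f))"
  using e0e1e2 by (simp add: e10 op_simps f_in)

lemma e0M: "e0 (e0 (e3 f)) = scale 2 (T (e0 f))"
proof -
  have "e0 (e1 (e2 f)) = - e0 (e0 (e3 f)) - T (e0 f)"
    by (simp add: s12 op_simps f_in)
  then have "e0 (e0 (e3 f)) = scale 3 (T (e0 f)) - scale 1 (T (e0 f))"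
    using e0e1e2 by (simp add: algebra_simps eq_neg_iff_add_eq_0)
  then show ?thesis
    by (simp only: scale_left_diff_distrib[symmetric]) simp
qed

lemma e2K: "e2 (e0 (e2 f)) = scale (-2) (e0 (e1 (e3 f)))"
proof -
  have "e2 (e0 (e2 f)) = e0 (e2 (e2 f))" by (simp add: e20 op_simps f_in)
  then show ?thesis by (simp add: s22 op_simps f_in)
qed

lemma e1M_e0N: "e1 (e0 (e3 f)) = e0 (e1 (e3 f))"
  by (simp add: e10 op_simps f_in)

text \<open>Two evaluations of \<open>e1 (e1 (e2 f))\<close>: by the equation for
  \<open>e1 (e2 f)\<close>, and by moving \<open>e2\<close> to the front, where
  \<open>e1 (e1 f)\<close> can be replaced. The unknown occurs with the coefficients - 1 and 4, and
  the resulting 5 cancels.\<close>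

lemma e1M: "e1 (e0 (e3 f)) = T (e1 f)"
proof -
  have "e1 (e1 (e2 f)) = - e1 (e0 (e3 f)) - T (e1 f)"
    by (simp add: s12 op_simps f_in)
  moreover have "e1 (e1 (e2 f)) = e1 (e2 (e1 f)) - scale 3 (T (e1 f))"
    using e21[OF f_in] by (simp add: op_simps f_in eq_diff_eq[symmetric])
  moreover have "e1 (e2 (e1 f)) = e2 (e1 (e1 f)) - scale 3 (T (e1 f))"
    by (simp add: e21 op_simps f_in)
  moreover have "e2 (e1 (e1 f)) = scale 4 (e1 (e0 (e3 f)))"
    by (simp add: s11 op_simps f_in e2K e1M_e0N)
  ultimately have "- e1 (e0 (e3 f)) - T (e1 f) =
      scale 4 (e1 (e0 (e3 f))) - scale 3 (T (e1 f)) - scale 3 (T (e1 f))"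
    by simp
  then have "scale 4 (e1 (e0 (e3 f))) + scale 1 (e1 (e0 (e3 f))) =
      scale 3 (T (e1 f)) + scale 3 (T (e1 f)) - scale 1 (T (e1 f))"
    by (simp add: algebra_simps)
  then have "scale 5 (e1 (e0 (e3 f))) = scale 5 (T (e1 f))"
    by (simp only: scale_left_distrib[symmetric] scale_left_diff_distrib[symmetric]) simp
  then show ?thesis by simp
qed

lemma e0N: "e0 (e1 (e3 f)) = T (e1 f)"
  using e1M e1M_e0N by simp

lemma e2K': "e2 (e0 (e2 f)) = scale (-2) (T (e1 f))"
  by (simp add: e2K e0N)

lemma e3K: "e3 (e0 (e2 f)) = - T (e2 f)"
  by (simp add: e30 op_simps f_in s32)

lemma e2M: "e2 (e0 (e3 f)) = 0"
  by (simp add: e20 op_simps f_in s23)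

lemma e3M: "e3 (e0 (e3 f)) = - T (e3 f)"
  by (simp add: e30 op_simps f_in s33)

lemma e1N: "e1 (e1 (e3 f)) = scale 2 (T (e2 f))"
proof -
  have "e1 (e1 (e3 f)) = e3 (e1 (e1 f))" by (simp add: e31 op_simps f_in)
  then show ?thesis by (simp add: s11 op_simps f_in e3K)
qed

lemma e2N: "e2 (e1 (e3 f)) = scale 3 (T (e3 f))"
  by (simp add: e21 op_simps f_in s23)

lemma e3N: "e3 (e1 (e3 f)) = 0"
  by (simp add: e31 op_simps f_in s33)

text \<open>The relation \<open>[e0, e3] = T\<close> is applied to \<open>K\<close>, and in the next
  two lemmas to \<open>N\<close> and \<open>M\<close>. The known derivatives reproduce the unknown
  on the other side, with a total coefficient that stays nonzero.\<close>

lemma TK: "T (e0 (e2 f)) = 0"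
proof -
  let ?k = "T (e0 (e2 f))"
  have "e3 (e0 (e0 (e2 f))) = e0 (e3 (e0 (e2 f))) - ?k"
    by (rule e30) (intro in_R f_in)
  then have "0 = - ?k - ?k"
    unfolding e0K e3K by (simp add: op_simps f_in)
  then have "scale 1 ?k + scale 1 ?k = 0"
    by (simp only: scale_one eq_diff_eq eq_neg_iff_add_eq_0 add_0)
  then show ?thesis
    by (simp only: scale_left_distrib[symmetric]) simp
qed

lemma TN: "T (e1 (e3 f)) = 0"
proof -
  have "e3 (e0 (e1 (e3 f))) = e0 (e3 (e1 (e3 f))) - T (e1 (e3 f))"
    by (simp add: e30 op_simps f_in)
  then have "scale 1 (T (e1 (e3 f))) + scale 1 (T (e1 (e3 f))) = 0"
    by (simp add: e0N e3N op_simps f_in s31 eq_neg_iff_add_eq_0)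
  then show ?thesis
    by (simp only: scale_left_distrib[symmetric]) simp
qed

lemma TM: "scale 2 (T (e0 (e3 f))) = T (T f)"
proof -
  let ?m = "T (e0 (e3 f))"
  have "e3 (e0 (e0 (e3 f))) = e0 (e3 (e0 (e3 f))) - ?m"
    by (simp add: e30 op_simps f_in)
  then have "scale 2 (?m - T (T f)) = - ?m - ?m"
    by (simp add: e0M e3M op_simps f_in s30)
  then have "scale 2 (T (T f)) = scale 2 ?m + scale 1 ?m + scale 1 ?m"
    by (simp add: algebra_simps)
  then have "scale 2 (T (T f)) = scale 2 (scale 2 ?m)"
    by (simp only: scale_left_distrib[symmetric] scale_scale) simp
  then show ?thesis by (rule eq_of_scaled[of 2, symmetric, rotated]) simp
qed

text \<open>Differentiating \<open>TM\<close> gives \<open>T (T (P f))\<close> as a multiple of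
  itself by 4, 2, 0 or - 2, none of which is 1. So \<open>T (T f)\<close> is constant and the system
  closes.\<close>

lemma e_TT:
  assumes "P \<in> {e0, e1, e2, e3}"
  shows "P (T (T f)) = 0"
proof -
  have *: "T (T (P f)) = scale 2 (T (P (e0 (e3 f))))"
    using arg_cong[OF TM, of P] assms by (auto simp: op_simps f_in)
  have "T (T (e0 f)) = scale 4 (T (T (e0 f)))" if "P = e0"
    using * that by (simp add: e0M op_simps f_in)
  moreover have "T (T (e1 f)) = scale 2 (T (T (e1 f)))" if "P = e1"
    using * that by (simp add: e1M op_simps f_in)
  moreover have "T (T (e2 f)) = 0" if "P = e2"
    using * that by (simp add: e2M op_simps f_in)
  moreover have "T (T (e3 f)) = scale (-2) (T (T (e3 f)))" if "P = e3"
    using * that by (simp add: e3M op_simps f_in)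
  ultimately have "T (T (P f)) = 0"
    using assms self_scaled_zero[of "T (T (e0 f))" 4] self_scaled_zero[of "T (T (e1 f))" 2]
      self_scaled_zero[of "T (T (e3 f))" "- 2"] by fastforce
  then show ?thesis using assms by (auto simp: op_simps f_in)
qed

end

text \<open>The components of the 14-jet of \<open>f\<close>, in an order in which each becomes constant as soon as all
  previous ones vanish.\<close>

definition jet :: "nat \<Rightarrow> 'v \<Rightarrow> 'v" where
  "jet k f = [T (T f), T (e0 f), T (e1 f), T (e2 f), T (e3 f), T f,
     e0 (e2 f), e0 (e3 f), e1 (e3 f), e0 f, e1 f, e2 f, e3 f, f] ! k"

lemma jet_simps [simp]:
  "jet 0 f = T (T f)" "jet (Suc 0) f = T (e0 f)" "jet 2 f = T (e1 f)" "jet 3 f = T (e2 f)"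
  "jet 4 f = T (e3 f)" "jet 5 f = T f" "jet 6 f = e0 (e2 f)" "jet 7 f = e0 (e3 f)"
  "jet 8 f = e1 (e3 f)" "jet 9 f = e0 f" "jet 10 f = e1 f" "jet 11 f = e2 f" "jet 12 f = e3 f"
  "jet 13 f = f"
  by (simp_all add: jet_def)

lemma jet_in_R: "\<lbrakk>f \<in> R; k < 14\<rbrakk> \<Longrightarrow> jet k f \<in> R"
  by (auto simp: less_Suc_eq numeral_eq_Suc jet_def in_R)

lemma below_14: "k < 14 \<longleftrightarrow> k \<in> {0, Suc 0, 2, 3, 4, 5, 6, 7, 8, 9, 10, 11, 12, 13::nat}"
  unfolding insert_iff empty_iff by presburger

text \<open>With weight 2 for \<open>T\<close> and weight 1 for each \<open>e\<close>, the jet lists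
  the weights 4, 3, 2, 1, 0, and every derivative of a component is a combination of components of
  the next higher weight, or 0 at weight 4. The five cases are the weights.\<close>

lemma e_jet:
  assumes sol: "solution f" and k: "k < 14" and prev: "\<And>l. l < k \<Longrightarrow> jet l f = 0"
    and P: "P \<in> {e0, e1, e2, e3}"
  shows "P (jet k f) = 0"
proof -
  have R: "f \<in> R" using f_in[OF sol] .
  note s = s00[OF sol] s01[OF sol] s11[OF sol] s12[OF sol] s22[OF sol] s23[OF sol] s33[OF sol]
    s10[OF sol] s20[OF sol] s30[OF sol] s21[OF sol] s31[OF sol] s32[OF sol]
    e0K[OF sol] e1K[OF sol] e2K'[OF sol] e3K[OF sol] e0M[OF sol] e1M[OF sol] e2M[OF sol] e3M[OF sol]
    e0N[OF sol] e1N[OF sol] e2N[OF sol] e3N[OF sol] TK[OF sol] TN[OF sol]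
  have p: "0 < k \<Longrightarrow> T (T f) = 0" "1 < k \<Longrightarrow> T (e0 f) = 0" "2 < k \<Longrightarrow> T (e1 f) = 0"
    "3 < k \<Longrightarrow> T (e2 f) = 0" "4 < k \<Longrightarrow> T (e3 f) = 0" "5 < k \<Longrightarrow> T f = 0" "6 < k \<Longrightarrow> e0 (e2 f) = 0"
    "7 < k \<Longrightarrow> e0 (e3 f) = 0" "8 < k \<Longrightarrow> e1 (e3 f) = 0" "9 < k \<Longrightarrow> e0 f = 0" "10 < k \<Longrightarrow> e1 f = 0"
    "11 < k \<Longrightarrow> e2 f = 0" "12 < k \<Longrightarrow> e3 f = 0"
    using prev[of 0] prev[of 1] prev[of 2] prev[of 3] prev[of 4] prev[of 5] prev[of 6] prev[of 7]
      prev[of 8] prev[of 9] prev[of 10] prev[of 11] prev[of 12] by simp_all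
  have TM: "T (e0 (e3 f)) = 0" if "0 < k"
    using TM[OF sol] p(1) that by simp
  consider "k = 0" | "1 \<le> k" "k \<le> 4" | "5 \<le> k" "k \<le> 8" | "9 \<le> k" "k \<le> 12" | "k = 13"
    using k by linarith
  then show ?thesis
  proof cases
    case 1
    then show ?thesis using e_TT[OF sol P] by simp
  next
    case 2
    then have "k \<in> {Suc 0, 2, 3, 4}" by auto
    moreover have "T (T f) = 0" "T (e0 (e3 f)) = 0" using p(1) TM 2 by auto
    ultimately show ?thesis
      using P by (elim insertE emptyE) (simp_all add: op_simps R s)
  next
    case 3
    then have "k \<in> {5, 6, 7, 8}" by auto
    moreover have "T (e0 f) = 0" "T (e1 f) = 0" "T (e2 f) = 0" "T (e3 f) = 0" using p 3 by auto
    ultimately show ?thesis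
      using P by (elim insertE emptyE) (simp_all add: op_simps R s)
  next
    case 4
    then have "k \<in> {9, 10, 11, 12}" by auto
    moreover have "T f = 0" "e0 (e2 f) = 0" "e0 (e3 f) = 0" "e1 (e3 f) = 0" using p 4 by auto
    ultimately show ?thesis
      using P by (elim insertE emptyE) (simp_all add: op_simps R s)
  next
    case 5
    then show ?thesis using P p by auto
  qed
qed

lemma solution_diff_scale:
  assumes "solution f" "solution g"
  shows "solution (f - scale c g)"
proof -
  note f = s00[OF assms(1)] s01[OF assms(1)] s11[OF assms(1)] s12[OF assms(1)] s22[OF assms(1)]
    s23[OF assms(1)] s33[OF assms(1)]
  note g = s00[OF assms(2)] s01[OF assms(2)] s11[OF assms(2)] s12[OF assms(2)] s22[OF assms(2)]
    s23[OF assms(2)] s33[OF assms(2)]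
  show ?thesis
    by (simp add: solution_def op_simps f_in[OF assms(1)] f_in[OF assms(2)] f g
        scale_right_diff_distrib scale_left_commute[of c] mult.commute[of c])
qed

lemma jet_diff_scale:
  assumes "f \<in> R" "g \<in> R" "k < 14"
  shows "jet k (f - scale c g) = jet k f - scale c (jet k g)"
  using assms(3) unfolding below_14 by (elim insertE emptyE) (simp_all add: op_simps assms(1,2))

text \<open>Elimination in a triangular system: once the components before \<open>k\<close> vanish,
  the \<open>k\<close>-th is constant by \<open>e_jet\<close> and \<open>kernel\<close>, and a
  multiple of \<open>G k\<close> removes it without disturbing the earlier ones.\<close>

theorem solutions_spanned:
  assumes G: "\<And>k. k < 14 \<Longrightarrow> solution (G k)"
    and tri: "\<And>k l. k < 14 \<Longrightarrow> l < k \<Longrightarrow> jet l (G k) = 0"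
    and diag: "\<And>k. k < 14 \<Longrightarrow> \<exists>c. c \<noteq> 0 \<and> jet k (G k) = scale c one"
    and f: "solution f"
  shows "f \<in> span (G ` {..<14})"
proof -
  \<comment> \<open>\<open>n\<close> counts the components that may still be nonzero.\<close>
  have "f \<in> span (G ` {..<14})" if "solution f" "\<And>l. l < 14 - n \<Longrightarrow> jet l f = 0" "n \<le> 14" for n f
    using that
  proof (induction n arbitrary: f)
    case 0
    \<comment> \<open>Component 13 is \<open>f\<close> itself.\<close>
    then have "f = 0" using "0.prems"(2)[of 13] by simp
    then show ?case by (simp add: span_zero)
  next
    case (Suc n)
    let ?k = "13 - n"
    have k: "?k < 14" "14 - Suc n = ?k" "14 - n = Suc ?k" using Suc.prems(3) by auto
    have zero: "P (jet ?k f) = 0" if "P \<in> {e0, e1, e2, e3}" for P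
      using e_jet[OF Suc.prems(1) k(1) _ that] Suc.prems(2) k(2) by simp
    have "jet ?k f \<in> R" using jet_in_R[OF f_in[OF Suc.prems(1)] k(1)] .
    then obtain c where c: "jet ?k f = scale c one"
      using kernel[of "jet ?k f"] zero by blast
    obtain d where d: "d \<noteq> 0" "jet ?k (G ?k) = scale d one"
      using diag[OF k(1)] by blast
    let ?f = "f - scale (c / d) (G ?k)"
    have "?f \<in> span (G ` {..<14})"
    proof (rule Suc.IH)
      show "solution ?f" by (rule solution_diff_scale[OF Suc.prems(1) G[OF k(1)]])
      show "jet l ?f = 0" if "l < 14 - n" for l
      proof -
        have l: "l < 14" "l = ?k \<or> l < ?k" using that k by auto
        have "jet l ?f = jet l f - scale (c / d) (jet l (G ?k))"
          by (rule jet_diff_scale[OF f_in[OF Suc.prems(1)] f_in[OF G[OF k(1)]] l(1)])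
        also have "\<dots> = 0"
          using l(2)
        proof
          assume "l = ?k"
          then show ?thesis using c d by simp
        next
          assume "l < ?k"
          then show ?thesis using Suc.prems(2)[of l] tri[OF k(1), of l] k(2) by simp
        qed
        finally show ?thesis .
      qed
    qed (use Suc.prems in simp)
    moreover have "G ?k \<in> span (G ` {..<14})"
      using k(1) by (intro span_base imageI) simp
    ultimately have "?f + scale (c / d) (G ?k) \<in> span (G ` {..<14})"
      by (intro span_add span_scale)
    then show ?case by simp
  qed
  from this[of f 14] f show ?thesis by simp
qed

end

section \<open>The structural tensor in its adapted coframe\<close>

text \<open>Up to the factor - 27, the discriminant of the cubic with coefficients
  \<open>a, 3 b, 3 c, d\<close>.\<close>

definition disc :: "'k::field \<Rightarrow> 'k \<Rightarrow> 'k \<Rightarrow> 'k \<Rightarrow> 'k" where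
  "disc a b c d = a^2 * d^2 - 6 * a * b * c * d + 4 * a * c^3 + 4 * b^3 * d - 3 * b^2 * c^2"

definition disc_deriv :: "'k::field \<Rightarrow> 'k \<Rightarrow> 'k \<Rightarrow> 'k \<Rightarrow> 'k \<Rightarrow> 'k \<Rightarrow> 'k \<Rightarrow> 'k \<Rightarrow> 'k" where
  "disc_deriv a b c d a' b' c' d' =
     (2 * a * d^2 - 6 * b * c * d + 4 * c^3) * a' + (12 * b^2 * d - 6 * a * c * d - 6 * b * c^2) * b'
     + (12 * a * c^2 - 6 * a * b * d - 6 * b^2 * c) * c' + (2 * a^2 * d - 6 * a * b * c + 4 * b^3) * d'"

definition cof :: "nat \<Rightarrow> 'k::field ^ coord \<Rightarrow> 'k" where
  "cof k v = [- (3/4) * v $ Cp, 1/4 * v $ Cq, 1/2 * v $ Cy, 1/2 * v $ Cx + 3/8 * v $ Cp] ! k"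

lemma cof_simps:
  "cof 0 v = - (3/4) * v $ Cp" "cof (Suc 0) v = 1/4 * v $ Cq" "cof 2 v = 1/2 * v $ Cy"
  "cof 3 v = 1/2 * v $ Cx + 3/8 * v $ Cp"
  by (simp_all add: cof_def)

definition discT :: "'k::field ^ coord \<Rightarrow> 'k" where
  "discT v = disc (cof 0 v) (cof (Suc 0) v) (cof 2 v) (cof 3 v)"

definition discT_deriv :: "'k::field ^ coord \<Rightarrow> 'k ^ coord \<Rightarrow> 'k" where
  "discT_deriv v w = disc_deriv (cof 0 v) (cof (Suc 0) v) (cof 2 v) (cof 3 v)
     (cof 0 w) (cof (Suc 0) w) (cof 2 w) (cof 3 w)"

lemma sum_coord: "(\<Sum>i\<in>UNIV. F i) = F Cx + F Cy + F Cz + F Cp + F Cq"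
  by (simp add: UNIV_coord add.assoc)

lemma form1_dcoord: "form1 (dcoord i) u v = v $ i"
  by (simp add: form1_def dcoord_def if_distrib[of "\<lambda>x. x * _"] eq_commute[of _ i] cong: if_cong)

lemma tdiag_monom4: "tdiag 4 (monom4 i j k l) u v = v $ i * v $ j * v $ k * v $ l"
proof -
  have four: "4 = Suc (Suc (Suc (Suc 0)))" by simp
  show ?thesis
    unfolding monom4_def four tdiag_sprod tdiag_Suc_0 form1_dcoord by (simp only: mult.assoc)
qed

lemma tdiag_Upsilon_explicit:
  fixes v :: "'k::real_normed_field ^ coord"
  shows "tdiag 4 Upsilon u v = 81 * v$Cp^4 + 216 * v$Cp^3 * v$Cx + 216 * v$Cp^2 * v$Cq * v$Cy
     + 144 * v$Cp^2 * v$Cx^2 + 24 * v$Cp * v$Cq^3 + 288 * v$Cp * v$Cq * v$Cx * v$Cy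
     - 384 * v$Cp * v$Cy^3 + 32 * v$Cq^3 * v$Cx - 48 * v$Cq^2 * v$Cy^2"
proof -
  have "tdiag 4 Upsilon u v = 81 * tdiag 4 (monom4 Cp Cp Cp Cp) u v + 216 * tdiag 4 (monom4 Cp Cp Cp Cx) u v
     + 216 * tdiag 4 (monom4 Cp Cp Cq Cy) u v + 144 * tdiag 4 (monom4 Cp Cp Cx Cx) u v
     + 24 * tdiag 4 (monom4 Cp Cq Cq Cq) u v + 288 * tdiag 4 (monom4 Cp Cq Cx Cy) u v
     - 384 * tdiag 4 (monom4 Cp Cy Cy Cy) u v + 32 * tdiag 4 (monom4 Cq Cq Cq Cx) u v
     - 48 * tdiag 4 (monom4 Cq Cq Cy Cy) u v"
    unfolding tdiag_eq Upsilon_def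
    by (simp only: distrib_right left_diff_distrib sum.distrib sum_subtractf mult.assoc sum_distrib_left)
  then show ?thesis
    unfolding tdiag_monom4 by (simp add: power2_eq_square power3_eq_cube power4_eq_xxxx mult.assoc)
qed

lemma tdiag_Upsilon:
  fixes v :: "'k::real_normed_field ^ coord"
  shows "tdiag 4 Upsilon u v = 1024 * discT v"
  unfolding tdiag_Upsilon_explicit discT_def disc_def cof_simps
  by (simp add: field_simps eval_nat_numeral)

lemma symmetric_form_monom4: "symmetric_form 4 (monom4 i j k l u)"
proof -
  have four: "(4::nat) = Suc (Suc (Suc (Suc 0)))" by simp
  have "symmetric_form (Suc 0) (dcoord l u)"
    by (auto simp: symmetric_form_def length_Suc_conv)
  then show ?thesis
    unfolding monom4_def four by (intro symmetric_form_sprod)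
qed

lemma symmetric_form_Upsilon: "symmetric_form 4 (Upsilon u)"
  unfolding symmetric_form_def
proof (intro allI impI)
  fix I J :: "coord list" assume "length I = 4" "mset I = mset J"
  then have e: "monom4 i j k l u I = monom4 i j k l u J" for i j k l
    using symmetric_form_monom4 unfolding symmetric_form_def by blast
  show "Upsilon u I = Upsilon u J"
    unfolding Upsilon_def e ..
qed

lemma Upsilon_const: "Upsilon (u :: 'a::real_normed_field ^ coord) = Upsilon 0"
proof -
  have sprod: "(\<alpha> \<odot> T) u = (\<alpha> \<odot> T) 0" if "\<alpha> u = \<alpha> 0" "T u = T 0" for \<alpha> T :: "'a tensor"
    by (intro ext) (simp only: sprod_def that)
  have dcoord: "dcoord i u = (dcoord i 0 :: coord list \<Rightarrow> 'a)" for i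
    by (intro ext) (simp only: dcoord_def)
  have "monom4 i j k l u = (monom4 i j k l 0 :: coord list \<Rightarrow> 'a)" for i j k l
    unfolding monom4_def by (intro sprod dcoord)
  then show ?thesis
    by (intro ext) (simp only: Upsilon_def)
qed

lemma discT_has_derivative:
  fixes v :: "'a::real_normed_field ^ coord"
  shows "((\<lambda>t. discT (v + t *s w)) has_field_derivative discT_deriv v w) (at 0)"
proof -
  have lin: "cof k (v + t *s w) = cof k v + t * cof k w" if "k \<in> {0, Suc 0, 2, 3}" for k t
    using that by (auto simp: cof_simps algebra_simps)
  have "((\<lambda>t. disc (a + t * a') (b + t * b') (c + t * c') (d + t * d')) has_field_derivative
      disc_deriv a b c d a' b' c' d') (at 0)" for a b c d a' b' c' d' :: 'a
    unfolding disc_def disc_deriv_def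
    by (auto intro!: derivative_eq_intros) (simp add: algebra_simps power2_eq_square power3_eq_cube)
  then show ?thesis
    by (simp add: discT_def discT_deriv_def lin)
qed

text \<open>Two computations of one directional derivative, from the components and from the
  discriminant form; derivatives are unique.\<close>

lemma polar_Upsilon:
  "of_nat 4 * (\<Sum>m\<in>UNIV. w $ m * tdiag 3 (\<lambda>u J. Upsilon u (m # J)) u v) = 1024 * discT_deriv v w"
proof -
  have "((\<lambda>t. tdiag (Suc 3) Upsilon u (v + t *s w)) has_field_derivative
      of_nat (Suc 3) * (\<Sum>m\<in>UNIV. w $ m * tdiag 3 (\<lambda>u J. Upsilon u (m # J)) u v)) (at 0)"
    by (rule tdiag_has_derivative) (simp add: symmetric_form_Upsilon)
  moreover have "((\<lambda>t. tdiag (Suc 3) Upsilon u (v + t *s w)) has_field_derivative 1024 * discT_deriv v w) (at 0)"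
    using DERIV_cmult[OF discT_has_derivative, of 1024 v w] by (simp add: tdiag_Upsilon)
  ultimately show ?thesis
    using DERIV_unique by fastforce
qed

section \<open>The symmetry equations for the contact Hamiltonian\<close>

text \<open>\<open>fr0\<close>, ..., \<open>fr3\<close> differentiate along the basis of the contact
  plane dual to \<open>cof\<close>; \<open>frT\<close> is the commutator \<open>[fr0, fr3]\<close>,
  which fixes its factor \<open>- (8/3)\<close>.\<close>

definition fr0 :: "('k::real_normed_field ^ coord \<Rightarrow> 'k) \<Rightarrow> 'k ^ coord \<Rightarrow> 'k" where
  "fr0 f u = partial Cx f u + u $ Cp * partial Cz f u - 4/3 * partial Cp f u"

definition fr1 :: "('k::real_normed_field ^ coord \<Rightarrow> 'k) \<Rightarrow> 'k ^ coord \<Rightarrow> 'k" where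
  "fr1 f u = 4 * partial Cq f u"

definition fr2 :: "('k::real_normed_field ^ coord \<Rightarrow> 'k) \<Rightarrow> 'k ^ coord \<Rightarrow> 'k" where
  "fr2 f u = 2 * (partial Cy f u + u $ Cq * partial Cz f u)"

definition fr3 :: "('k::real_normed_field ^ coord \<Rightarrow> 'k) \<Rightarrow> 'k ^ coord \<Rightarrow> 'k" where
  "fr3 f u = 2 * (partial Cx f u + u $ Cp * partial Cz f u)"

definition frT :: "('k::real_normed_field ^ coord \<Rightarrow> 'k) \<Rightarrow> 'k ^ coord \<Rightarrow> 'k" where
  "frT f u = - (8/3) * partial Cz f u"

lemmas fr_defs = fr0_def fr1_def fr2_def fr3_def frT_def

text \<open>The vector of the contact plane at \<open>u\<close> with the coframe values
  \<open>a, b, c, d\<close>.\<close>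

definition contact_vec :: "'k ^ coord \<Rightarrow> 'k \<Rightarrow> 'k \<Rightarrow> 'k \<Rightarrow> 'k \<Rightarrow> 'k::real_normed_field ^ coord" where
  "contact_vec u a b c d =
     vec5 (a + 2 * d) (2 * c) (u $ Cp * (a + 2 * d) + u $ Cq * (2 * c)) (- (4/3) * a) (4 * b)"

lemma vec5_nth [simp]:
  "vec5 a b c d e $ Cx = a" "vec5 a b c d e $ Cy = b" "vec5 a b c d e $ Cz = c"
  "vec5 a b c d e $ Cp = d" "vec5 a b c d e $ Cq = e"
  by (simp_all add: vec5_def)

lemma cof_contact_vec:
  "cof 0 (contact_vec u a b c d) = a" "cof (Suc 0) (contact_vec u a b c d) = b"
  "cof 2 (contact_vec u a b c d) = c" "cof 3 (contact_vec u a b c d) = d"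
  by (simp_all add: cof_simps contact_vec_def field_simps)

lemma form1_contact: "form1 contact_form u v = v $ Cz - u $ Cp * v $ Cx - u $ Cq * v $ Cy"
  by (simp add: form1_def sum_coord contact_form_def dcoord_def)

lemma form1_contact_vec: "form1 contact_form u (contact_vec u a b c d) = 0"
  by (simp add: form1_contact contact_vec_def)

lemma contact_vec_cof:
  assumes "form1 contact_form u v = 0"
  shows "contact_vec u (cof 0 v) (cof (Suc 0) v) (cof 2 v) (cof 3 v) = v"
proof -
  have "v $ Cz = u $ Cp * v $ Cx + u $ Cq * v $ Cy"
    using assms by (simp add: form1_contact algebra_simps)
  moreover have "(w = v) = (w $ Cx = v $ Cx \<and> w $ Cy = v $ Cy \<and> w $ Cz = v $ Cz \<and> w $ Cp = v $ Cp \<and> w $ Cq = v $ Cq)" for w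
    by (metis (full_types) vec_eq_iff coord.exhaust)
  ultimately show ?thesis
    by (simp add: contact_vec_def cof_simps algebra_simps)
qed

lemma derivative_along_contact_vec:
  "(\<Sum>i\<in>UNIV. partial i f u * contact_vec u a b c d $ i) = a * fr0 f u + b * fr1 f u + c * fr2 f u + d * fr3 f u"
  by (simp add: sum_coord contact_vec_def fr_defs algebra_simps)

text \<open>The usual contact field of \<open>f\<close>, with components \<open>- f_p\<close> and
  \<open>- f_q\<close> along \<open>x\<close> and \<open>y\<close>, rewritten in frame derivatives.
  Both \<open>fr0\<close> and \<open>fr3\<close> enter \<open>f_p\<close> because \<open>fr0\<close>
  mixes the directions of \<open>x\<close> and \<open>p\<close>.\<close>

definition hamiltonian_on :: "('k ^ coord) set \<Rightarrow> ('k ^ coord \<Rightarrow> 'k ^ coord) \<Rightarrow> ('k::real_normed_field ^ coord \<Rightarrow> 'k) \<Rightarrow> bool" where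
  "hamiltonian_on U X f \<longleftrightarrow> (\<forall>u\<in>U.
     X u $ Cx = 3/4 * fr0 f u - 3/8 * fr3 f u \<and> X u $ Cy = - (1/4) * fr1 f u \<and>
     X u $ Cz = f u + u $ Cp * X u $ Cx + u $ Cq * X u $ Cy \<and>
     X u $ Cp = 1/2 * fr3 f u \<and> X u $ Cq = 1/2 * fr2 f u)"

text \<open>Here \<open>mij\<close> stands for a second frame derivative of the Hamiltonian and
  \<open>t\<close> for its \<open>T\<close>-derivative; \<open>m12 + 3 * t\<close> and
  \<open>m03 - t\<close> are two of these derivatives with the operators in the other order. The
  quartic identity is tested at a few points that isolate the unknowns, and the multiplier
  \<open>\<phi>\<close> comes out as \<open>- 6 * t\<close>.\<close>

lemma alg_forward:
  fixes t \<phi> :: "'k::field_char_0"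
  assumes id: "\<And>a b c d. disc_deriv a b c d
      (- 3 * (a * m03 + b * m13 + c * m23 + d * m33)) (a * m02 + b * m12 + c * m22 + d * m23)
      (- (a * m01 + b * m11 + c * (m12 + 3 * t) + d * m13)) (3 * (a * m00 + b * m01 + c * m02 + d * (m03 - t)))
      = \<phi> * disc a b c d"
  shows "m00 = 0" "m01 = 0" "m11 = - 2 * m02" "m12 = - m03 - t" "m22 = - 2 * m13" "m23 = 0" "m33 = 0"
proof -
  have cancel: "x = 0" if "c * x = 0" "c \<noteq> 0" for c x :: 'k
    using that by simp
  note id' = id[unfolded disc_deriv_def disc_def]
  show 23: "m23 = 0" using id'[where a=0 and b=0 and c=1 and d=0] by simp
  show 01: "m01 = 0" using id'[where a=0 and b=1 and c=0 and d=0] by simp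
  \<comment> \<open>On the points \<open>(1, 0, 0, d)\<close> only \<open>m00\<close>,
    \<open>m33\<close> and \<open>\<phi> + 6 * t\<close> survive; three values of \<open>d\<close>
    determine them.\<close>
  have a: "6 * (m00 - m33) = \<phi> + 6 * t"
    using id'[where a=1 and b=0 and c=0 and d=1] by (simp add: algebra_simps)
  have b: "6 * (m33 - m00) = \<phi> + 6 * t"
    using id'[where a=1 and b=0 and c=0 and d="-1"] by (simp add: algebra_simps)
  have c: "12 * (m00 - 4 * m33) = 4 * (\<phi> + 6 * t)"
    using id'[where a=1 and b=0 and c=0 and d=2] by (simp add: algebra_simps)
  have "2 * (\<phi> + 6 * t) = 6 * (m00 - m33) + 6 * (m33 - m00)"
    unfolding a b by (simp only: mult_2)
  also have "\<dots> = 0" by (simp add: algebra_simps)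
  finally have \<phi>6: "\<phi> + 6 * t = 0" by (rule cancel) simp
  then have \<phi>: "\<phi> = - 6 * t" by (simp add: eq_neg_iff_add_eq_0)
  have eq: "m00 = m33" using a \<phi>6 by simp
  have "- 36 * m33 = 12 * (m00 - 4 * m33)" unfolding eq by (simp add: algebra_simps)
  then show 33: "m33 = 0" using c \<phi>6 by simp
  then show 00: "m00 = 0" using eq by simp
  have f: "- 12 * m03 - 12 * (m12 + 3 * t) = 4 * \<phi>"
    using id'[where a=1 and b=0 and c=1 and d=0] 23 01 by (simp add: algebra_simps)
  have "12 * (m12 + m03 + t) = 4 * \<phi> - (- 12 * m03 - 12 * (m12 + 3 * t))"
    unfolding \<phi> by (simp add: algebra_simps)
  then have "12 * (m12 + m03 + t) = 0" unfolding f by (simp only: diff_self)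
  then have "m12 + m03 + t = 0" by (rule cancel) simp
  then show 12: "m12 = - m03 - t" by (simp add: eq_neg_iff_add_eq_0 eq_diff_eq algebra_simps)
  \<comment> \<open>The points \<open>(1, 1, 1, 0)\<close> and \<open>(1, 1, - 1, 0)\<close> give
    two relations. Their combination contains \<open>m11 + 2 * m02\<close> alone, after which the
    first one leaves \<open>m22 + 2 * m13\<close>.\<close>
  have "- 12 * (m03 + m13) - 6 * (m02 + m12 + m22) - 6 * (m11 + (m12 + 3 * t)) - 6 * m02 =
      disc_deriv 1 1 1 0 (- 3 * (1 * m03 + 1 * m13 + 1 * m23 + 0 * m33)) (1 * m02 + 1 * m12 + 1 * m22 + 0 * m23)
      (- (1 * m01 + 1 * m11 + 1 * (m12 + 3 * t) + 0 * m13)) (3 * (1 * m00 + 1 * m01 + 1 * m02 + 0 * (m03 - t)))"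
    by (simp add: disc_deriv_def 23 01 00 algebra_simps)
  also have "\<dots> = \<phi>"
    unfolding id by (simp add: disc_def)
  finally have d: "- 12 * (m03 + m13) - 6 * (m02 + m12 + m22) - 6 * (m11 + (m12 + 3 * t)) - 6 * m02 = \<phi>" .
  have "12 * (m03 + m13) - 6 * (m02 + m12 - m22) - 18 * (m11 - (m12 + 3 * t)) - 30 * m02 =
      disc_deriv 1 1 (- 1) 0 (- 3 * (1 * m03 + 1 * m13 + (- 1) * m23 + 0 * m33)) (1 * m02 + 1 * m12 + (- 1) * m22 + 0 * m23)
      (- (1 * m01 + 1 * m11 + (- 1) * (m12 + 3 * t) + 0 * m13)) (3 * (1 * m00 + 1 * m01 + (- 1) * m02 + 0 * (m03 - t)))"
    by (simp add: disc_deriv_def 23 01 00 algebra_simps)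
  also have "\<dots> = - 7 * \<phi>"
    unfolding id by (simp add: disc_def)
  finally have e: "12 * (m03 + m13) - 6 * (m02 + m12 - m22) - 18 * (m11 - (m12 + 3 * t)) - 30 * m02 = - 7 * \<phi>" .
  have "24 * (m11 + 2 * m02) =
      (\<phi> - (- 12 * (m03 + m13) - 6 * (m02 + m12 + m22) - 6 * (m11 + (m12 + 3 * t)) - 6 * m02))
      + (- 7 * \<phi> - (12 * (m03 + m13) - 6 * (m02 + m12 - m22) - 18 * (m11 - (m12 + 3 * t)) - 30 * m02))"
    unfolding 12 \<phi> by (simp add: algebra_simps)
  then have "24 * (m11 + 2 * m02) = 0" unfolding d e by (simp only: diff_self add_0)
  then have "m11 + 2 * m02 = 0" by (rule cancel) simp
  then show 11: "m11 = - 2 * m02" by (simp add: eq_neg_iff_add_eq_0)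
  have "6 * (m22 + 2 * m13) =
      \<phi> - (- 12 * (m03 + m13) - 6 * (m02 + m12 + m22) - 6 * (m11 + (m12 + 3 * t)) - 6 * m02)"
    unfolding 11 12 \<phi> by (simp add: algebra_simps)
  then have "6 * (m22 + 2 * m13) = 0" unfolding d by (simp only: diff_self)
  then have "m22 + 2 * m13 = 0" by (rule cancel) simp
  then show "m22 = - 2 * m13" by (simp add: eq_neg_iff_add_eq_0)
qed

lemma alg_backward:
  fixes t :: "'k::field_char_0"
  assumes "m00 = 0" "m01 = 0" "m11 = - 2 * m02" "m12 = - m03 - t" "m22 = - 2 * m13" "m23 = 0" "m33 = 0"
  shows "disc_deriv a b c d
      (- 3 * (a * m03 + b * m13 + c * m23 + d * m33)) (a * m02 + b * m12 + c * m22 + d * m23)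
      (- (a * m01 + b * m11 + c * (m12 + 3 * t) + d * m13)) (3 * (a * m00 + b * m01 + c * m02 + d * (m03 - t)))
      = - 6 * t * disc a b c d"
  unfolding disc_deriv_def disc_def assms by (simp add: algebra_simps power2_eq_square power3_eq_cube)

lemma regular_on_diff:
  assumes "open U" "regular_on U f" "regular_on U g"
  shows "regular_on U (\<lambda>u. f u - g u)"
  using regular_on_add[OF assms(1,2) regular_on_mult[OF assms(1) polyfun_regular[OF polyfun_const[of "-1"]] assms(3)]]
  by simp

lemma regular_on_const: "regular_on U (\<lambda>u. c)" and regular_on_coord: "regular_on U (\<lambda>u. u $ i)"
  by (rule polyfun_regular, rule polyfun.intros)+

lemmas regular_on_intros = regular_on_add regular_on_diff regular_on_mult regular_on_const
  regular_on_coord regular_on_partial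

lemma regular_on_fr:
  assumes "open U" "regular_on U f"
  shows "regular_on U (fr0 f)" "regular_on U (fr1 f)" "regular_on U (fr2 f)" "regular_on U (fr3 f)"
    "regular_on U (frT f)"
  unfolding fr_defs[abs_def] by (intro regular_on_intros assms)+

lemma has_partial_cmult: "has_partial i f d u \<Longrightarrow> has_partial i (\<lambda>u. c * f u) (c * d) u"
  using has_partial_mult[OF has_partial_const] by fastforce

lemma partial_fr:
  assumes "regular_on U f" "u \<in> U"
  shows "partial i (fr0 f) u = partial i (partial Cx f) u + ((if i = Cp then 1 else 0) * partial Cz f u
      + u $ Cp * partial i (partial Cz f) u) - 4/3 * partial i (partial Cp f) u"
    and "partial i (fr1 f) u = 4 * partial i (partial Cq f) u"
    and "partial i (fr2 f) u = 2 * (partial i (partial Cy f) u + ((if i = Cq then 1 else 0) * partial Cz f u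
      + u $ Cq * partial i (partial Cz f) u))"
    and "partial i (fr3 f) u = 2 * (partial i (partial Cx f) u + ((if i = Cp then 1 else 0) * partial Cz f u
      + u $ Cp * partial i (partial Cz f) u))"
    and "partial i (frT f) u = - (8/3) * partial i (partial Cz f) u"
  unfolding fr_defs[abs_def]
  by (rule has_partial_imp_partial;
      intro has_partial_add has_partial_diff has_partial_mult has_partial_cmult has_partial_coord
        regular_on_has_partial[OF regular_on_partial[OF assms(1)] assms(2)])+

text \<open>Second partial derivatives are brought into one order of the coordinates, each pair
  being commuted in one direction only so that rewriting terminates. What remains are the
  derivatives of the coefficients \<open>p\<close> and \<open>q\<close> of the frame.\<close>

lemma fr_commute:
  assumes U: "open U" and f: "regular_on U f" and u: "u \<in> U"
  shows "fr1 (fr0 f) u = fr0 (fr1 f) u" "fr2 (fr0 f) u = fr0 (fr2 f) u"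
    "fr3 (fr0 f) u = fr0 (fr3 f) u - frT f u" "fr2 (fr1 f) u = fr1 (fr2 f) u + 3 * frT f u"
    "fr3 (fr1 f) u = fr1 (fr3 f) u" "fr3 (fr2 f) u = fr2 (fr3 f) u"
    "fr0 (frT f) u = frT (fr0 f) u" "fr1 (frT f) u = frT (fr1 f) u" "fr2 (frT f) u = frT (fr2 f) u"
    "fr3 (frT f) u = frT (fr3 f) u"
  by (simp_all add: fr0_def[of "fr1 f"] fr0_def[of "fr2 f"] fr0_def[of "fr3 f"] fr0_def[of "frT f"]
      fr1_def[of "fr0 f"] fr1_def[of "fr2 f"] fr1_def[of "fr3 f"] fr1_def[of "frT f"]
      fr2_def[of "fr0 f"] fr2_def[of "fr1 f"] fr2_def[of "fr3 f"] fr2_def[of "frT f"]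
      fr3_def[of "fr0 f"] fr3_def[of "fr1 f"] fr3_def[of "fr2 f"] fr3_def[of "frT f"]
      frT_def partial_fr[OF f u] partial_commute[OF U u f, of Cy Cx] partial_commute[OF U u f, of Cz Cx]
      partial_commute[OF U u f, of Cp Cx] partial_commute[OF U u f, of Cq Cx]
      partial_commute[OF U u f, of Cz Cy] partial_commute[OF U u f, of Cp Cy]
      partial_commute[OF U u f, of Cq Cy] partial_commute[OF U u f, of Cp Cz]
      partial_commute[OF U u f, of Cq Cz] partial_commute[OF U u f, of Cq Cp] algebra_simps)

section \<open>The Lie derivative of the structural tensor on contact planes\<close>

definition nabla :: "('k ^ coord \<Rightarrow> 'k ^ coord) \<Rightarrow> 'k ^ coord \<Rightarrow> 'k ^ coord \<Rightarrow> 'k::real_normed_field ^ coord" where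
  "nabla X u v = (\<chi> m. \<Sum>i\<in>UNIV. partial i (\<lambda>u'. X u' $ m) u * v $ i)"

lemma tdiag_lie_Upsilon: "tdiag 4 (lie_deriv X Upsilon) u v = 1024 * discT_deriv v (nabla X u v)"
proof -
  have "tdiag (Suc 3) (lie_deriv X Upsilon) u v = of_nat (Suc 3) *
      (\<Sum>m\<in>UNIV. (\<Sum>i\<in>UNIV. partial i (\<lambda>u'. X u' $ m) u * v $ i) * tdiag 3 (\<lambda>u J. Upsilon u (m # J)) u v)"
    by (rule tdiag_lie_deriv[OF Upsilon_const]) (simp add: symmetric_form_Upsilon)
  then show ?thesis
    using polar_Upsilon[of "nabla X u v" u v] by (simp add: nabla_def)
qed

text \<open>The pattern \<open>- 3, 1, - 1, 3\<close>, pairing index 0 with 3 and 1 with 2, is that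
  of the inverse of the differential of \<open>contact_form\<close> on contact planes, which is 8/3
  times \<open>th0 wedge th3 - 3 th1 wedge th2\<close>. The common 1/8 is kept apart so that it can
  be scaled out.\<close>

lemma nabla_hamiltonian:
  assumes U: "open U" and f: "regular_on U f" and X: "hamiltonian_on U X f" and u: "u \<in> U"
  defines "\<delta> \<equiv> \<lambda>g v. \<Sum>i\<in>UNIV. partial i g u * v $ i"
  shows "cof 0 (nabla X u v) = 1/8 * (- 3 * \<delta> (fr3 f) v)" "cof (Suc 0) (nabla X u v) = 1/8 * \<delta> (fr2 f) v"
    "cof 2 (nabla X u v) = 1/8 * (- \<delta> (fr1 f) v)" "cof 3 (nabla X u v) = 1/8 * (3 * \<delta> (fr0 f) v)"
proof -
  note hp = regular_on_has_partial[OF regular_on_fr(1)[OF U f] u] regular_on_has_partial[OF regular_on_fr(2)[OF U f] u]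
    regular_on_has_partial[OF regular_on_fr(3)[OF U f] u] regular_on_has_partial[OF regular_on_fr(4)[OF U f] u]
  have p: "partial i (\<lambda>u. X u $ Cx) u = 3/4 * partial i (fr0 f) u - 3/8 * partial i (fr3 f) u"
    "partial i (\<lambda>u. X u $ Cy) u = - (1/4) * partial i (fr1 f) u"
    "partial i (\<lambda>u. X u $ Cp) u = 1/2 * partial i (fr3 f) u"
    "partial i (\<lambda>u. X u $ Cq) u = 1/2 * partial i (fr2 f) u" for i
  proof -
    have c: "partial i g u = d" if "has_partial i g' d u" "\<And>v. v \<in> U \<Longrightarrow> g v = g' v" for g g' d
      using partial_cong[OF U u that(2)] has_partial_imp_partial[OF that(1)] by simp
    show "partial i (\<lambda>u. X u $ Cx) u = 3/4 * partial i (fr0 f) u - 3/8 * partial i (fr3 f) u"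
      by (rule c[OF has_partial_diff[OF has_partial_cmult has_partial_cmult]])
         (use hp X in \<open>auto simp: hamiltonian_on_def\<close>)
    show "partial i (\<lambda>u. X u $ Cy) u = - (1/4) * partial i (fr1 f) u"
      by (rule c[OF has_partial_cmult]) (use hp X in \<open>auto simp: hamiltonian_on_def\<close>)
    show "partial i (\<lambda>u. X u $ Cp) u = 1/2 * partial i (fr3 f) u"
      by (rule c[OF has_partial_cmult]) (use hp X in \<open>auto simp: hamiltonian_on_def\<close>)
    show "partial i (\<lambda>u. X u $ Cq) u = 1/2 * partial i (fr2 f) u"
      by (rule c[OF has_partial_cmult]) (use hp X in \<open>auto simp: hamiltonian_on_def\<close>)
  qed
  show "cof 0 (nabla X u v) = 1/8 * (- 3 * \<delta> (fr3 f) v)" "cof (Suc 0) (nabla X u v) = 1/8 * \<delta> (fr2 f) v"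
    "cof 2 (nabla X u v) = 1/8 * (- \<delta> (fr1 f) v)" "cof 3 (nabla X u v) = 1/8 * (3 * \<delta> (fr0 f) v)"
    by (simp_all add: cof_simps nabla_def \<delta>_def p sum_coord field_simps)
qed

lemma disc_deriv_scale:
  "disc_deriv a b c d (s * a') (s * b') (s * c') (s * d') = s * disc_deriv a b c d a' b' c' d'"
  by (simp add: disc_deriv_def algebra_simps)

text \<open>Along a contact vector the Jacobian of a contact field consists of second frame
  derivatives of \<open>f\<close>, so the symmetry condition becomes algebraic in them. The right
  hand side has the shape that \<open>alg_forward\<close> and \<open>alg_backward\<close>
  expect.\<close>

lemma lie_Upsilon_contact_vec:
  fixes a b c d :: "'k::real_normed_field"
  assumes U: "open U" and f: "regular_on U f" and X: "hamiltonian_on U X f" and u: "u \<in> U"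
  defines "v \<equiv> contact_vec u a b c d"
  shows "8 * discT_deriv v (nabla X u v) = disc_deriv a b c d
      (- 3 * (a * fr0 (fr3 f) u + b * fr1 (fr3 f) u + c * fr2 (fr3 f) u + d * fr3 (fr3 f) u))
      (a * fr0 (fr2 f) u + b * fr1 (fr2 f) u + c * fr2 (fr2 f) u + d * fr2 (fr3 f) u)
      (- (a * fr0 (fr1 f) u + b * fr1 (fr1 f) u + c * (fr1 (fr2 f) u + 3 * frT f u) + d * fr1 (fr3 f) u))
      (3 * (a * fr0 (fr0 f) u + b * fr0 (fr1 f) u + c * fr0 (fr2 f) u + d * (fr0 (fr3 f) u - frT f u)))"
  unfolding discT_deriv_def nabla_hamiltonian[OF U f X u] disc_deriv_scale
  unfolding v_def cof_contact_vec derivative_along_contact_vec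
  by (simp add: fr_commute[OF U f u])

definition symmetry_equations :: "('k ^ coord) set \<Rightarrow> ('k::real_normed_field ^ coord \<Rightarrow> 'k) \<Rightarrow> bool" where
  "symmetry_equations U f \<longleftrightarrow> (\<forall>u\<in>U. fr0 (fr0 f) u = 0 \<and> fr0 (fr1 f) u = 0 \<and>
     fr1 (fr1 f) u = - 2 * fr0 (fr2 f) u \<and> fr1 (fr2 f) u = - fr0 (fr3 f) u - frT f u \<and>
     fr2 (fr2 f) u = - 2 * fr1 (fr3 f) u \<and> fr2 (fr3 f) u = 0 \<and> fr3 (fr3 f) u = 0)"

text \<open>Cartan's formula: the differential of \<open>f\<close> plus the contraction of
  \<open>X\<close> with \<open>dx wedge dp + dy wedge dq\<close>, where \<open>f\<close> is the
  value of the contact form on \<open>X\<close>.\<close>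

lemma lie_contact:
  assumes X: "\<And>m. regular_on U (\<lambda>u. X u $ m)" and u: "u \<in> U"
    and f: "f = (\<lambda>u. X u $ Cz - u $ Cp * X u $ Cx - u $ Cq * X u $ Cy)"
  shows "lie_deriv X contact_form u [i] = partial i f u + (if i = Cp then X u $ Cx else 0)
    + (if i = Cq then X u $ Cy else 0) - (if i = Cx then X u $ Cp else 0) - (if i = Cy then X u $ Cq else 0)"
proof -
  have "has_partial j f (partial j (\<lambda>u. X u $ Cz) u
      - ((if j = Cp then 1 else 0) * X u $ Cx + u $ Cp * partial j (\<lambda>u. X u $ Cx) u)
      - ((if j = Cq then 1 else 0) * X u $ Cy + u $ Cq * partial j (\<lambda>u. X u $ Cy) u)) u" for j
    unfolding f by (intro has_partial_diff has_partial_mult has_partial_coord regular_on_has_partial[OF X u])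
  note pf = has_partial_imp_partial[OF this]
  have w: "(\<lambda>u'. contact_form u' [j]) = (\<lambda>u'::'a ^ coord. if j = Cz then 1 else if j = Cx then - u' $ Cp
      else if j = Cy then - u' $ Cq else 0)" for j
    by (cases j) (auto simp: contact_form_def dcoord_def)
  have pw: "partial m (\<lambda>u'. contact_form u' [j]) u =
      (if j = Cx \<and> m = Cp \<or> j = Cy \<and> m = Cq then - 1 else 0)" for m j
    by (cases j) (auto simp: w partial_minus polyfun_coord)
  have cw: "contact_form u [j] = (if j = Cz then 1 else if j = Cx then - u $ Cp
      else if j = Cy then - u $ Cq else 0)" for j
    using fun_cong[OF w, of u j] .
  show ?thesis
    by (cases i) (simp_all add: lie_deriv_def pw cw pf sum_coord)
qed

text \<open>On contact vectors the term with \<open>\<sigma>\<close> disappears and the quartic form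
  is preserved up to a factor, which is the hypothesis of \<open>alg_forward\<close>.\<close>

lemma symmetry_imp_hamiltonian:
  fixes X :: "'k::real_normed_field ^ coord \<Rightarrow> 'k ^ coord"
  assumes U: "open U" and X: "\<And>m. regular_on U (\<lambda>u. X u $ m)"
    and w: "\<And>u i. u \<in> U \<Longrightarrow> lie_deriv X contact_form u [i] = lam u * contact_form u [i]"
    and Y: "\<And>u I. u \<in> U \<Longrightarrow> length I = 4 \<Longrightarrow>
      lie_deriv X Upsilon u I = \<phi> u * Upsilon u I + (contact_form \<odot> \<sigma>) u I"
    and f: "f = (\<lambda>u. X u $ Cz - u $ Cp * X u $ Cx - u $ Cq * X u $ Cy)"
  shows "regular_on U f" "hamiltonian_on U X f" "symmetry_equations U f"
proof -
  show reg: "regular_on U f"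
    unfolding f by (intro regular_on_intros X U)
  show ham: "hamiltonian_on U X f"
    unfolding hamiltonian_on_def
  proof
    fix u assume u: "u \<in> U"
    have e: "partial i f u + (if i = Cp then X u $ Cx else 0)
      + (if i = Cq then X u $ Cy else 0) - (if i = Cx then X u $ Cp else 0) - (if i = Cy then X u $ Cq else 0)
      = lam u * contact_form u [i]" for i
      using lie_contact[OF X u f] w[OF u] by metis
    \<comment> \<open>The five components of Cartan's formula: \<open>Cz\<close> identifies the
      multiplier, the other four determine \<open>X\<close>.\<close>
    have "partial Cz f u = lam u" "partial Cp f u = - X u $ Cx" "partial Cq f u = - X u $ Cy"
      "partial Cx f u - X u $ Cp = - lam u * u $ Cp" "partial Cy f u - X u $ Cq = - lam u * u $ Cq"
      using e[of Cz] e[of Cp] e[of Cq] e[of Cx] e[of Cy]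
      by (simp_all add: contact_form_def dcoord_def eq_neg_iff_add_eq_0)
    then show "X u $ Cx = 3/4 * fr0 f u - 3/8 * fr3 f u \<and> X u $ Cy = - (1/4) * fr1 f u \<and>
     X u $ Cz = f u + u $ Cp * X u $ Cx + u $ Cq * X u $ Cy \<and>
     X u $ Cp = 1/2 * fr3 f u \<and> X u $ Cq = 1/2 * fr2 f u"
      by (simp add: fr_defs f[THEN fun_cong] algebra_simps)
  qed
  show "symmetry_equations U f"
    unfolding symmetry_equations_def
  proof
    fix u assume u: "u \<in> U"
    have "8 * discT_deriv v (nabla X u v) = (8 * \<phi> u) * discT v" if "form1 contact_form u v = 0" for v
    proof -
      have "tdiag 4 (lie_deriv X Upsilon) u v =
          (\<Sum>I\<in>lists_of 4. (\<phi> u * Upsilon u I + (contact_form \<odot> \<sigma>) u I) * weight v I)"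
        unfolding tdiag_eq using Y[OF u] by (intro sum.cong refl) simp
      also have "\<dots> = \<phi> u * tdiag 4 Upsilon u v + tdiag (Suc 3) (contact_form \<odot> \<sigma>) u v"
        by (simp add: tdiag_eq distrib_right sum.distrib sum_distrib_left mult.assoc)
      also have "\<dots> = \<phi> u * tdiag 4 Upsilon u v"
        unfolding tdiag_sprod that by simp
      finally show ?thesis
        unfolding tdiag_lie_Upsilon tdiag_Upsilon by simp
    qed
    note id = this[OF form1_contact_vec, unfolded lie_Upsilon_contact_vec[OF U reg ham u] discT_def cof_contact_vec]
    show "fr0 (fr0 f) u = 0 \<and> fr0 (fr1 f) u = 0 \<and>
     fr1 (fr1 f) u = - 2 * fr0 (fr2 f) u \<and> fr1 (fr2 f) u = - fr0 (fr3 f) u - frT f u \<and>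
     fr2 (fr2 f) u = - 2 * fr1 (fr3 f) u \<and> fr2 (fr3 f) u = 0 \<and> fr3 (fr3 f) u = 0"
      by (intro conjI alg_forward[OF id])
  qed
qed

text \<open>Off the contact plane \<open>v\<close> is split into a contact vector \<open>v'\<close>
  and \<open>c\<close> times the coordinate vector of \<open>z\<close>. The coframe does not see the
  second part, so the defect of invariance is \<open>c\<close> times a cubic form in
  \<open>v\<close>, the contraction of the tensor with the derivative of the field by
  \<open>z\<close>. This is where \<open>\<sigma>\<close> comes from. Equality of diagonals becomes
  equality of tensors by \<open>polarization\<close>.\<close>

lemma hamiltonian_imp_symmetry:
  fixes P :: "'k::real_normed_field ^ coord \<Rightarrow> 'k ^ coord"
  assumes U: "open U" and R: "\<And>h. polyfun h \<Longrightarrow> R U h" "\<And>h h'. (\<And>v. v \<in> U \<Longrightarrow> h v = h' v) \<Longrightarrow> R U h \<Longrightarrow> R U h'"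
    and P: "\<And>m. polyfun (\<lambda>u. P u $ m)" and f: "polyfun f"
    and ham: "hamiltonian_on U P f" and eqs: "symmetry_equations U f"
  shows "restrict_vf U P \<in> symmetry_algebra R U contact_form Upsilon"
proof -
  let ?X = "restrict_vf U P"
  have X: "?X u $ m = P u $ m" if "u \<in> U" for u m
    using that by (simp add: restrict_vf_def)
  have pX: "partial i (\<lambda>u. ?X u $ m) u = partial i (\<lambda>u. P u $ m) u" if "u \<in> U" for i m u
    by (rule partial_cong[OF U that]) (rule X)
  have lieX: "lie_deriv ?X T u I = lie_deriv P T u I" if "u \<in> U" for T u I
    unfolding lie_deriv_def by (simp only: pX[OF that] X[OF that])
  have comps: "R U (\<lambda>u. ?X u $ m)" for m
    using R(2)[OF _ R(1)[OF P]] X by metis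
  define lam where "lam = partial Cz f"
  have lam: "polyfun lam" using polyfun_partial[OF f] by (simp add: lam_def)
  have contact: "lie_deriv ?X contact_form u [i] = lam u * contact_form u [i]" if u: "u \<in> U" for u i
  proof -
    let ?f = "\<lambda>u. P u $ Cz - u $ Cp * P u $ Cx - u $ Cq * P u $ Cy"
    have "partial i ?f u = partial i f u"
      by (rule partial_cong[OF U u]) (use ham in \<open>simp add: hamiltonian_on_def\<close>)
    then have eq: "lie_deriv P contact_form u [i] = partial i f u + (if i = Cp then P u $ Cx else 0)
      + (if i = Cq then P u $ Cy else 0) - (if i = Cx then P u $ Cp else 0) - (if i = Cy then P u $ Cq else 0)"
      using lie_contact[of U P u ?f i, OF polyfun_regular[OF P] u refl] by simp
    show ?thesis
      unfolding lieX[OF u] eq using ham[unfolded hamiltonian_on_def, rule_format, OF u]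
      by (cases i) (simp_all add: fr_defs lam_def contact_form_def dcoord_def algebra_simps)
  qed
  \<comment> \<open>The factor - 6 of \<open>alg_backward\<close> over the 8 of
    \<open>lie_Upsilon_contact_vec\<close>.\<close>
  define \<phi> where "\<phi> u = - (3/4) * frT f u" for u
  have \<phi>: "polyfun \<phi>"
    unfolding \<phi>_def[abs_def] frT_def using polyfun_partial[OF f] by (intro polyfun_intros) auto
  define Z where "Z u = (\<chi> m. partial Cz (\<lambda>u. P u $ m) u)" for u
  define \<sigma> where "\<sigma> u J = (\<Sum>m\<in>UNIV. (4 * Z u $ m) * Upsilon u (m # J))" for u J
  have \<sigma>: "polyfun (\<lambda>u. \<sigma> u J)" for J
  proof -
    have "\<sigma> u J = (\<Sum>m\<in>UNIV. (4 * partial Cz (\<lambda>u. P u $ m) u) * Upsilon 0 (m # J))" for u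
      using Upsilon_const[of u] by (simp add: \<sigma>_def Z_def)
    then have "(\<lambda>u. \<sigma> u J) = (\<lambda>u. \<Sum>m\<in>UNIV. (4 * partial Cz (\<lambda>u. P u $ m) u) * Upsilon 0 (m # J))"
      by (rule ext)
    then show ?thesis
      using polyfun_partial[OF P] by (simp only:) (intro polyfun_sum polyfun_mult polyfun_const, blast)
  qed
  have "symmetric_form (Suc 3) (Upsilon u)" for u :: "'k ^ coord"
    using symmetric_form_Upsilon by simp
  note symU = symmetric_form_Cons[OF this]
  have sym\<sigma>: "symmetric_form 3 (\<sigma> u)" for u
    unfolding symmetric_form_def \<sigma>_def
    using symU unfolding symmetric_form_def by (intro allI impI sum.cong refl arg_cong2[where f="(*)"]) blast
  have Y: "lie_deriv ?X Upsilon u I = \<phi> u * Upsilon u I + (contact_form \<odot> \<sigma>) u I"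
    if u: "u \<in> U" and I: "length I = 4" for u I
  proof -
    have four: "4 = Suc 3" by simp
    let ?T = "\<lambda>u I. lie_deriv P Upsilon u I - (\<phi> u * Upsilon u I + (contact_form \<odot> \<sigma>) u I)"
    have "?T u I = 0"
    proof (rule polarization[of 4 ?T u I, OF _ _ I])
      have sym1: "symmetric_form 4 (lie_deriv P Upsilon u)"
        by (rule symmetric_form_lie_deriv[OF Upsilon_const symmetric_form_Upsilon])
      have sym2: "symmetric_form 4 ((contact_form \<odot> \<sigma>) u)"
        unfolding four by (rule symmetric_form_sprod[OF sym\<sigma>])
      show "symmetric_form 4 (?T u)"
        unfolding symmetric_form_def
      proof (intro allI impI)
        fix I J :: "coord list" assume IJ: "length I = 4" "mset I = mset J"
        show "?T u I = ?T u J"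
          using sym1[unfolded symmetric_form_def, rule_format, OF IJ]
            sym2[unfolded symmetric_form_def, rule_format, OF IJ]
            symmetric_form_Upsilon[unfolded symmetric_form_def, rule_format, OF IJ, of u]
          by (simp only:)
      qed
      fix v
      define c where "c = form1 contact_form u v"
      define v' where "v' = v - c *s axis Cz 1"
      have "form1 contact_form u v' = 0"
        by (simp add: form1_contact v'_def c_def axis_def)
      note v'_eq = contact_vec_cof[OF this]
      have cof: "cof k v' = cof k v" if "k \<in> {0, Suc 0, 2, 3}" for k
        using that by (auto simp: cof_simps v'_def axis_def)
      have "8 * discT_deriv v' (nabla P u v') = - 6 * frT f u * discT v'"
        using lie_Upsilon_contact_vec[OF U polyfun_regular[OF f] ham u, of "cof 0 v'" "cof (Suc 0) v'" "cof 2 v'" "cof 3 v'"]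
        unfolding v'_eq discT_def
        using eqs u by (subst (asm) alg_backward) (auto simp: symmetry_equations_def)
      then have "discT_deriv v' (nabla P u v') = \<phi> u * discT v'"
        by (simp add: \<phi>_def field_simps)
      then have dv: "discT_deriv v (nabla P u v') = \<phi> u * discT v"
        by (simp add: discT_deriv_def discT_def cof)
      have nab: "nabla P u v = nabla P u v' + c *s Z u"
        by (simp add: vec_eq_iff nabla_def v'_def Z_def sum_coord axis_def algebra_simps)
      have "discT_deriv v (w + c *s w') = discT_deriv v w + c * discT_deriv v w'" for w w'
      proof -
        have "cof k (w + c *s w') = cof k w + c * cof k w'" if "k \<in> {0, Suc 0, 2, 3}" for k
          using that by (auto simp: cof_simps algebra_simps)
        then show ?thesis by (simp add: discT_deriv_def disc_deriv_def algebra_simps)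
      qed
      then have "tdiag 4 (lie_deriv P Upsilon) u v = 1024 * (\<phi> u * discT v + c * discT_deriv v (Z u))"
        unfolding tdiag_lie_Upsilon nab by (simp add: dv)
      moreover have "tdiag 3 \<sigma> u v = 1024 * discT_deriv v (Z u)"
        using polar_Upsilon[of "Z u" u v]
        by (simp add: \<sigma>_def[abs_def] tdiag_linear sum_distrib_left mult.assoc)
      moreover have "tdiag 4 ?T u v = tdiag 4 (lie_deriv P Upsilon) u v
          - (\<phi> u * tdiag 4 Upsilon u v + tdiag (Suc 3) (contact_form \<odot> \<sigma>) u v)"
        by (simp add: tdiag_linear)
      ultimately show "tdiag 4 ?T u v = 0"
        unfolding tdiag_sprod tdiag_Upsilon c_def[symmetric] by (simp add: algebra_simps)
    qed
    then show ?thesis by (simp add: lieX[OF u])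
  qed
  have "symmetric_tensor_on U 3 \<sigma>"
    using sym\<sigma> by (simp add: symmetric_tensor_on_def symmetric_form_def)
  then have "\<exists>\<phi> \<sigma>. R U \<phi> \<and> (\<forall>I. length I = 3 \<longrightarrow> R U (\<lambda>u. \<sigma> u I)) \<and> symmetric_tensor_on U 3 \<sigma> \<and>
      (\<forall>u\<in>U. \<forall>I. length I = 4 \<longrightarrow> lie_deriv ?X Upsilon u I = \<phi> u * Upsilon u I + (contact_form \<odot> \<sigma>) u I)"
    using R(1)[OF \<phi>] R(1)[OF \<sigma>] Y by (intro exI[of _ \<phi>] exI[of _ \<sigma>]) simp
  moreover have "\<exists>lam. R U lam \<and> (\<forall>u\<in>U. \<forall>i. lie_deriv ?X contact_form u [i] = lam u * contact_form u [i])"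
    using R(1)[OF lam] contact by (intro exI[of _ lam]) simp
  moreover have "\<forall>u. u \<notin> U \<longrightarrow> ?X u = 0" by (simp add: restrict_vf_def)
  ultimately show ?thesis
    unfolding symmetry_algebra_def mem_Collect_eq by (intro conjI allI[OF comps])
qed

section \<open>Brackets of the fourteen fields\<close>

lemma polyfun_divide: "polyfun f \<Longrightarrow> polyfun (\<lambda>u. f u / c)"
  using polyfun_mult[OF _ polyfun_const[of "1 / c"], of f] by simp

lemma partial_divide: "polyfun f \<Longrightarrow> partial i (\<lambda>u. f u / c) u = partial i f u / c"
  using partial_mult[OF _ polyfun_const[of "1 / c"], of f i u] by simp

lemmas poly_partial = partial_simps partial_divide polyfun_intros polyfun_divide

text \<open>The bracket on the whole space, so that the multiplication table is independent of
  \<open>U\<close>; \<open>vf_bracket_restrict\<close> brings it to \<open>U\<close>.\<close>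

definition bracket :: "('k ^ coord \<Rightarrow> 'k ^ coord) \<Rightarrow> ('k ^ coord \<Rightarrow> 'k ^ coord) \<Rightarrow> 'k ^ coord \<Rightarrow> 'k::real_normed_field ^ coord" where
  "bracket X Y u = (\<chi> i. \<Sum>m\<in>UNIV. X u $ m * partial m (\<lambda>u'. Y u' $ i) u - Y u $ m * partial m (\<lambda>u'. X u' $ i) u)"

text \<open>\<open>h2\<close> freed of its factor \<open>sqrt 3 / 2\<close>, which keeps all
  structure constants rational.\<close>

definition E_field :: "'k ^ coord \<Rightarrow> 'k::real_normed_field ^ coord" where
  "E_field = in_coords (\<lambda>x y z p q. vec5 x y (2 * z) p q)"

lemmas field_defs = S1_def L2_def S3_def L4_def S5_def L6_def S7_def L8_def S9_def L10_def S11_def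
  L12_def h1_def E_field_def in_coords_def

lemma coord_all: "(\<forall>i. P i) \<longleftrightarrow> P Cx \<and> P Cy \<and> P Cz \<and> P Cp \<and> P Cq"
  by (metis coord.exhaust)

lemmas bracket_unfold = fun_eq_iff zero_fun_def plus_fun_def vf_scale_def bracket_def field_defs
  vec_eq_iff coord_all sum_coord poly_partial

text \<open>Each of these tables lists the brackets with the fields that come later in the list; the
  rest follows by anticommutativity.\<close>

lemma bracket_S1: "map (bracket S1) [L2, S3, L4, S5, L6, S7, L8, S9, L10, S11, L12, h1, E_field] =
    [0, vf_scale (3/4) L2, 0, vf_scale (- 1) S3, vf_scale (3/2) S5,
      vf_scale (1/2) h1 + vf_scale (3/4) E_field, vf_scale (1/2) S9, vf_scale (- 1/2) S11, 0,
      vf_scale (- 3/2) L12, 0, vf_scale (- 1/2) S1, vf_scale (- 1) S1]"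
  by (simp add: bracket_unfold; simp add: field_simps power2_eq_square power3_eq_cube eval_nat_numeral)

lemma bracket_L2: "map (bracket L2) [S3, L4, S5, L6, S7, L8, S9, L10, S11, L12, h1, E_field] =
    [0, 0, 0, vf_scale 1 L4, vf_scale (- 2) S3, vf_scale 1 h1 + vf_scale (1/2) E_field,
      vf_scale (- 2) S1, vf_scale (- 1) L12, 0, 0, vf_scale (- 3/2) L2, vf_scale (- 1) L2]"
  by (simp add: bracket_unfold; simp add: field_simps power2_eq_square power3_eq_cube eval_nat_numeral)

lemma bracket_S3: "map (bracket S3) [L4, S5, L6, S7, L8, S9, L10, S11, L12, h1, E_field] =
    [0, vf_scale (- 1/2) L4, 0, vf_scale 2 S5, vf_scale (1/2) S7, vf_scale (- 1) h1,
      vf_scale (1/2) S11, vf_scale (- 4) S1, 0, vf_scale (- 1) S3, 0]"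
  by (simp add: bracket_unfold; simp add: field_simps power2_eq_square power3_eq_cube eval_nat_numeral)

lemma bracket_L4: "map (bracket L4) [S5, L6, S7, L8, S9, L10, S11, L12, h1, E_field] =
    [0, 0, 0, vf_scale (- 1) L6, vf_scale (- 3) S5, vf_scale 3 h1 + vf_scale (- 3/2) E_field,
      vf_scale (- 6) S3, vf_scale 3 L2, vf_scale (- 3/2) L4, vf_scale 1 L4]"
  by (simp add: bracket_unfold; simp add: field_simps power2_eq_square power3_eq_cube eval_nat_numeral)

lemma bracket_S5: "map (bracket S5) [L6, S7, L8, S9, L10, S11, L12, h1, E_field] =
    [0, vf_scale (- 1) L6, 0, vf_scale 1 S7, vf_scale 1 S9,
      vf_scale 1 h1 + vf_scale (- 3/2) E_field, vf_scale 2 S1, vf_scale (- 1/2) S5, vf_scale 1 S5]"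
  by (simp add: bracket_unfold; simp add: field_simps power2_eq_square power3_eq_cube eval_nat_numeral)

lemma bracket_L6: "map (bracket L6) [S7, L8, S9, L10, S11, L12, h1, E_field] =
    [0, 0, 0, vf_scale 3 L8, vf_scale 3 S7, vf_scale (- 3) E_field, 0, vf_scale 2 L6]"
  by (simp add: bracket_unfold; simp add: field_simps power2_eq_square power3_eq_cube eval_nat_numeral)

lemma bracket_S7: "map (bracket S7) [L8, S9, L10, S11, L12, h1, E_field] =
    [0, vf_scale 3 L8, 0, vf_scale (- 4) S9, vf_scale (- 1) S11, vf_scale (1/2) S7, vf_scale 1 S7]"
  by (simp add: bracket_unfold; simp add: field_simps power2_eq_square power3_eq_cube eval_nat_numeral)

lemma bracket_L8: "map (bracket L8) [S9, L10, S11, L12, h1, E_field] =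
    [0, 0, 0, vf_scale (- 1) L10, vf_scale (3/2) L8, vf_scale 1 L8]"
  by (simp add: bracket_unfold; simp add: field_simps power2_eq_square power3_eq_cube eval_nat_numeral)

lemma bracket_S9: "map (bracket S9) [L10, S11, L12, h1, E_field] =
    [0, vf_scale (- 3) L10, 0, vf_scale 1 S9, 0]"
  by (simp add: bracket_unfold; simp add: field_simps power2_eq_square power3_eq_cube eval_nat_numeral)

lemma bracket_L10: "map (bracket L10) [S11, L12, h1, E_field] =
    [0, 0, vf_scale (3/2) L10, vf_scale (- 1) L10]"
  by (simp add: bracket_unfold; simp add: field_simps power2_eq_square power3_eq_cube eval_nat_numeral)

lemma bracket_S11: "map (bracket S11) [L12, h1, E_field] =
    [0, vf_scale (1/2) S11, vf_scale (- 1) S11]"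
  by (simp add: bracket_unfold; simp add: field_simps power2_eq_square power3_eq_cube eval_nat_numeral)

lemma bracket_L12: "map (bracket L12) [h1, E_field] =
    [0, vf_scale (- 2) L12]"
  by (simp add: bracket_unfold; simp add: field_simps power2_eq_square power3_eq_cube eval_nat_numeral)

lemma bracket_h1: "map (bracket h1) [E_field] =
    [0]"
  by (simp add: bracket_unfold; simp add: field_simps power2_eq_square power3_eq_cube eval_nat_numeral)


       text \<open>Each field with its contact Hamiltonian, in an order that makes the
         \<open>k\<close>-th Hamiltonian have its first nonzero jet component at place
         \<open>k\<close>.\<close>

       definition generators :: "(('k ^ coord \<Rightarrow> 'k ^ coord) \<times> ('k ^ coord \<Rightarrow> 'k::real_normed_field)) list" where
  "generators = [
     (L12, \<lambda>u. 9/8*u$Cx*u$Cp^3 + 1/6*u$Cx*u$Cq^3 + 1/8*u$Cp*u$Cq^3 + 27/64*u$Cp^4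
        + 3*u$Cx*u$Cz*u$Cp + 3*u$Cy*u$Cz*u$Cq + 9/8*u$Cy*u$Cp^2*u$Cq - 3*u$Cz^2 - u$Cy^2*u$Cq^2
        - 2*u$Cy^3*u$Cp),
     (L10, \<lambda>u. - (9/8*u$Cp^3) - 1/6*u$Cq^3 - 3*u$Cz*u$Cp),
     (S11, \<lambda>u. 2*u$Cy*u$Cq^2 + 6*u$Cy^2*u$Cp - 3*u$Cz*u$Cq - 9/8*u$Cp^2*u$Cq),
     (S1, \<lambda>u. 9/16*u$Cy*u$Cp^2 + 1/4*u$Cx*u$Cq^2 + 3/16*u$Cp*u$Cq^2 + 3/2*u$Cx*u$Cy*u$Cp
        + 1/2*u$Cy^2*u$Cq - 3/2*u$Cy*u$Cz),
     (L2, \<lambda>u. 9/8*u$Cx*u$Cp^2 + 9/32*u$Cp^3 + u$Cx^2*u$Cp + 3/4*u$Cy*u$Cp*u$Cq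
        + u$Cx*u$Cy*u$Cq - u$Cx*u$Cz - 2/3*u$Cy^3 - 3/4*u$Cz*u$Cp),
     (E_field, \<lambda>u. 2*u$Cz - u$Cx*u$Cp - u$Cy*u$Cq),
     (S9, \<lambda>u. - (1/2*u$Cq^2) - 3*u$Cy*u$Cp),
     (h1, \<lambda>u. - (9/8*u$Cp^2) - 3/2*u$Cx*u$Cp - 1/2*u$Cy*u$Cq),
     (S3, \<lambda>u. 3/8*u$Cp*u$Cq + 1/2*u$Cx*u$Cq - u$Cy^2),
     (L8, \<lambda>u. - (u$Cp)),
     (S7, \<lambda>u. - (u$Cq)),
     (S5, \<lambda>u. u$Cy),
     (L4, \<lambda>u. u$Cx + 3/4*u$Cp),
     (L6, \<lambda>u. 1)]"

lemma length_generators [simp]: "length generators = 14"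
  by (simp add: generators_def)

lemma generators_regular:
  assumes "(X, f) \<in> set generators"
  shows "polyfun f" "hamiltonian_on U X f" "symmetry_equations U f"
proof -
  have "list_all (\<lambda>(X, f). polyfun f \<and> hamiltonian_on U X f \<and> symmetry_equations U f) generators"
    by (simp add: generators_def hamiltonian_on_def symmetry_equations_def field_defs fr_defs[abs_def] poly_partial;
        simp add: field_simps power2_eq_square power3_eq_cube eval_nat_numeral)
  then show "polyfun f" "hamiltonian_on U X f" "symmetry_equations U f"
    using assms by (auto simp: list_all_iff)
qed

definition frame_jet :: "('k::real_normed_field ^ coord \<Rightarrow> 'k) \<Rightarrow> 'k ^ coord \<Rightarrow> 'k list" where
  "frame_jet f u = [frT (frT f) u, frT (fr0 f) u, frT (fr1 f) u, frT (fr2 f) u, frT (fr3 f) u, frT f u,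
     fr0 (fr2 f) u, fr0 (fr3 f) u, fr1 (fr3 f) u, fr0 f u, fr1 f u, fr2 f u, fr3 f u, f u]"

text \<open>These are the triangularity hypotheses \<open>tri\<close> and \<open>diag\<close> of
  \<open>solutions_spanned\<close>; the listed constants are the diagonal entries.\<close>

lemma generators_jets:
  "list_all2 (\<lambda>(X, f) (k, c). take (Suc k) (frame_jet f u) = replicate k 0 @ [c]) generators
    (zip [0..<14] [- (128/3), - (32/3), 32, 8, 16/3, - (16/3), 8, 4, 4, 4/3, - 4, 2, 2, 1])"
  by (simp add: generators_def frame_jet_def upt_rec numeral_eq_Suc fr_defs[abs_def] poly_partial;
      simp add: field_simps power2_eq_square power3_eq_cube eval_nat_numeral)

section \<open>The solution space on a connected open set\<close>

definition fun_scale :: "'k::real_normed_field \<Rightarrow> ('k ^ coord \<Rightarrow> 'k) \<Rightarrow> 'k ^ coord \<Rightarrow> 'k" where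
  "fun_scale c f = (\<lambda>u. c * f u)"

definition restrict_fun :: "('k::real_normed_field ^ coord) set \<Rightarrow> ('k ^ coord \<Rightarrow> 'k) \<Rightarrow> 'k ^ coord \<Rightarrow> 'k" where
  "restrict_fun U f = (\<lambda>u. if u \<in> U then f u else 0)"

text \<open>Functions are cut off outside \<open>U\<close>, so that equality on \<open>U\<close> is
  equality of elements; the frame operators are cut off in the same way.\<close>

definition regular_space :: "('k::real_normed_field ^ coord) set \<Rightarrow> ('k ^ coord \<Rightarrow> 'k) set" where
  "regular_space U = {f. regular_on U f \<and> (\<forall>u. u \<notin> U \<longrightarrow> f u = 0)}"

lemma fr_cong:
  assumes "open U" "u \<in> U" "\<And>v. v \<in> U \<Longrightarrow> f v = g v"
  shows "fr0 f u = fr0 g u" "fr1 f u = fr1 g u" "fr2 f u = fr2 g u" "fr3 f u = fr3 g u" "frT f u = frT g u"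
  by (simp_all add: fr_defs partial_cong[OF assms(1,2), of f g] assms(3))

lemma fr_linear:
  assumes "regular_on U f" "regular_on U g" "u \<in> U" "fr \<in> {fr0, fr1, fr2, fr3, frT}"
  shows "fr (\<lambda>u. f u + g u) u = fr f u + fr g u" "fr (\<lambda>u. c * f u) u = c * fr f u"
proof -
  have "partial i (\<lambda>u. f u + g u) u = partial i f u + partial i g u" for i
    by (intro has_partial_imp_partial has_partial_add regular_on_has_partial[of U] assms)
  moreover have "partial i (\<lambda>u. c * f u) u = c * partial i f u" for i
    by (intro has_partial_imp_partial has_partial_cmult regular_on_has_partial[of U] assms)
  ultimately show "fr (\<lambda>u. f u + g u) u = fr f u + fr g u" "fr (\<lambda>u. c * f u) u = c * fr f u"
    using assms(4) by (auto simp: fr_defs algebra_simps)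
qed

lemma vector_space_fun_scale: "vector_space (fun_scale :: 'k::real_normed_field \<Rightarrow> _)"
  by unfold_locales (auto simp: fun_scale_def fun_eq_iff algebra_simps)

lemma restrict_fun_regular:
  assumes "open U" "regular_on U f"
  shows "restrict_fun U f \<in> regular_space U"
  using assms regular_on_cong[of U "restrict_fun U f" f] by (simp add: regular_space_def restrict_fun_def)

lemma contact_frame_fr:
  fixes U :: "('k::real_normed_field ^ coord) set"
  assumes U: "open U" "connected U"
  shows "contact_frame fun_scale (regular_space U)
    (\<lambda>f. restrict_fun U (fr0 f)) (\<lambda>f. restrict_fun U (fr1 f)) (\<lambda>f. restrict_fun U (fr2 f))
    (\<lambda>f. restrict_fun U (fr3 f)) (\<lambda>f. restrict_fun U (frT f)) (restrict_fun U (\<lambda>u. 1))"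
proof -
  interpret vs: vector_space "fun_scale :: 'k \<Rightarrow> _" by (rule vector_space_fun_scale)
  let ?r = "restrict_fun U"
  have reg: "regular_on U f" "\<And>u. u \<notin> U \<Longrightarrow> f u = 0" if "f \<in> regular_space U" for f
    using that by (auto simp: regular_space_def)
  have nested: "fr0 (?r g) u = fr0 g u" "fr1 (?r g) u = fr1 g u" "fr2 (?r g) u = fr2 g u"
    "fr3 (?r g) u = fr3 g u" "frT (?r g) u = frT g u" if "u \<in> U" for g u
    using fr_cong[OF U(1) that, of "?r g" g] by (auto simp: restrict_fun_def)
  have ops: "\<exists>fr\<in>{fr0, fr1, fr2, fr3, frT}. P = (\<lambda>f. ?r (fr f))"
    if "P \<in> {\<lambda>f. ?r (fr0 f), \<lambda>f. ?r (fr1 f), \<lambda>f. ?r (fr2 f), \<lambda>f. ?r (fr3 f), \<lambda>f. ?r (frT f)}" for P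
    using that by blast
  show ?thesis
  proof (unfold_locales)
    show "vs.subspace (regular_space U)"
      unfolding vs.subspace_def
    proof (intro conjI ballI allI)
      show "0 \<in> regular_space U"
        using regular_on_const[of U 0] by (simp add: regular_space_def zero_fun_def)
      show "f + g \<in> regular_space U" if "f \<in> regular_space U" "g \<in> regular_space U" for f g
        using regular_on_add[OF U(1) reg(1)[OF that(1)] reg(1)[OF that(2)]] that
        by (simp add: regular_space_def plus_fun_def)
      show "fun_scale c f \<in> regular_space U" if "f \<in> regular_space U" for c f
        using regular_on_mult[OF U(1) regular_on_const reg(1)[OF that]] that
        by (simp add: regular_space_def fun_scale_def)
    qed
  next
    fix P f assume P: "P \<in> {\<lambda>f. ?r (fr0 f), \<lambda>f. ?r (fr1 f), \<lambda>f. ?r (fr2 f), \<lambda>f. ?r (fr3 f), \<lambda>f. ?r (frT f)}"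
      and f: "f \<in> regular_space U"
    show "P f \<in> regular_space U"
      using P restrict_fun_regular[OF U(1)] regular_on_fr[OF U(1) reg(1)[OF f]] by blast
    obtain fr where fr: "fr \<in> {fr0, fr1, fr2, fr3, frT}" "P = (\<lambda>f. ?r (fr f))"
      using ops[OF P] by blast
    show "P (fun_scale c f) = fun_scale c (P f)" for c
      using fr_linear(2)[OF reg(1)[OF f] reg(1)[OF f] _ fr(1)] unfolding fr(2)
      by (auto simp: fun_eq_iff restrict_fun_def fun_scale_def)
    fix g assume g: "g \<in> regular_space U"
    show "P (f + g) = P f + P g"
      using fr_linear(1)[OF reg(1)[OF f] reg(1)[OF g] _ fr(1)] unfolding fr(2)
      by (auto simp: fun_eq_iff restrict_fun_def plus_fun_def)
  next
    fix f assume f: "f \<in> regular_space U"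
    note comm = fr_commute[OF U(1) reg(1)[OF f]]
    show "?r (fr1 (?r (fr0 f))) = ?r (fr0 (?r (fr1 f)))" "?r (fr2 (?r (fr0 f))) = ?r (fr0 (?r (fr2 f)))"
      "?r (fr3 (?r (fr0 f))) = ?r (fr0 (?r (fr3 f))) - ?r (frT f)"
      "?r (fr2 (?r (fr1 f))) = ?r (fr1 (?r (fr2 f))) + fun_scale 3 (?r (frT f))"
      "?r (fr3 (?r (fr1 f))) = ?r (fr1 (?r (fr3 f)))" "?r (fr3 (?r (fr2 f))) = ?r (fr2 (?r (fr3 f)))"
      by (auto simp: fun_eq_iff restrict_fun_def[of _ "fr0 _"] restrict_fun_def[of _ "fr1 _"]
          restrict_fun_def[of _ "fr2 _"] restrict_fun_def[of _ "fr3 _"] restrict_fun_def[of _ "frT _"]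
          fun_scale_def nested[unfolded restrict_fun_def] comm)
    fix P assume "P \<in> {\<lambda>f. ?r (fr0 f), \<lambda>f. ?r (fr1 f), \<lambda>f. ?r (fr2 f), \<lambda>f. ?r (fr3 f)}"
    then show "P (?r (frT f)) = ?r (frT (P f))"
      by (elim insertE emptyE; hypsubst) (auto simp: fun_eq_iff restrict_fun_def[of _ "fr0 _"] restrict_fun_def[of _ "fr1 _"]
          restrict_fun_def[of _ "fr2 _"] restrict_fun_def[of _ "fr3 _"] restrict_fun_def[of _ "frT _"]
          nested[unfolded restrict_fun_def] comm)
  next
    fix f assume f: "f \<in> regular_space U"
      and z: "?r (fr0 f) = 0" "?r (fr1 f) = 0" "?r (fr2 f) = 0" "?r (fr3 f) = 0"
    have e: "fr0 f u = 0" "fr1 f u = 0" "fr2 f u = 0" "fr3 f u = 0" if "u \<in> U" for u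
      using z[THEN fun_cong, of u] that by (simp_all add: restrict_fun_def)
    have c0: "fr0 (\<lambda>u. 0) u = 0" "fr3 (\<lambda>u. 0) u = 0" for u :: "'k ^ coord"
      by (simp_all add: fr_defs)
    have zero: "has_partial i f 0 u" if u: "u \<in> U" for i u
    proof -
      \<comment> \<open>Vanishing along the contact planes is enough: the commutator supplies the
        derivative by \<open>z\<close>.\<close>
      have "frT f u = fr0 (fr3 f) u - fr3 (fr0 f) u"
        by (simp add: fr_commute[OF U(1) reg(1)[OF f] u])
      also have "\<dots> = 0"
        using fr_cong(1)[OF U(1) u, of "fr3 f" "\<lambda>u. 0"] fr_cong(4)[OF U(1) u, of "fr0 f" "\<lambda>u. 0"] e c0
        by simp
      finally have "partial Cz f u = 0" by (simp add: fr_defs)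
      then have "partial i f u = 0"
        using e[OF u] by (cases i) (auto simp: fr_defs)
      then show ?thesis
        using regular_on_has_partial[OF reg(1)[OF f] u, of i] by simp
    qed
    obtain c where "\<forall>u\<in>U. f u = c"
      using constant_of_zero_partials[OF U zero] by blast
    then have "f = fun_scale c (?r (\<lambda>u. 1))"
      using reg(2)[OF f] by (auto simp: fun_eq_iff fun_scale_def restrict_fun_def)
    then show "\<exists>c. f = fun_scale c (?r (\<lambda>u. 1))" ..
  qed
qed

lemma solution_in_span:
  fixes U :: "('k::real_normed_field ^ coord) set"
  assumes U: "open U" "connected U" and f: "regular_on U f" "symmetry_equations U f"
  shows "restrict_fun U f \<in> module.span fun_scale ((\<lambda>k. restrict_fun U (snd (generators ! k))) ` {..<14})"
proof -
  let ?r = "restrict_fun U"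
  interpret cf: contact_frame fun_scale "regular_space U" "\<lambda>f. ?r (fr0 f)" "\<lambda>f. ?r (fr1 f)" "\<lambda>f. ?r (fr2 f)"
    "\<lambda>f. ?r (fr3 f)" "\<lambda>f. ?r (frT f)" "?r (\<lambda>u. 1)"
    by (rule contact_frame_fr[OF U])
  have nested: "fr0 (?r g) u = fr0 g u" "fr1 (?r g) u = fr1 g u" "fr2 (?r g) u = fr2 g u"
    "fr3 (?r g) u = fr3 g u" "frT (?r g) u = frT g u" if "u \<in> U" for g u
    using fr_cong[OF U(1) that, of "?r g" g] by (auto simp: restrict_fun_def)
  have rr: "?r (fr0 (?r g)) = ?r (fr0 g)" "?r (fr1 (?r g)) = ?r (fr1 g)" "?r (fr2 (?r g)) = ?r (fr2 g)"
    "?r (fr3 (?r g)) = ?r (fr3 g)" "?r (frT (?r g)) = ?r (frT g)" for g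
    unfolding restrict_fun_def[of U "fr0 _"] restrict_fun_def[of U "fr1 _"] restrict_fun_def[of U "fr2 _"]
      restrict_fun_def[of U "fr3 _"] restrict_fun_def[of U "frT _"] using nested by (auto simp: fun_eq_iff)
  have sol: "cf.solution (?r g)" if g: "regular_on U g" "symmetry_equations U g" for g
    unfolding cf.solution_def rr
    using restrict_fun_regular[OF U(1) g(1)] g(2)
    by (auto simp: symmetry_equations_def restrict_fun_def fun_eq_iff fun_scale_def)
  have gen: "generators ! k \<in> set generators" if "k < 14" for k
    using that by simp
  have jet: "cf.jet l (?r g) = ?r (\<lambda>u. frame_jet g u ! l)" if "l < 14" for l g
    using that unfolding cf.below_14
    by (elim insertE emptyE) (simp_all add: frame_jet_def rr)
  have take: "take (Suc k) (frame_jet (snd (generators ! k)) u) = replicate k 0 @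
      [[- (128/3), - (32/3), 32, 8, 16/3, - (16/3), 8, 4, 4, 4/3, - 4, 2, 2, 1] ! k]" if "k < 14" for k and u :: "'k ^ coord"
    using list_all2_nthD[OF generators_jets, of k u] that by (simp add: case_prod_beta)
  have jet_nth: "frame_jet (snd (generators ! k)) u ! l =
      (replicate k 0 @ [[- (128/3), - (32/3), 32, 8, 16/3, - (16/3), 8, 4, 4, 4/3, - 4, 2, 2, 1] ! k]) ! l"
    if "k < 14" "l \<le> k" for k l and u :: "'k ^ coord"
    using arg_cong[OF take[OF that(1), of u], of "\<lambda>xs. xs ! l"] that(2) by simp
  show ?thesis
  proof (rule cf.solutions_spanned)
    show "cf.solution (?r f)" by (rule sol[OF f])
  next
    fix k :: nat assume k: "k < 14"
    note g = generators_regular[of "fst (generators ! k)" "snd (generators ! k)", unfolded prod.collapse, OF gen[OF k]]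
    show "cf.solution (?r (snd (generators ! k)))"
      by (rule sol[OF polyfun_regular[OF g(1)] g(3)])
    show "cf.jet l (?r (snd (generators ! k))) = 0" if "l < k" for l
    proof -
      have "l < 14" "l \<le> k" using that k by auto
      then have "frame_jet (snd (generators ! k)) u ! l = 0" for u :: "'k ^ coord"
        using jet_nth[OF k, of l u] that by (simp add: nth_append)
      then show ?thesis
        unfolding jet[OF \<open>l < 14\<close>] by (simp add: restrict_fun_def zero_fun_def)
    qed
    let ?c = "[- (128/3), - (32/3), 32, 8, 16/3, - (16/3), 8, 4, 4, 4/3, - 4, 2, 2, 1] ! k :: 'k"
    have "?c \<noteq> 0"
      using k unfolding cf.below_14 by (elim insertE emptyE) simp_all
    moreover have "cf.jet k (?r (snd (generators ! k))) = fun_scale ?c (?r (\<lambda>u. 1))"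
      unfolding jet[OF k] using jet_nth[OF k order_refl]
      by (simp add: nth_append restrict_fun_def fun_scale_def fun_eq_iff)
    ultimately show "\<exists>c. c \<noteq> 0 \<and> cf.jet k (?r (snd (generators ! k))) = fun_scale c (?r (\<lambda>u. 1))"
      by blast
  qed
qed

lemma vector_space_vf_scale: "vector_space (vf_scale :: 'k::real_normed_field \<Rightarrow> _)"
  by unfold_locales (auto simp: vf_scale_def fun_eq_iff vec_eq_iff algebra_simps)

definition field_of :: "('k ^ coord) set \<Rightarrow> ('k ^ coord \<Rightarrow> 'k) \<Rightarrow> 'k ^ coord \<Rightarrow> 'k::real_normed_field ^ coord" where
  "field_of U f = restrict_vf U (\<lambda>u. vec5 (3/4 * fr0 f u - 3/8 * fr3 f u) (- (1/4) * fr1 f u)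
     (f u + u $ Cp * (3/4 * fr0 f u - 3/8 * fr3 f u) + u $ Cq * (- (1/4) * fr1 f u))
     (1/2 * fr3 f u) (1/2 * fr2 f u))"

lemma field_of_unique:
  assumes "hamiltonian_on U X f" "\<And>u. u \<in> U \<Longrightarrow> Y u = X u" "\<And>u. u \<notin> U \<Longrightarrow> Y u = 0"
  shows "Y = field_of U f"
  using assms by (auto simp: fun_eq_iff field_of_def restrict_vf_def vec_eq_iff coord_all hamiltonian_on_def)

text \<open>\<open>field_of\<close> is linear and sends the Hamiltonian of a generator to that
  generator, so it carries \<open>solution_in_span\<close> over to vector fields.\<close>

lemma hamiltonian_in_span:
  fixes U :: "('k::real_normed_field ^ coord) set"
  assumes U: "open U" "connected U" and f: "regular_on U f" "symmetry_equations U f"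
    and X: "hamiltonian_on U X f" "\<And>u. u \<notin> U \<Longrightarrow> X u = 0"
  shows "X \<in> vf_span (restrict_vf U ` fst ` set generators)"
proof -
  interpret vs: vector_space "fun_scale :: 'k \<Rightarrow> _" by (rule vector_space_fun_scale)
  interpret vv: vector_space "vf_scale :: 'k \<Rightarrow> _" by (rule vector_space_vf_scale)
  let ?r = "restrict_fun U" and ?B = "restrict_vf U ` fst ` set generators"
  have cong: "field_of U (?r g) = field_of U g" for g
    using fr_cong[OF U(1), of _ "?r g" g] by (auto simp: field_of_def restrict_vf_def fun_eq_iff restrict_fun_def)
  have "h \<in> regular_space U \<and> field_of U h \<in> vv.span ?B"
    if "h \<in> vs.span ((\<lambda>k. ?r (snd (generators ! k))) ` {..<14})" for h
    using that
  proof (induction rule: vs.span_induct_alt)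
    case base
    have "field_of U 0 = 0"
      by (auto simp: field_of_def restrict_vf_def fun_eq_iff zero_fun_def fr_defs vec_eq_iff coord_all)
    then show ?case
      using regular_on_const[of U 0] vv.span_zero[of ?B] by (simp add: regular_space_def zero_fun_def)
  next
    case (step c g h)
    then obtain k where k: "k < 14" "g = ?r (snd (generators ! k))" by auto
    let ?X = "fst (generators ! k)" and ?f = "snd (generators ! k)"
    have mem: "generators ! k \<in> set generators" using k(1) by simp
    note gk = generators_regular[of ?X ?f, unfolded prod.collapse, OF mem]
    have g: "regular_on U g" "\<And>u. u \<notin> U \<Longrightarrow> g u = 0"
      using restrict_fun_regular[OF U(1) polyfun_regular[OF gk(1)]] unfolding k(2) by (auto simp: regular_space_def)
    have h: "regular_on U h" "\<And>u. u \<notin> U \<Longrightarrow> h u = 0" using step by (auto simp: regular_space_def)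
    have "restrict_vf U ?X = field_of U ?f"
      by (rule field_of_unique[OF gk(2)]) (simp_all add: restrict_vf_def)
    then have "field_of U g \<in> vv.span ?B"
      unfolding k(2) cong using mem by (metis imageI vv.span_base)
    moreover have cg: "regular_on U (\<lambda>u. c * g u)"
      by (intro regular_on_mult regular_on_const U g)
    have "field_of U (\<lambda>u. c * g u + h u) = vf_scale c (field_of U g) + field_of U h"
    proof
      fix u
      show "field_of U (\<lambda>u. c * g u + h u) u = (vf_scale c (field_of U g) + field_of U h) u"
      proof (cases "u \<in> U")
        case True
        have lin: "fr (\<lambda>u. c * g u + h u) u = c * fr g u + fr h u" if "fr \<in> {fr0, fr1, fr2, fr3, frT}" for fr
          unfolding fr_linear(1)[OF cg h(1) True that] fr_linear(2)[OF g(1) g(1) True that] ..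
        show ?thesis
          using True by (simp add: field_of_def restrict_vf_def vf_scale_def vec_eq_iff coord_all lin;
            simp add: field_simps)
      qed (simp add: field_of_def restrict_vf_def vf_scale_def)
    qed
    ultimately have "field_of U (\<lambda>u. c * g u + h u) \<in> vv.span ?B"
      using step by (simp add: vv.span_add vv.span_scale)
    moreover have "fun_scale c g + h = (\<lambda>u. c * g u + h u)"
      by (simp add: fun_scale_def plus_fun_def)
    ultimately show ?case
      using regular_on_add[OF U(1) cg h(1)] g(2) h(2) by (simp add: regular_space_def)
  qed
  from this[OF solution_in_span[OF U f]] have "field_of U f \<in> vv.span ?B"
    unfolding cong by blast
  moreover have "X = field_of U f"
    by (rule field_of_unique[OF X(1)]) (simp_all add: X(2))
  ultimately show ?thesis by simp
qed

section \<open>The Lie algebra of regular vector fields\<close>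

definition ddir :: "('k ^ coord \<Rightarrow> 'k ^ coord) \<Rightarrow> ('k ^ coord \<Rightarrow> 'k) \<Rightarrow> 'k ^ coord \<Rightarrow> 'k::real_normed_field" where
  "ddir X f u = (\<Sum>m\<in>UNIV. X u $ m * partial m f u)"

definition regular_fields :: "('k ^ coord) set \<Rightarrow> ('k ^ coord \<Rightarrow> 'k::real_normed_field ^ coord) set" where
  "regular_fields U = {X. (\<forall>i. regular_on U (\<lambda>u. X u $ i)) \<and> (\<forall>u. u \<notin> U \<longrightarrow> X u = 0)}"

lemma vf_bracket_nth:
  "u \<in> U \<Longrightarrow> vf_bracket U X Y u $ i = ddir X (\<lambda>u. Y u $ i) u - ddir Y (\<lambda>u. X u $ i) u"
  by (simp add: vf_bracket_def restrict_vf_def ddir_def sum_subtractf)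

lemma vf_bracket_outside: "u \<notin> U \<Longrightarrow> vf_bracket U X Y u = 0"
  by (simp add: vf_bracket_def restrict_vf_def)

lemma vf_bracket_restrict:
  assumes U: "open U"
  shows "vf_bracket U (restrict_vf U X) (restrict_vf U Y) = restrict_vf U (bracket X Y)"
proof -
  have p: "partial m (\<lambda>u'. restrict_vf U Z u' $ i) u = partial m (\<lambda>u'. Z u' $ i) u" if "u \<in> U" for m i u Z
    by (rule partial_cong[OF U that]) (simp add: restrict_vf_def)
  show ?thesis
    unfolding vf_bracket_def by (intro ext) (simp add: restrict_vf_def[of U "\<lambda>u. \<chi> i. _ u i"] restrict_vf_def[of U "bracket X Y"]
      restrict_vf_def[of U X] restrict_vf_def[of U Y] bracket_def p[unfolded restrict_vf_def])
qed

lemma ddir_linear: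
  assumes "regular_on U f" "regular_on U g" "u \<in> U"
  shows "ddir X (\<lambda>u. f u + g u) u = ddir X f u + ddir X g u"
    "ddir X (\<lambda>u. f u - g u) u = ddir X f u - ddir X g u"
    "ddir X (\<lambda>u. c * f u) u = c * ddir X f u"
proof -
  have "partial i (\<lambda>u. f u + g u) u = partial i f u + partial i g u"
    "partial i (\<lambda>u. f u - g u) u = partial i f u - partial i g u"
    "partial i (\<lambda>u. c * f u) u = c * partial i f u" for i
    by (rule has_partial_imp_partial; intro has_partial_add has_partial_diff has_partial_cmult
        regular_on_has_partial[of U] assms)+
  then show "ddir X (\<lambda>u. f u + g u) u = ddir X f u + ddir X g u"
    "ddir X (\<lambda>u. f u - g u) u = ddir X f u - ddir X g u"
    "ddir X (\<lambda>u. c * f u) u = c * ddir X f u"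
    by (simp_all add: ddir_def sum.distrib sum_subtractf sum_distrib_left distrib_left
        right_diff_distrib mult.left_commute)
qed

lemma regular_on_ddir:
  assumes "open U" "\<And>m. regular_on U (\<lambda>u. X u $ m)" "regular_on U f"
  shows "regular_on U (ddir X f)"
  unfolding ddir_def[abs_def] sum_coord by (intro regular_on_intros assms)

text \<open>The second order terms of the two compositions cancel by the symmetry of mixed
  derivatives.\<close>

lemma ddir_commutator:
  assumes U: "open U" and u: "u \<in> U" and f: "regular_on U f"
    and Y: "\<And>m. regular_on U (\<lambda>u. Y u $ m)" and Z: "\<And>m. regular_on U (\<lambda>u. Z u $ m)"
  shows "ddir (vf_bracket U Y Z) f u = ddir Y (ddir Z f) u - ddir Z (ddir Y f) u"
proof -
  have p: "partial m (ddir X f) u = (\<Sum>n\<in>UNIV. partial m (\<lambda>u. X u $ n) u * partial n f u + X u $ n * partial m (partial n f) u)"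
    if "\<And>m. regular_on U (\<lambda>u. X u $ m)" for X m
    unfolding ddir_def[abs_def] sum_coord
    by (intro has_partial_imp_partial has_partial_add has_partial_mult regular_on_has_partial[of U]
        regular_on_partial f that u)
  show ?thesis
    unfolding ddir_def[of _ "ddir Z f"] ddir_def[of _ "ddir Y f"] p[OF Z] p[OF Y] ddir_def[of "vf_bracket U Y Z"]
      vf_bracket_nth[OF u]
    unfolding ddir_def sum_coord
    by (simp add: partial_commute[OF U u f, of Cy Cx] partial_commute[OF U u f, of Cz Cx]
      partial_commute[OF U u f, of Cp Cx] partial_commute[OF U u f, of Cq Cx]
      partial_commute[OF U u f, of Cz Cy] partial_commute[OF U u f, of Cp Cy]
      partial_commute[OF U u f, of Cq Cy] partial_commute[OF U u f, of Cp Cz]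
      partial_commute[OF U u f, of Cq Cz] partial_commute[OF U u f, of Cq Cp] algebra_simps)
qed

lemma vf_bracket_bilinear:
  assumes U: "open U" and "X \<in> regular_fields U" "Y \<in> regular_fields U" "Z \<in> regular_fields U"
  shows "vf_bracket U (X + Y) Z = vf_bracket U X Z + vf_bracket U Y Z"
    "vf_bracket U X (Y + Z) = vf_bracket U X Y + vf_bracket U X Z"
    "vf_bracket U (vf_scale c X) Y = vf_scale c (vf_bracket U X Y)"
    "vf_bracket U X (vf_scale c Y) = vf_scale c (vf_bracket U X Y)"
    "vf_bracket U X X = 0"
proof -
  have r: "regular_on U (\<lambda>u. X u $ m)" "regular_on U (\<lambda>u. Y u $ m)" "regular_on U (\<lambda>u. Z u $ m)" for m
    using assms by (auto simp: regular_fields_def)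
  have l: "ddir (X + Y) f u = ddir X f u + ddir Y f u" "ddir (vf_scale c X) f u = c * ddir X f u"
    for X Y :: "'a ^ coord \<Rightarrow> 'a ^ coord" and f u
    by (simp_all add: ddir_def vf_scale_def sum.distrib sum_distrib_left algebra_simps)
  have eqI: "V = W" if "\<And>u i. u \<in> U \<Longrightarrow> V u $ i = W u $ i" "\<And>u. u \<notin> U \<Longrightarrow> V u = W u"
    for V W :: "'a ^ coord \<Rightarrow> 'a ^ coord"
    using that by (auto simp: fun_eq_iff vec_eq_iff)
  show "vf_bracket U (X + Y) Z = vf_bracket U X Z + vf_bracket U Y Z"
    by (rule eqI) (simp_all add: vf_bracket_nth l ddir_linear[OF r(1) r(2)] vf_bracket_outside)
  show "vf_bracket U X (Y + Z) = vf_bracket U X Y + vf_bracket U X Z"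
    by (rule eqI) (simp_all add: vf_bracket_nth l ddir_linear[OF r(2) r(3)] vf_bracket_outside)
  show "vf_bracket U (vf_scale c X) Y = vf_scale c (vf_bracket U X Y)"
    by (rule eqI) (simp_all add: vf_bracket_nth l vf_scale_def[of c X] vf_scale_def[of c "vf_bracket U X Y"]
        ddir_linear(3)[OF r(1) r(1)] l(2)[unfolded vf_scale_def] vf_bracket_outside right_diff_distrib)
  show "vf_bracket U X (vf_scale c Y) = vf_scale c (vf_bracket U X Y)"
    by (rule eqI) (simp_all add: vf_bracket_nth l vf_scale_def[of c Y] vf_scale_def[of c "vf_bracket U X Y"]
        ddir_linear(3)[OF r(2) r(2)] l(2)[unfolded vf_scale_def] vf_bracket_outside right_diff_distrib)
  show "vf_bracket U X X = 0"
    by (rule eqI) (simp_all add: vf_bracket_nth vf_bracket_outside)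
qed

text \<open>Each double bracket splits into four compositions of two directional derivatives applied
  to a component of the third field; in the cyclic sum they cancel in pairs.\<close>

lemma vf_jacobi:
  assumes U: "open U" and X: "X \<in> regular_fields U" and Y: "Y \<in> regular_fields U" and Z: "Z \<in> regular_fields U"
  shows "vf_bracket U X (vf_bracket U Y Z) + vf_bracket U Y (vf_bracket U Z X) + vf_bracket U Z (vf_bracket U X Y) = 0"
proof -
  have r: "regular_on U (\<lambda>u. W u $ m)" if "W \<in> regular_fields U" for W m
    using that by (auto simp: regular_fields_def)
  have double: "vf_bracket U A (vf_bracket U B C) u $ i = ddir A (ddir B (\<lambda>u. C u $ i)) u - ddir A (ddir C (\<lambda>u. B u $ i)) u
      - ddir B (ddir C (\<lambda>u. A u $ i)) u + ddir C (ddir B (\<lambda>u. A u $ i)) u"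
    if u: "u \<in> U" and A: "A \<in> regular_fields U" and B: "B \<in> regular_fields U" and C: "C \<in> regular_fields U" for A B C u i
  proof -
    have "partial m (\<lambda>u. vf_bracket U B C u $ i) u = partial m (\<lambda>u. ddir B (\<lambda>u. C u $ i) u - ddir C (\<lambda>u. B u $ i) u) u" for m
      by (rule partial_cong[OF U u vf_bracket_nth])
    then have "ddir A (\<lambda>u. vf_bracket U B C u $ i) u = ddir A (\<lambda>u. ddir B (\<lambda>u. C u $ i) u - ddir C (\<lambda>u. B u $ i) u) u"
      by (simp add: ddir_def)
    also have "\<dots> = ddir A (ddir B (\<lambda>u. C u $ i)) u - ddir A (ddir C (\<lambda>u. B u $ i)) u"
      by (rule ddir_linear(2)[OF regular_on_ddir regular_on_ddir u]) (intro U r A B C)+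
    finally show ?thesis
      using ddir_commutator[OF U u r[OF A, of i] r[OF B] r[OF C]] by (simp add: vf_bracket_nth[OF u, of A])
  qed
  show ?thesis
  proof
    fix u
    show "(vf_bracket U X (vf_bracket U Y Z) + vf_bracket U Y (vf_bracket U Z X) + vf_bracket U Z (vf_bracket U X Y)) u = 0 u"
    proof (cases "u \<in> U")
      case True
      then show ?thesis
        by (simp add: vec_eq_iff double[OF True X Y Z] double[OF True Y Z X] double[OF True Z X Y])
    qed (simp add: vf_bracket_outside)
  qed
qed

text \<open>Closure extends from \<open>B\<close> to its span first in the right argument, then in
  the left one by antisymmetry.\<close>

lemma lie_algebra_span:
  fixes B :: "('k::real_normed_field ^ coord \<Rightarrow> 'k ^ coord) set"
  assumes U: "open U" and B: "B \<subseteq> regular_fields U"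
    and closed: "\<And>X Y. \<lbrakk>X \<in> B; Y \<in> B\<rbrakk> \<Longrightarrow> vf_bracket U X Y \<in> vf_span B"
  shows "lie_algebra vf_scale (vf_span B) (vf_bracket U)"
proof -
  interpret vv: vector_space "vf_scale :: 'k \<Rightarrow> _" by (rule vector_space_vf_scale)
  have "vv.subspace (regular_fields U)"
    unfolding vv.subspace_def
  proof (intro conjI ballI allI)
    show "0 \<in> regular_fields U"
      using regular_on_const[of U 0] by (simp add: regular_fields_def)
    show "X + Y \<in> regular_fields U" if "X \<in> regular_fields U" "Y \<in> regular_fields U" for X Y
      using that regular_on_add[OF U] by (simp add: regular_fields_def)
    show "vf_scale c X \<in> regular_fields U" if "X \<in> regular_fields U" for c X
      using that regular_on_mult[OF U regular_on_const] by (simp add: regular_fields_def vf_scale_def)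
  qed
  then have reg: "X \<in> regular_fields U" if "X \<in> vv.span B" for X
    using vv.span_minimal[OF B] that by blast
  note bil = vf_bracket_bilinear[OF U]
  have zero: "vf_bracket U X 0 = 0" "vf_bracket U 0 X = 0" if "X \<in> regular_fields U" for X
    using bil(4)[OF that that that, of 0] bil(3)[OF that that that, of 0] by simp_all
  have right: "vf_bracket U X Y \<in> vv.span B"
    if X: "X \<in> regular_fields U" and XB: "\<And>Z. Z \<in> B \<Longrightarrow> vf_bracket U X Z \<in> vv.span B"
      and Y: "Y \<in> vv.span B" for X Y
  proof -
    have "Y \<in> vv.span B \<and> vf_bracket U X Y \<in> vv.span B"
      using Y
    proof (induction rule: vv.span_induct_alt)
      case base
      show ?case unfolding zero(1)[OF X] by (intro conjI vv.span_zero)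
    next
      case (step c Z W)
      then have r: "Z \<in> regular_fields U" "vf_scale c Z \<in> regular_fields U" "W \<in> regular_fields U"
        by (blast intro: reg vv.span_scale vv.span_base)+
      show ?case
        unfolding bil(2)[OF X r(2) r(3)] bil(4)[OF X r(1) r(1)]
        by (intro conjI vv.span_add vv.span_scale) (use step XB[OF step(1)] vv.span_base[OF step(1)] in blast)+
    qed
    then show ?thesis ..
  qed
  have anti: "vf_bracket U X Y = vf_scale (-1) (vf_bracket U Y X)" for X Y
  proof
    fix u
    show "vf_bracket U X Y u = vf_scale (-1) (vf_bracket U Y X) u"
      by (cases "u \<in> U") (simp_all add: vec_eq_iff vf_bracket_nth vf_bracket_outside vf_scale_def)
  qed
  have closed': "vf_bracket U X Y \<in> vv.span B" if X: "X \<in> vv.span B" and Y: "Y \<in> vv.span B" for X Y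
  proof (rule right[OF reg[OF X] _ Y])
    fix Z assume Z: "Z \<in> B"
    have "vf_bracket U Z X \<in> vv.span B"
      by (rule right[OF _ _ X]) (use Z B closed[OF Z] in blast)+
    then show "vf_bracket U X Z \<in> vv.span B"
      using anti[of X Z] by (simp only: vv.span_scale)
  qed
  show ?thesis
    by (unfold_locales; (rule bil; intro reg)?)
      (auto intro: closed' bil vf_jacobi[OF U] reg simp: vv.subspace_span)
qed

lemma restrict_vf_linear:
  "restrict_vf U 0 = 0" "restrict_vf U (X + Y) = restrict_vf U X + restrict_vf U Y"
  "restrict_vf U (vf_scale c X) = vf_scale c (restrict_vf U X)"
  by (intro ext; simp add: restrict_vf_def vf_scale_def)+

lemma bracket_anticommute: "bracket Y X = vf_scale (-1) (bracket X Y)"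
  by (intro ext) (simp add: vec_eq_iff bracket_def vf_scale_def sum_subtractf)

lemmas bracket_rules = bracket_S1[simplified] bracket_L2[simplified] bracket_S3[simplified]
  bracket_L4[simplified] bracket_S5[simplified] bracket_L6[simplified] bracket_S7[simplified]
  bracket_L8[simplified] bracket_S9[simplified] bracket_L10[simplified] bracket_S11[simplified]
  bracket_L12[simplified] bracket_h1[simplified]

definition basis_list :: "('k ^ coord \<Rightarrow> 'k::real_normed_field ^ coord) list" where
  "basis_list = [S1, L2, S3, L4, S5, L6, S7, L8, S9, L10, S11, L12, h1, E_field]"

lemma basis_closed:
  assumes U: "open U" and "X \<in> restrict_vf U ` set basis_list" "Y \<in> restrict_vf U ` set basis_list"
  shows "vf_bracket U X Y \<in> vf_span (restrict_vf U ` set basis_list :: ('k::real_normed_field ^ coord \<Rightarrow> _) set)"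
proof -
  interpret vv: vector_space "vf_scale :: 'k \<Rightarrow> _" by (rule vector_space_vf_scale)
  let ?S = "vv.span (restrict_vf U ` set basis_list)"
  let ?P = "\<lambda>X Y. restrict_vf U (bracket X Y) \<in> ?S"
  have base: "restrict_vf U X \<in> ?S" if "X \<in> set basis_list" for X
    using that by (intro vv.span_base imageI)
  have base': "restrict_vf U S1 \<in> ?S" "restrict_vf U L2 \<in> ?S" "restrict_vf U S3 \<in> ?S" "restrict_vf U L4 \<in> ?S"
    "restrict_vf U S5 \<in> ?S" "restrict_vf U L6 \<in> ?S" "restrict_vf U S7 \<in> ?S" "restrict_vf U L8 \<in> ?S"
    "restrict_vf U S9 \<in> ?S" "restrict_vf U L10 \<in> ?S" "restrict_vf U S11 \<in> ?S" "restrict_vf U L12 \<in> ?S"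
    "restrict_vf U h1 \<in> ?S" "restrict_vf U E_field \<in> ?S"
    by (rule base; simp add: basis_list_def)+
  \<comment> \<open>\<open>sorted_wrt\<close> asks for the pairs in list order, which are those of
    the bracket tables; the general fact \<open>all\<close> adds the diagonal and the reversed
    pairs.\<close>
  have sorted: "sorted_wrt ?P basis_list"
    unfolding basis_list_def
    by (simp only: sorted_wrt.simps list.set ball_simps bracket_rules restrict_vf_linear
        vv.span_zero vv.span_add vv.span_scale base'[unfolded basis_list_def list.set] simp_thms)
  have all: "\<forall>X\<in>set xs. \<forall>Y\<in>set xs. ?P X Y" if "sorted_wrt ?P xs" for xs
    using that
  proof (induction xs)
    case (Cons x xs)
    have "bracket x x = 0"
      by (simp add: fun_eq_iff vec_eq_iff bracket_def)
    then have "?P x x" using vv.span_zero by (simp add: restrict_vf_linear)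
    moreover have "?P Y x" if "?P x Y" for Y
      using that unfolding bracket_anticommute[of Y x] restrict_vf_linear by (rule vv.span_scale)
    ultimately show ?case using Cons by auto
  qed simp
  obtain X' Y' where "X' \<in> set basis_list" "Y' \<in> set basis_list" "X = restrict_vf U X'" "Y = restrict_vf U Y'"
    using assms(2,3) by blast
  then show ?thesis
    using all[OF sorted] by (simp add: vf_bracket_restrict[OF U])
qed

section \<open>The symmetry algebra\<close>

lemma fr_nested_linear:
  assumes U: "open U" "u \<in> U" and f: "regular_on U f" and g: "regular_on U g"
    and fr: "a \<in> {fr0, fr1, fr2, fr3, frT}" "b \<in> {fr0, fr1, fr2, fr3, frT}"
  shows "b (\<lambda>u. c * f u + g u) u = c * b f u + b g u"
    "a (b (\<lambda>u. c * f u + g u)) u = c * a (b f) u + a (b g) u"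
proof -
  have cf: "regular_on U (\<lambda>u. c * f u)" if "regular_on U f" for f
    using that by (intro regular_on_mult regular_on_const U)
  have lin: "b (\<lambda>u. c * f u + g u) u = c * b f u + b g u"
    if "u \<in> U" "regular_on U f" "regular_on U g" "b \<in> {fr0, fr1, fr2, fr3, frT}" for b u f g
    unfolding fr_linear(1)[OF cf[OF that(2)] that(3,1,4)] fr_linear(2)[OF that(2,2,1,4)] ..
  show "b (\<lambda>u. c * f u + g u) u = c * b f u + b g u" by (rule lin[OF U(2) f g fr(2)])
  have "regular_on U (b f)" "regular_on U (b g)"
    using fr(2) regular_on_fr[OF U(1) f] regular_on_fr[OF U(1) g] by auto
  from lin[OF U(2) this fr(1)]
  show "a (b (\<lambda>u. c * f u + g u)) u = c * a (b f) u + a (b g) u"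
    using fr(1) fr_cong[OF U, of "b (\<lambda>u. c * f u + g u)" "\<lambda>u. c * b f u + b g u", OF lin[OF _ f g fr(2)]]
    by auto
qed

lemma symmetry_equations_linear:
  assumes U: "open U" and f: "regular_on U f" "symmetry_equations U f" and g: "regular_on U g" "symmetry_equations U g"
  shows "symmetry_equations U (\<lambda>u. c * f u + g u)"
proof -
  define h where "h = (\<lambda>u. c * f u + g u)"
  have "symmetry_equations U h"
    unfolding symmetry_equations_def
  proof
    fix u assume u: "u \<in> U"
    have L: "b h u = c * b f u + b g u" "a (b h) u = c * a (b f) u + a (b g) u"
      if "a \<in> {fr0, fr1, fr2, fr3, frT}" "b \<in> {fr0, fr1, fr2, fr3, frT}" for a b
      unfolding h_def by (rule fr_nested_linear[OF U u f(1) g(1) that])+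
    have 1: "frT h u = c * frT f u + frT g u" "fr0 (fr0 h) u = c * fr0 (fr0 f) u + fr0 (fr0 g) u"
      "fr0 (fr1 h) u = c * fr0 (fr1 f) u + fr0 (fr1 g) u" "fr1 (fr1 h) u = c * fr1 (fr1 f) u + fr1 (fr1 g) u"
      "fr0 (fr2 h) u = c * fr0 (fr2 f) u + fr0 (fr2 g) u" "fr1 (fr2 h) u = c * fr1 (fr2 f) u + fr1 (fr2 g) u"
      "fr0 (fr3 h) u = c * fr0 (fr3 f) u + fr0 (fr3 g) u" "fr2 (fr2 h) u = c * fr2 (fr2 f) u + fr2 (fr2 g) u"
      "fr1 (fr3 h) u = c * fr1 (fr3 f) u + fr1 (fr3 g) u" "fr2 (fr3 h) u = c * fr2 (fr3 f) u + fr2 (fr3 g) u"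
      "fr3 (fr3 h) u = c * fr3 (fr3 f) u + fr3 (fr3 g) u"
      by (rule L(1)[of fr0] L(2); simp)+
    show "fr0 (fr0 h) u = 0 \<and> fr0 (fr1 h) u = 0 \<and> fr1 (fr1 h) u = - 2 * fr0 (fr2 h) u \<and>
        fr1 (fr2 h) u = - fr0 (fr3 h) u - frT h u \<and> fr2 (fr2 h) u = - 2 * fr1 (fr3 h) u \<and>
        fr2 (fr3 h) u = 0 \<and> fr3 (fr3 h) u = 0"
      using f(2)[unfolded symmetry_equations_def, rule_format, OF u]
        g(2)[unfolded symmetry_equations_def, rule_format, OF u]
      unfolding 1 by (elim conjE, simp (no_asm_simp) only: , simp (no_asm) add: algebra_simps)
  qed
  then show ?thesis unfolding h_def .
qed

lemma hamiltonian_linear: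
  assumes U: "open U" and f: "regular_on U f" "hamiltonian_on U X f" and g: "regular_on U g" "hamiltonian_on U Y g"
  shows "hamiltonian_on U (vf_scale c X + Y) (\<lambda>u. c * f u + g u)"
proof -
  define h where "h = (\<lambda>u. c * f u + g u)"
  have "hamiltonian_on U (vf_scale c X + Y) h"
    unfolding hamiltonian_on_def
  proof
    fix u assume u: "u \<in> U"
    have 1: "fr0 h u = c * fr0 f u + fr0 g u" "fr1 h u = c * fr1 f u + fr1 g u"
      "fr2 h u = c * fr2 f u + fr2 g u" "fr3 h u = c * fr3 f u + fr3 g u"
      unfolding h_def by (rule fr_nested_linear(1)[OF U u f(1) g(1), where a = fr0]; simp)+
    have 2: "h u = c * f u + g u" by (simp add: h_def)
    note F = f(2)[unfolded hamiltonian_on_def, rule_format, OF u] g(2)[unfolded hamiltonian_on_def, rule_format, OF u]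
    have 3: "(vf_scale c X + Y) u $ m = c * X u $ m + Y u $ m" for m by (simp add: vf_scale_def)
    show "(vf_scale c X + Y) u $ Cx = 3/4 * fr0 h u - 3/8 * fr3 h u \<and> (vf_scale c X + Y) u $ Cy = - (1/4) * fr1 h u \<and>
        (vf_scale c X + Y) u $ Cz = h u + u $ Cp * (vf_scale c X + Y) u $ Cx + u $ Cq * (vf_scale c X + Y) u $ Cy \<and>
        (vf_scale c X + Y) u $ Cp = 1/2 * fr3 h u \<and> (vf_scale c X + Y) u $ Cq = 1/2 * fr2 h u"
      unfolding 1 2 3 using F by (elim conjE, simp (no_asm_simp) only: , simp (no_asm) add: field_simps)
  qed
  then show ?thesis unfolding h_def .
qed

lemma fst_generators: "fst ` set generators = set basis_list"
  unfolding generators_def basis_list_def by (simp add: insert_commute)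

lemma polyfun_basis: "X \<in> set basis_list \<Longrightarrow> polyfun (\<lambda>u. X u $ m)"
  unfolding basis_list_def set_simps
  by (elim insertE emptyE; hypsubst; cases m; simp add: field_defs poly_partial)

lemma h2_eq: "h2 = vf_scale (of_real (sqrt 3 / 2)) E_field"
  by (intro ext) (simp add: h2_def E_field_def in_coords_def vf_scale_def)

lemma vf_scale_simps:
  "vf_scale a (vf_scale b X) = vf_scale (a * b) X" "vf_scale 1 X = X" "vf_scale 0 X = 0" "vf_scale a 0 = 0"
  by (auto simp: vf_scale_def fun_eq_iff vec_eq_iff mult.assoc)

definition clock_field :: "nat \<Rightarrow> 'k ^ coord \<Rightarrow> 'k::real_normed_field ^ coord" where
  "clock_field i = [0, S1, L2, S3, L4, S5, L6, S7, L8, S9, L10, S11, L12] ! i"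

lemma clock_field_simps [simp]:
  "clock_field (Suc 0) = S1" "clock_field (Suc (Suc 0)) = L2" "clock_field 2 = L2" "clock_field 3 = S3" "clock_field 4 = L4"
  "clock_field 5 = S5" "clock_field 6 = L6" "clock_field 7 = S7" "clock_field 8 = L8"
  "clock_field 9 = S9" "clock_field 10 = L10" "clock_field 11 = S11" "clock_field 12 = L12"
  by (simp_all add: clock_field_def)

lemma clock_weights:
  assumes "i \<in> {1..12}"
  shows "bracket h1 (clock_field i) = vf_scale (of_int (clock_A i) / 2) (clock_field i)"
    "bracket E_field (clock_field i) = vf_scale (of_int (clock_E i)) (clock_field i)"
  using assms unfolding clock_set
  by (elim insertE emptyE; simp add: bracket_anticommute[of h1] bracket_anticommute[of E_field]
      bracket_rules vf_scale_simps)+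

lemma clock_next:
  assumes "i \<in> {1..12}"
  shows "\<exists>X\<in>set basis_list. \<exists>c::'k::real_normed_field. c \<noteq> 0 \<and>
    bracket X (clock_field i) = vf_scale c (clock_field (if i = 12 then 1 else Suc i))"
proof -
  \<comment> \<open>The root of each entry is the difference of two neighbouring roots, which is a
    short root.\<close>
  let ?X = "[0, S3, S7, S5, S9, S7, S11, S9, S1, S11, S3, S1, S5] ! i"
  let ?c = "[0, - (3/4), 2, 1/2, 3, 1, - 3, - 3, 1/2, 3, 1/2, - (3/2), 2] ! i :: 'k"
  have "?X \<in> set basis_list \<and> ?c \<noteq> 0 \<and>
      bracket ?X (clock_field i) = vf_scale ?c (clock_field (if i = 12 then 1 else Suc i))"
    using assms unfolding clock_set
    by (elim insertE emptyE; simp add: basis_list_def bracket_anticommute[of S3 S1] bracket_anticommute[of S7 L2]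
        bracket_anticommute[of S5 S3] bracket_anticommute[of S9 L4] bracket_anticommute[of S7 S5]
        bracket_anticommute[of S11 L6] bracket_anticommute[of S9 S7] bracket_anticommute[of S11 S9]
        bracket_rules vf_scale_simps)
  then show ?thesis by blast
qed

lemma root_table_eq:
  "root_table = (\<lambda>i. (clock_field i, of_int (clock_A i) / 2, sqrt 3 / 2 * of_int (clock_E i))) ` {1..12}"
  unfolding clock_set image_insert image_empty by (simp add: root_table_def)

section \<open>The contact structure of type G_2 and the solution of Noth's equation\<close>

lemma ext_deriv_contact_form:
  "ext_deriv contact_form u v w = v $ Cx * w $ Cp - v $ Cp * w $ Cx + v $ Cy * w $ Cq - v $ Cq * w $ Cy"
proof -
  have w: "(\<lambda>u'. contact_form u' [j]) = (\<lambda>u'::'a ^ coord. if j = Cz then 1 else if j = Cx then - u' $ Cp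
      else if j = Cy then - u' $ Cq else 0)" for j
    by (cases j) (auto simp: contact_form_def dcoord_def)
  have "partial m (\<lambda>u'. contact_form u' [j]) u =
      (if j = Cx \<and> m = Cp \<or> j = Cy \<and> m = Cq then - 1 else 0)" for m j
    by (cases j) (auto simp: w partial_minus polyfun_coord)
  then show ?thesis
    by (simp add: ext_deriv_def sum_coord algebra_simps)
qed

text \<open>The coframe \<open>cof\<close> has constant coefficients, so the local condition holds
  with \<open>W = U\<close> and constant factors.\<close>

lemma contact_structure_Upsilon:
  fixes U :: "('k::real_normed_field ^ coord) set"
  assumes "open U" "\<And>c. R U (\<lambda>u. c)"
  shows "contact_structure_G2 R U contact_form Upsilon"
  unfolding contact_structure_G2_def
proof
  fix u0 assume "u0 \<in> U"
  \<comment> \<open>\<open>axis (hd I) 1\<close> evaluates the linear form on a coordinate vector,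
    which gives its tensor component.\<close>
  let ?\<theta> = "\<lambda>j (u::'k ^ coord) I. cof j (axis (hd I) 1)"
  have \<theta>: "form1 (?\<theta> 0) u v = cof 0 v" "form1 (?\<theta> 1) u v = cof 1 v" "form1 (?\<theta> 2) u v = cof 2 v"
    "form1 (?\<theta> 3) u v = cof 3 v" "form1 (?\<theta> (Suc 0)) u v = cof (Suc 0) v" for u v
    by (simp_all add: form1_def sum_coord cof_simps axis_def algebra_simps)
  have A: "v = 0" if "form1 contact_form u v = 0" "\<forall>j<4. form1 (?\<theta> j) u v = 0" for u v
  proof -
    have "cof 0 v = 0" "cof (Suc 0) v = 0" "cof 2 v = 0" "cof 3 v = 0"
      using that(2)[rule_format, of 0] that(2)[rule_format, of 1] that(2)[rule_format, of 2]
        that(2)[rule_format, of 3] \<theta>[of u v] by simp_all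
    then show "v = 0"
      using that(1) by (simp add: cof_simps form1_contact vec_eq_iff coord_all)
  qed
  have B: "ext_deriv contact_form u v v' = 8/3 * (form1 (?\<theta> 0) u v * form1 (?\<theta> 3) u v' - form1 (?\<theta> 3) u v * form1 (?\<theta> 0) u v'
                 - 3 * (form1 (?\<theta> 1) u v * form1 (?\<theta> 2) u v' - form1 (?\<theta> 2) u v * form1 (?\<theta> 1) u v'))" for u v v'
    unfolding \<theta> ext_deriv_contact_form by (simp add: cof_simps field_simps)
  have C: "tdiag 4 Upsilon u v = 1024 * ((form1 (?\<theta> 0) u v)^2 * (form1 (?\<theta> 3) u v)^2
      - 6 * form1 (?\<theta> 0) u v * form1 (?\<theta> 1) u v * form1 (?\<theta> 2) u v * form1 (?\<theta> 3) u v
      + 4 * form1 (?\<theta> 0) u v * (form1 (?\<theta> 2) u v)^3 + 4 * (form1 (?\<theta> 1) u v)^3 * form1 (?\<theta> 3) u v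
      - 3 * (form1 (?\<theta> 1) u v)^2 * (form1 (?\<theta> 2) u v)^2)" for u v
    unfolding tdiag_Upsilon discT_def disc_def \<theta> by simp
  show "\<exists>W \<theta> l m. open W \<and> u0 \<in> W \<and> W \<subseteq> U \<and>
        (\<forall>j<4. \<forall>i. R W (\<lambda>u. \<theta> (j::nat) u [i])) \<and> R W l \<and> R W m \<and>
        (\<forall>u\<in>W. l u \<noteq> 0 \<and> m u \<noteq> 0 \<and>
          (\<forall>v. form1 contact_form u v = 0 \<and> (\<forall>j<4. form1 (\<theta> j) u v = 0) \<longrightarrow> v = 0) \<and>
          (\<forall>v v'. form1 contact_form u v = 0 \<and> form1 contact_form u v' = 0 \<longrightarrow>
             ext_deriv contact_form u v v' =
               l u * (form1 (\<theta> 0) u v * form1 (\<theta> 3) u v' - form1 (\<theta> 3) u v * form1 (\<theta> 0) u v'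
                 - 3 * (form1 (\<theta> 1) u v * form1 (\<theta> 2) u v' - form1 (\<theta> 2) u v * form1 (\<theta> 1) u v'))) \<and>
          (\<forall>v. form1 contact_form u v = 0 \<longrightarrow>
             (let x0 = form1 (\<theta> 0) u v; x1 = form1 (\<theta> 1) u v;
                  x2 = form1 (\<theta> 2) u v; x3 = form1 (\<theta> 3) u v
              in tdiag 4 Upsilon u v = m u * (x0^2 * x3^2 - 6 * x0 * x1 * x2 * x3
                   + 4 * x0 * x2^3 + 4 * x1^3 * x3 - 3 * x1^2 * x2^2))))"
    by (intro exI[of _ U] exI[of _ ?\<theta>] exI[of _ "\<lambda>u. 8/3"] exI[of _ "\<lambda>u. 1024"] conjI allI ballI impI;
      (elim conjE)?; (unfold Let_def)?; (rule assms \<open>u0 \<in> U\<close> order.refl B C | rule A; assumption | simp; fail))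
qed

text \<open>On the common zero locus the coframe takes the values $(k, rk, r^2k, r^3k)$: the parameter $r=s^{1/3}$ is
  the one of the twisted cubic.\<close>

lemma Upsilon_vanishes_on_param_locus:
  fixes s :: "'k::real_normed_field"
  assumes r: "cube_root_branch D r" "s \<in> D"
    and v: "form1 (param_omega2 r s) u v = 0" "form1 (param_omega3 r s) u v = 0" "form1 (param_omega4 r s) u v = 0"
  shows "tdiag 4 Upsilon u v = 0"
proof -
  define \<rho> where "\<rho> = r s"
  have s: "\<rho> ^ 3 = s" "s - 1 \<noteq> 0" "2 * s + 1 \<noteq> 0" "\<rho> \<noteq> 0"
    using r cube_root_branch_deriv(2)[OF r] by (auto simp: \<rho>_def cube_root_branch_def add.commute)
  define k where "k = v $ Cx / (2 * s + 1)"
  have x: "v $ Cx = (2 * s + 1) * k" using s by (simp add: k_def)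
  have y: "v $ Cy = 2 * \<rho> ^ 2 * k"
    using v(3) s by (simp add: form1_def sum_coord param_omega4_def dcoord_def \<rho>_def[symmetric] x)
  have "v $ Cp = 4 / (3 * (s - 1)) * v $ Cx - 2 * \<rho> / (s - 1) * v $ Cy"
    using v(1) by (simp add: form1_def sum_coord param_omega2_def dcoord_def \<rho>_def[symmetric] algebra_simps)
  also have "\<dots> = (4 * (2 * s + 1) * k - 12 * \<rho> ^ 3 * k) / (3 * (s - 1))"
    unfolding x y using s(2) by (simp add: divide_simps) (simp add: algebra_simps power2_eq_square power3_eq_cube)
  also have "\<dots> = - (4/3) * k"
    unfolding s(1) using s(2) by (simp add: divide_simps) (simp add: algebra_simps)
  finally have p: "v $ Cp = - (4/3) * k" .
  have "v $ Cq = - (2 * \<rho> / (s - 1) * v $ Cx) - (1 - 4 * s) / (\<rho> * (s - 1)) * v $ Cy"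
    using v(2) by (simp add: form1_def sum_coord param_omega3_def dcoord_def \<rho>_def[symmetric] algebra_simps eq_neg_iff_add_eq_0)
  also have "\<dots> = 4 * \<rho> * k"
    unfolding x y using s(2,4) by (simp add: divide_simps) (simp add: algebra_simps power2_eq_square)
  finally have q: "v $ Cq = 4 * \<rho> * k" .
  have "cof 0 v = k" "cof (Suc 0) v = \<rho> * k" "cof 2 v = \<rho> ^ 2 * k" "cof 3 v = \<rho> ^ 3 * k"
    by (simp_all add: cof_simps x y p q s(1) field_simps)
  then show ?thesis
    unfolding tdiag_Upsilon discT_def disc_def by (simp add: algebra_simps eval_nat_numeral)
qed

lemma associated_Upsilon:
  fixes U :: "('k::{real_normed_field, euclidean_space} ^ coord) set"
  shows "associated_to_noth_param U Upsilon"
  unfolding associated_to_noth_param_def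
  using param_solves_noth Upsilon_vanishes_on_param_locus by (intro allI impI conjI ballI) blast+

text \<open>The class \<open>R\<close> lies between the polynomials and \<open>regular_on\<close>.
  The listed polynomial fields are symmetries with polynomial multipliers, and the symmetries in the
  largest class are already spanned by them, so every class in between has the same symmetry
  algebra.\<close>

locale regularity =
  fixes R :: "'k::{real_normed_field, euclidean_space} regularity" and U
  assumes U: "open U" "connected U" "U \<noteq> {}"
    and R_regular: "R U f \<Longrightarrow> regular_on U f"
    and R_poly: "polyfun f \<Longrightarrow> R U f"
    and R_cong: "\<lbrakk>\<And>v. v \<in> U \<Longrightarrow> f v = g v; R U f\<rbrakk> \<Longrightarrow> R U g"
begin

sublocale vv: vector_space "vf_scale :: 'k \<Rightarrow> _"
  by (rule vector_space_vf_scale)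

abbreviation "res \<equiv> restrict_vf U"

definition "L = vf_span (res ` set basis_list)"

lemma res_basis: "X \<in> set basis_list \<Longrightarrow> res X \<in> L"
  unfolding L_def by (intro vv.span_base imageI)

lemma basis_regular: "res ` set basis_list \<subseteq> regular_fields U"
proof clarify
  fix X :: "'k ^ coord \<Rightarrow> 'k ^ coord" assume X: "X \<in> set basis_list"
  have "regular_on U (\<lambda>u. X u $ i)" for i
    by (rule polyfun_regular[OF polyfun_basis[OF X]])
  moreover have "regular_on U (\<lambda>u. res X u $ i) \<longleftrightarrow> regular_on U (\<lambda>u. X u $ i)" for i
    by (rule regular_on_cong[OF U(1)]) (simp add: restrict_vf_def)
  ultimately show "res X \<in> regular_fields U"
    by (simp add: regular_fields_def) (simp add: restrict_vf_def)
qed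

lemma lie_algebra_L: "lie_algebra vf_scale L (vf_bracket U)"
  unfolding L_def using basis_regular basis_closed[OF U(1)] by (rule lie_algebra_span[OF U(1)])

text \<open>Polynomial Hamiltonians keep the multipliers constructed in
  \<open>hamiltonian_imp_symmetry\<close> polynomial, hence in \<open>R\<close>.\<close>

lemma L_has_hamiltonian:
  assumes "X \<in> L"
  shows "\<exists>P f. X = res P \<and> (\<forall>m. polyfun (\<lambda>u. P u $ m)) \<and> polyfun f \<and> hamiltonian_on U P f \<and> symmetry_equations U f"
  using assms unfolding L_def
proof (induction rule: vv.span_induct_alt)
  case base
  have "hamiltonian_on U 0 (\<lambda>u. 0)" "symmetry_equations U (\<lambda>u. 0)"
    by (simp_all add: hamiltonian_on_def symmetry_equations_def fr_defs[abs_def] poly_partial)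
  moreover have "polyfun (\<lambda>u. (0 :: 'k ^ coord \<Rightarrow> 'k ^ coord) u $ m)" for m
    by (simp add: polyfun_const)
  ultimately show ?case
    by (intro exI[of _ 0] exI[of _ "\<lambda>u. 0"] conjI allI restrict_vf_linear(1)[symmetric] polyfun_const)
next
  case (step c X Y)
  obtain P f where P: "Y = res P" "\<And>m. polyfun (\<lambda>u. P u $ m)" "polyfun f" "hamiltonian_on U P f" "symmetry_equations U f"
    using step.IH by blast
  obtain Q where Q: "Q \<in> set basis_list" "X = res Q" using step.hyps by blast
  then obtain f' where f': "(Q, f') \<in> set generators" using fst_generators by force
  note g = generators_regular[OF f']
  have "vf_scale c X + Y = res (vf_scale c Q + P)"
    by (simp only: P(1) Q(2) restrict_vf_linear)
  moreover have "polyfun (\<lambda>u. (vf_scale c Q + P) u $ m)" for m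
    using polyfun_basis[OF Q(1), of m] P(2)[of m] by (simp add: vf_scale_def polyfun_intros)
  moreover have "polyfun (\<lambda>u. c * f' u + f u)"
    using g(1) P(3) by (intro polyfun_intros)
  ultimately show ?case
    using hamiltonian_linear[OF U(1) polyfun_regular[OF g(1)] g(2) polyfun_regular[OF P(3)] P(4)]
      symmetry_equations_linear[OF U(1) polyfun_regular[OF g(1)] g(3) polyfun_regular[OF P(3)] P(5)]
    by blast
qed

text \<open>That \<open>L\<close> consists of symmetries is a verification with polynomial data. The
  converse passes to the Hamiltonian, where the prolongation bounds the solution space.\<close>

lemma symmetry_algebra_eq: "symmetry_algebra R U contact_form Upsilon = L"
proof (intro equalityI subsetI)
  fix X assume "X \<in> L"
  then obtain P f where P: "X = res P" "\<And>m. polyfun (\<lambda>u. P u $ m)" "polyfun f" "hamiltonian_on U P f" "symmetry_equations U f"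
    using L_has_hamiltonian by blast
  show "X \<in> symmetry_algebra R U contact_form Upsilon"
    unfolding P(1)
  proof (rule hamiltonian_imp_symmetry[where P = P and f = f])
    show "R U h'" if "\<And>v. v \<in> U \<Longrightarrow> h v = h' v" "R U h" for h h'
      using that by (rule R_cong)
  qed (use U(1) R_poly P(2-5) in blast)+
next
  fix X assume X: "X \<in> symmetry_algebra R U contact_form Upsilon"
  then obtain lam \<phi> \<sigma> where reg: "\<And>i. R U (\<lambda>u. X u $ i)" and out: "\<And>u. u \<notin> U \<Longrightarrow> X u = 0"
    and w: "\<And>u i. u \<in> U \<Longrightarrow> lie_deriv X contact_form u [i] = lam u * contact_form u [i]"
    and Y: "\<And>u I. u \<in> U \<Longrightarrow> length I = 4 \<Longrightarrow> lie_deriv X Upsilon u I = \<phi> u * Upsilon u I + (contact_form \<odot> \<sigma>) u I"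
    unfolding symmetry_algebra_def by blast
  note h = symmetry_imp_hamiltonian[OF U(1) R_regular[OF reg] w Y refl]
  show "X \<in> L"
    unfolding L_def fst_generators[symmetric]
    by (rule hamiltonian_in_span[OF U(1,2) h(1,3,2) out])
qed

lemma bracket_res: "vf_bracket U (res X) (res Y) = res (bracket X Y)"
  by (rule vf_bracket_restrict[OF U(1)])

lemma clock_field_basis: "i \<in> {1..12} \<Longrightarrow> clock_field i \<in> set basis_list"
  unfolding clock_set by (elim insertE emptyE; simp add: basis_list_def)

lemma h1_basis: "h1 \<in> set basis_list" and E_basis: "E_field \<in> set basis_list"
  by (simp_all add: basis_list_def)

text \<open>If one root field vanished on \<open>U\<close>, going round the clock would make all of
  them vanish, among them \<open>L6\<close>, the coordinate field of \<open>z\<close>.\<close>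

lemma clock_field_nonzero:
  assumes i: "i \<in> {1..12}"
  shows "res (clock_field i) \<noteq> 0"
proof
  interpret lie_algebra vf_scale L "vf_bracket U" by (rule lie_algebra_L)
  assume z: "res (clock_field i) = 0"
  have nxt: "res (clock_field (if j = 12 then 1 else Suc j)) = 0" if j: "j \<in> {1..12}" "res (clock_field j) = 0" for j
  proof -
    obtain X and c :: 'k where X: "X \<in> set basis_list" "c \<noteq> 0"
      "bracket X (clock_field j) = vf_scale c (clock_field (if j = 12 then 1 else Suc j))"
      using clock_next[OF j(1)] by blast
    have "res (bracket X (clock_field j)) = 0"
      unfolding bracket_res[symmetric] j(2) by (rule br_zero_right[OF res_basis[OF X(1)]])
    then have "vf_scale c (res (clock_field (if j = 12 then 1 else Suc j))) = 0"
      unfolding X(3) restrict_vf_linear .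
    then show ?thesis using X(2) by (simp only: vv.scale_eq_0_iff simp_thms)
  qed
  have up: "res (clock_field j) = 0" if "k \<le> j" "k \<in> {1..12}" "res (clock_field k) = 0" "j \<le> 12" for j k
    using that
  proof (induction rule: dec_induct)
    case (step n)
    have n: "n \<in> {1..12}" "n \<noteq> 12" using step.hyps step.prems by auto
    have "res (clock_field n) = 0" by (rule step.IH) (rule step.prems Suc_leD | assumption)+
    from nxt[OF n(1) this] show ?case by (simp only: n(2) if_False)
  qed
  have "res (clock_field 12) = 0" using up[of i 12] i z by auto
  then have "res (clock_field 1) = 0" using nxt[of 12] by simp
  then have "res L6 = 0" using up[of 1 6] by simp
  moreover obtain u where "u \<in> U" using U(3) by blast
  ultimately have "L6 u = (0 :: 'k ^ coord)"
    by (metis restrict_vf_def zero_fun_apply)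
  then have "L6 u $ Cz = (0 :: 'k)" by simp
  then show False by (simp add: L6_def in_coords_def)
qed

abbreviation "A \<equiv> vf_scale 2 (res h1)"
abbreviation "E \<equiv> res E_field"

lemma span_h: "vf_span {A, E} = vf_span {res h1, res h2}"
proof (intro equalityI vv.span_minimal vv.subspace_span)
  have s: "inverse (of_real (sqrt 3 / 2)) * of_real (sqrt 3 / 2) = (1 :: 'k)"
    by (rule field_class.field_inverse) simp
  have "E = vf_scale (inverse (of_real (sqrt 3 / 2))) (res h2)"
    unfolding h2_eq restrict_vf_linear vf_scale_simps(1) s vf_scale_simps(2) ..
  moreover have "vf_scale (inverse (of_real (sqrt 3 / 2))) (res h2) \<in> vf_span {res h1, res h2}"
    by (intro vv.span_scale vv.span_base) simp
  moreover have "A \<in> vf_span {res h1, res h2}"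
    by (intro vv.span_scale vv.span_base) simp
  ultimately show "{A, E} \<subseteq> vf_span {res h1, res h2}" by simp
  have "res h1 = vf_scale (1/2) A" by (simp add: vf_scale_simps)
  moreover have "vf_scale (1/2) A \<in> vf_span {A, E}"
    by (intro vv.span_scale vv.span_base) simp
  moreover have "res h2 \<in> vf_span {A, E}"
    unfolding h2_eq restrict_vf_linear by (intro vv.span_scale vv.span_base) simp
  ultimately show "{res h1, res h2} \<subseteq> vf_span {A, E}" by simp
qed

lemma clock_fields: "clock_field ` {1..12} \<union> {h1, E_field} = set basis_list"
  unfolding clock_set image_insert image_empty by (simp add: basis_list_def insert_commute)

lemma clock_basis_L: "clock_basis vf_scale L (vf_bracket U) (\<lambda>i. res (clock_field i)) A E"
proof -
  interpret lie_algebra vf_scale L "vf_bracket U" by (rule lie_algebra_L)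
  have "vf_span ((\<lambda>i. res (clock_field i)) ` {1..12} \<union> {A, E}) = L"
  proof (intro equalityI vv.span_minimal vv.subspace_span)
    show "(\<lambda>i. res (clock_field i)) ` {1..12} \<union> {A, E} \<subseteq> L"
      using res_basis[OF clock_field_basis] res_basis[OF h1_basis] res_basis[OF E_basis]
      unfolding L_def by (auto intro: vv.span_scale)
    show "vv.subspace L" unfolding L_def by (rule vv.subspace_span)
    let ?S = "vf_span ((\<lambda>i. res (clock_field i)) ` {1..12} \<union> {A, E})"
    have "vf_scale (1/2) A \<in> ?S" by (intro vv.span_scale vv.span_base) simp
    then have "res h1 \<in> ?S" by (simp add: vf_scale_simps)
    moreover have "E \<in> ?S" "\<And>i. i \<in> {1..12} \<Longrightarrow> res (clock_field i) \<in> ?S"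
      by (rule vv.span_base; blast)+
    ultimately have "res ` (clock_field ` {1..12} \<union> {h1, E_field}) \<subseteq> ?S" by blast
    then show "L \<subseteq> ?S"
      unfolding L_def clock_fields by (intro vv.span_minimal vv.subspace_span)
  qed
  moreover have "\<exists>X\<in>L. \<exists>c. c \<noteq> 0 \<and> vf_bracket U X (res (clock_field i)) = vf_scale c (res (clock_field (if i = 12 then 1 else Suc i)))"
    if i: "i \<in> {1..12}" for i
  proof -
    obtain X and c :: 'k where X: "X \<in> set basis_list" "c \<noteq> 0"
      "bracket X (clock_field i) = vf_scale c (clock_field (if i = 12 then 1 else Suc i))"
      using clock_next[OF i] by blast
    have "vf_bracket U (res X) (res (clock_field i)) = vf_scale c (res (clock_field (if i = 12 then 1 else Suc i)))"
      unfolding bracket_res X(3) restrict_vf_linear ..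
    then show ?thesis using X(2) res_basis[OF X(1)] by blast
  qed
  moreover have "vf_bracket U A (res (clock_field i)) = vf_scale (of_int (clock_A i)) (res (clock_field i))"
    if i: "i \<in> {1..12}" for i
    using br_scale_left[OF res_basis[OF h1_basis] res_basis[OF clock_field_basis[OF i]], of 2]
    by (simp add: bracket_res clock_weights[OF i] restrict_vf_linear vf_scale_simps)
  moreover have "vf_bracket U E (res (clock_field i)) = vf_scale (of_int (clock_E i)) (res (clock_field i))"
    if i: "i \<in> {1..12}" for i
    by (simp only: bracket_res clock_weights[OF i] restrict_vf_linear)
  moreover have "vf_bracket U A E = 0"
    using br_scale_left[OF res_basis[OF h1_basis] res_basis[OF E_basis], of 2]
    by (simp add: bracket_res bracket_rules restrict_vf_linear vf_scale_simps)
  moreover have "\<exists>c. c \<noteq> 0 \<and> vf_bracket U (res (clock_field 3)) (res (clock_field 9)) = vf_scale c A"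
    \<comment> \<open>\<open>S3\<close> and \<open>S9\<close> bracket to \<open>- h1\<close>, and
      \<open>A\<close> is twice \<open>h1\<close>.\<close>
    by (rule exI[of _ "- (1/2)"]; simp add: bracket_res bracket_rules; simp add: vf_scale_def restrict_vf_def fun_eq_iff)
  moreover have "\<exists>c. c \<noteq> 0 \<and> vf_bracket U (res (clock_field 6)) (res (clock_field 12)) = vf_scale c E"
    by (rule exI[of _ "- 3"]; simp add: bracket_res bracket_rules; simp add: vf_scale_def restrict_vf_def fun_eq_iff)
  ultimately show ?thesis
    by (intro clock_basis.intro clock_basis_axioms.intro lie_algebra_L clock_field_nonzero) assumption+
qed

lemma root_vectors:
  assumes "(X, a, b) \<in> root_table"
  shows "res X \<noteq> 0" "vf_bracket U (res h1) (res X) = vf_scale (of_real a) (res X)"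
    "vf_bracket U (res h2) (res X) = vf_scale (of_real b) (res X)"
proof -
  interpret lie_algebra vf_scale L "vf_bracket U" by (rule lie_algebra_L)
  obtain i where i: "i \<in> {1..12}" "X = clock_field i" "a = of_int (clock_A i) / 2" "b = sqrt 3 / 2 * of_int (clock_E i)"
    using assms unfolding root_table_eq by blast
  show "res X \<noteq> 0" unfolding i(2) by (rule clock_field_nonzero[OF i(1)])
  show "vf_bracket U (res h1) (res X) = vf_scale (of_real a) (res X)"
    by (simp add: i bracket_res clock_weights[OF i(1)] restrict_vf_linear)
  show "vf_bracket U (res h2) (res X) = vf_scale (of_real b) (res X)"
    unfolding h2_eq restrict_vf_linear i(2)
      br_scale_left[OF res_basis[OF E_basis] res_basis[OF clock_field_basis[OF i(1)]]]
    by (simp add: i(4) bracket_res clock_weights[OF i(1)] restrict_vf_linear vf_scale_simps)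
qed

lemma span_listed: "L = vf_span (res ` {S1, L2, S3, L4, S5, L6, S7, L8, S9, L10, S11, L12, h1, h2})"
proof -
  let ?T = "{S1, L2, S3, L4, S5, L6, S7, L8, S9, L10, S11, L12, h1} :: ('k ^ coord \<Rightarrow> 'k ^ coord) set"
  let ?c = "of_real (sqrt 3 / 2) :: 'k"
  have b: "set basis_list = insert E_field ?T" by (simp add: basis_list_def insert_commute)
  have c: "{S1, L2, S3, L4, S5, L6, S7, L8, S9, L10, S11, L12, h1, h2} = insert h2 ?T" by blast
  have s: "inverse ?c * ?c = 1" by (rule field_class.field_inverse) simp
  have h2: "res h2 = vf_scale ?c E" unfolding h2_eq restrict_vf_linear ..
  have E: "E = vf_scale (inverse ?c) (res h2)"
    unfolding h2 vf_scale_simps(1) s vf_scale_simps(2) ..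
  have "vf_span (insert E (res ` ?T)) = vf_span (insert (res h2) (res ` ?T))"
  proof (intro equalityI vv.span_minimal vv.subspace_span)
    have "vf_scale (inverse ?c) (res h2) \<in> vf_span (insert (res h2) (res ` ?T))"
      by (intro vv.span_scale vv.span_base) simp
    then show "insert E (res ` ?T) \<subseteq> vf_span (insert (res h2) (res ` ?T))"
      unfolding E[symmetric] using vv.span_superset[of "insert (res h2) (res ` ?T)"] by blast
    have "vf_scale ?c E \<in> vf_span (insert E (res ` ?T))"
      by (intro vv.span_scale vv.span_base) simp
    then show "insert (res h2) (res ` ?T) \<subseteq> vf_span (insert E (res ` ?T))"
      unfolding h2[symmetric] using vv.span_superset[of "insert E (res ` ?T)"] by blast
  qed
  then show ?thesis unfolding L_def b c image_insert .
qed

theorem symmetry_algebra_G2: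
  "let g = symmetry_algebra R U contact_form Upsilon;
       res = restrict_vf U;
       h = vf_span {res h1, res h2}
   in contact_structure_G2 R U contact_form Upsilon \<and>
      associated_to_noth_param U Upsilon \<and>
      lie_algebra vf_scale g (vf_bracket U) \<and>
      lie_algebra.split_simple_G2 vf_scale g (vf_bracket U) \<and>
      vf_dim g = 14 \<and>
      g = vf_span (res ` {S1, L2, S3, L4, S5, L6, S7, L8, S9, L10, S11, L12, h1, h2}) \<and>
      lie_algebra.splitting_cartan vf_scale g (vf_bracket U) h \<and>
      lie_algebra.roots_type_G2 vf_scale g (vf_bracket U) h \<and>
      (\<forall>(X, a, b) \<in> root_table. res X \<noteq> 0 \<and>
         vf_bracket U (res h1) (res X) = vf_scale (of_real a) (res X) \<and>
         vf_bracket U (res h2) (res X) = vf_scale (of_real b) (res X))"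
proof -
  interpret cb: clock_basis vf_scale L "vf_bracket U" "\<lambda>i. res (clock_field i)" A E
    by (rule clock_basis_L)
  show ?thesis
    unfolding Let_def symmetry_algebra_eq span_h[symmetric]
  proof (intro conjI)
    show "contact_structure_G2 R U contact_form Upsilon"
      by (rule contact_structure_Upsilon[OF U(1)]) (intro R_poly polyfun_const)
    show "\<forall>(X, a, b) \<in> root_table. res X \<noteq> 0 \<and>
         vf_bracket U (res h1) (res X) = vf_scale (of_real a) (res X) \<and>
         vf_bracket U (res h2) (res X) = vf_scale (of_real b) (res X)"
      using root_vectors by blast
  qed (rule associated_Upsilon lie_algebra_L cb.split_simple cb.dim_L span_listed cb.splitting cb.roots_G2)+
qed

end

lemma regularity_smooth:
  assumes "open U" "connected U" "U \<noteq> {}"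
  shows "regularity smooth_fn_on U"
proof
  show "smooth_fn_on U g" if "\<And>v. v \<in> U \<Longrightarrow> f v = g v" "smooth_fn_on U f" for f g
    using smooth_fn_on_cong[OF assms(1), of f g] that by blast
qed (use assms smooth_imp_regular polyfun_smooth in auto)

lemma regularity_holomorphic:
  assumes "open V" "connected V" "V \<noteq> {}"
  shows "regularity holomorphic_fn_on V"
proof
  show "holomorphic_fn_on V g" if "\<And>v. v \<in> V \<Longrightarrow> f v = g v" "holomorphic_fn_on V f" for f g
    using holomorphic_fn_on_cong[OF assms(1), of f g] that by blast
qed (use assms holomorphic_imp_regular polyfun_holomorphic in auto)

theorem theorem4p2:
  fixes U :: "(real ^ coord) set" and V :: "(complex ^ coord) set"
  assumes "open U" "connected U" "U \<noteq> {}"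
    and "open V" "connected V" "V \<noteq> {}"
  shows
    "(let g = symmetry_algebra smooth_fn_on U contact_form Upsilon;
           res = restrict_vf U;
           h = vf_span {res h1, res h2}
       in contact_structure_G2 smooth_fn_on U contact_form Upsilon \<and>
          associated_to_noth_param U Upsilon \<and>
          lie_algebra vf_scale g (vf_bracket U) \<and>
          lie_algebra.split_simple_G2 vf_scale g (vf_bracket U) \<and>
          vf_dim g = 14 \<and>
          g = vf_span (res ` {S1, L2, S3, L4, S5, L6, S7, L8, S9, L10, S11, L12, h1, h2}) \<and>
          lie_algebra.splitting_cartan vf_scale g (vf_bracket U) h \<and>
          lie_algebra.roots_type_G2 vf_scale g (vf_bracket U) h \<and>
          (\<forall>(X, a, b) \<in> root_table. res X \<noteq> 0 \<and>
             vf_bracket U (res h1) (res X) = vf_scale (of_real a) (res X) \<and>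
             vf_bracket U (res h2) (res X) = vf_scale (of_real b) (res X)))
     \<and>
     (let g = symmetry_algebra holomorphic_fn_on V contact_form Upsilon;
           res = restrict_vf V;
           h = vf_span {res h1, res h2}
       in contact_structure_G2 holomorphic_fn_on V contact_form Upsilon \<and>
          associated_to_noth_param V Upsilon \<and>
          lie_algebra vf_scale g (vf_bracket V) \<and>
          lie_algebra.split_simple_G2 vf_scale g (vf_bracket V) \<and>
          vf_dim g = 14 \<and>
          g = vf_span (res ` {S1, L2, S3, L4, S5, L6, S7, L8, S9, L10, S11, L12, h1, h2}) \<and>
          lie_algebra.splitting_cartan vf_scale g (vf_bracket V) h \<and>
          lie_algebra.roots_type_G2 vf_scale g (vf_bracket V) h \<and>
          (\<forall>(X, a, b) \<in> root_table. res X \<noteq> 0 \<and>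
             vf_bracket V (res h1) (res X) = vf_scale (of_real a) (res X) \<and>
             vf_bracket V (res h2) (res X) = vf_scale (of_real b) (res X)))"
  using regularity.symmetry_algebra_G2[OF regularity_smooth[OF assms(1-3)]]
    regularity.symmetry_algebra_G2[OF regularity_holomorphic[OF assms(4-6)]]
  by (rule conjI)

end
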